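(* Assume that $q_i\mid q_{i+1}$ for $i=1,\ldots,n-1$, and consider the degree reverse lexicographic order on $R$. Then for any homogeneous ideal $I\subseteq R$, $$\operatorname{depth} R/I=\operatorname{depth} R/\operatorname{Gin}(I).$$
   Context: Setting: $K$ is an infinite field of characteristic $0$ and $R=K[\mathbf{X_1},\ldots,\mathbf{X_n}]$ is a polynomial ring in the groups of variables $\mathbf{X_i}=(X_{i1},\ldots,X_{il_i})$, graded by $\deg X_{ij}=q_i$ for $j=1,\ldots,l_i$, where $0<q_1<q_2<\cdots<q_n$ are integers. Depth is taken with respect to the graded maximal ideal generated by all the variables. Degree reverse lexicographic order: list the variables as $X_{11},\ldots,X_{1l_1},X_{21},\ldots,X_{nl_n}$; then $u>v$ if the weighted degree of $u$ is larger than that of $v$, or the weighted degrees are equal and the last nonzero entry of (exponent vector of $u$) $-$ (exponent vector of $v$) is negative. Generic initial ideal: the graded $K$-algebra automorphisms of $R$ are the maps $X_{ij}\mapsto\sum_{h}a^i_{jh}X_{ih}+\psi_{ij}$ with $(a^i_{jh})_{j,h}$ invertible and $\psi_{ij}\in K[\mathbf{X_1},\ldots,\mathbf{X_{i-1}}]$ homogeneous of degree $q_i$ (possibly zero); via these coefficients the group $\operatorname{Aut}(R)$ of graded automorphisms is a Zariski-open subset of an affine space. For a homogeneous ideal $I$ there is a nonempty Zariski-open subset of $\operatorname{Aut}(R)$ on which the initial ideal $\operatorname{in}(gI)$ is constant; this monomial ideal is $\operatorname{Gin}(I)$. *)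

theory Defs
  imports
    "HOL-Algebra.QuotRing"
    "HOL-Algebra.Module"
    "HOL-Library.Poly_Mapping"
    "HOL-Library.Extended_Nat"
begin

section \<open>The weighted polynomial ring\<close>

text \<open>The variable $X_{ij}$ is the index pair \<open>(i, j)\<close>. Monomials are finitely supported
  exponent vectors and polynomials are finitely supported coefficient functions on monomials; the
  product of \<open>Poly_Mapping\<close> is then the usual (convolution) product of polynomials.\<close>

type_synonym var = "nat \<times> nat"
type_synonym 'x mono = "'x \<Rightarrow>\<^sub>0 nat"
type_synonym ('x, 'k) mpoly = "'x mono \<Rightarrow>\<^sub>0 'k"

definition indets :: "('x, 'k::zero) mpoly \<Rightarrow> 'x set" where
  "indets f = (\<Union>m\<in>Poly_Mapping.keys f. Poly_Mapping.keys m)"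

definition monomial :: "'x mono \<Rightarrow> ('x, 'k::comm_ring_1) mpoly" where
  "monomial m = Poly_Mapping.single m 1"

definition const :: "'k \<Rightarrow> ('x, 'k::comm_ring_1) mpoly" where
  "const c = Poly_Mapping.single 0 c"

definition indet :: "'x \<Rightarrow> ('x, 'k::comm_ring_1) mpoly" where
  "indet v = monomial (Poly_Mapping.single v 1)"

definition eval_mpoly :: "('x \<Rightarrow> 'k) \<Rightarrow> ('x, 'k::comm_ring_1) mpoly \<Rightarrow> 'k" where
  "eval_mpoly c f = (\<Sum>m\<in>Poly_Mapping.keys f. Poly_Mapping.lookup f m *
      (\<Prod>v\<in>Poly_Mapping.keys m. c v ^ Poly_Mapping.lookup m v))"

definition vars :: "nat \<Rightarrow> (nat \<Rightarrow> nat) \<Rightarrow> var set" where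
  "vars n l = (SIGMA i:{1..n}. {1..l i})"

definition poly_ring :: "nat \<Rightarrow> (nat \<Rightarrow> nat) \<Rightarrow> (var, 'k::comm_ring_1) mpoly ring" where
  "poly_ring n l = \<lparr>carrier = {f. indets f \<subseteq> vars n l}, mult = (*), one = 1, zero = 0, add = (+)\<rparr>"

definition wdeg :: "(nat \<Rightarrow> nat) \<Rightarrow> var mono \<Rightarrow> nat" where
  "wdeg q m = (\<Sum>v\<in>Poly_Mapping.keys m. q (fst v) * Poly_Mapping.lookup m v)"

definition homogeneous :: "(nat \<Rightarrow> nat) \<Rightarrow> nat \<Rightarrow> (var, 'k::zero) mpoly \<Rightarrow> bool" where
  "homogeneous q d f \<longleftrightarrow> (\<forall>m\<in>Poly_Mapping.keys f. wdeg q m = d)"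

definition hom_component :: "(nat \<Rightarrow> nat) \<Rightarrow> nat \<Rightarrow> (var, 'k::comm_ring_1) mpoly \<Rightarrow> (var, 'k) mpoly" where
  "hom_component q d f = (\<Sum>m\<in>{m \<in> Poly_Mapping.keys f. wdeg q m = d}.
      Poly_Mapping.single m (Poly_Mapping.lookup f m))"

definition homogeneous_ideal ::
  "nat \<Rightarrow> (nat \<Rightarrow> nat) \<Rightarrow> (nat \<Rightarrow> nat) \<Rightarrow> (var, 'k::comm_ring_1) mpoly set \<Rightarrow> bool" where
  "homogeneous_ideal n l q I \<longleftrightarrow>
     ideal I (poly_ring n l) \<and> (\<forall>f\<in>I. \<forall>d. hom_component q d f \<in> I)"

definition irrelevant_ideal :: "nat \<Rightarrow> (nat \<Rightarrow> nat) \<Rightarrow> (var, 'k::comm_ring_1) mpoly set" where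
  "irrelevant_ideal n l = Idl\<^bsub>poly_ring n l\<^esub> (indet ` vars n l)"


section \<open>Initial ideals for the degree reverse lexicographic order\<close>

text \<open>\<open>var_after w v\<close>: the variable \<open>w\<close> comes after \<open>v\<close> in the list
  $X_{11},\ldots,X_{1l_1},X_{21},\ldots,X_{nl_n}$.\<close>

definition var_after :: "var \<Rightarrow> var \<Rightarrow> bool" where
  "var_after w v \<longleftrightarrow> fst v < fst w \<or> fst v = fst w \<and> snd v < snd w"

text \<open>In \<open>drl_greater\<close> the variable \<open>v\<close> is the position of the last nonzero entry of the
  difference of the exponent vectors.\<close>

definition drl_greater :: "(nat \<Rightarrow> nat) \<Rightarrow> var mono \<Rightarrow> var mono \<Rightarrow> bool" where
  "drl_greater q s t \<longleftrightarrow> wdeg q s > wdeg q t \<or>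
     wdeg q s = wdeg q t \<and>
     (\<exists>v. Poly_Mapping.lookup s v < Poly_Mapping.lookup t v \<and>
          (\<forall>w. var_after w v \<longrightarrow> Poly_Mapping.lookup s w = Poly_Mapping.lookup t w))"

definition lead_mono :: "(nat \<Rightarrow> nat) \<Rightarrow> (var, 'k::zero) mpoly \<Rightarrow> var mono" where
  "lead_mono q f = (THE s. s \<in> Poly_Mapping.keys f \<and>
      (\<forall>t\<in>Poly_Mapping.keys f. t \<noteq> s \<longrightarrow> drl_greater q s t))"

definition initial_ideal ::
  "nat \<Rightarrow> (nat \<Rightarrow> nat) \<Rightarrow> (nat \<Rightarrow> nat) \<Rightarrow> (var, 'k::comm_ring_1) mpoly set \<Rightarrow> (var, 'k) mpoly set" where
  "initial_ideal n l q J = Idl\<^bsub>poly_ring n l\<^esub> {monomial (lead_mono q f) | f. f \<in> J \<and> f \<noteq> 0}"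


section \<open>Graded automorphisms and the generic initial ideal\<close>

text \<open>Only the values on the carrier of \<open>poly_ring n l\<close> matter below; two functions agreeing there
  represent the same automorphism.\<close>

definition graded_auts ::
  "nat \<Rightarrow> (nat \<Rightarrow> nat) \<Rightarrow> (nat \<Rightarrow> nat) \<Rightarrow> ((var, 'k::comm_ring_1) mpoly \<Rightarrow> (var, 'k) mpoly) set" where
  "graded_auts n l q = {g \<in> ring_iso (poly_ring n l) (poly_ring n l).
     (\<forall>c. g (const c) = const c) \<and>
     (\<forall>d. \<forall>f\<in>carrier (poly_ring n l). homogeneous q d f \<longrightarrow> homogeneous q d (g f))}"

text \<open>A graded automorphism \<open>g\<close> is given by the coefficients of $g(X_{ij})$ at the monomials
  of degree $q_i$. As $0 < q_1 < \cdots < q_n$, these monomials are the variables $X_{ih}$, whose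
  coefficients are the $a^i_{jh}$, and the monomials of degree $q_i$ in the variables of the groups
  before the $i$-th, whose coefficients are those of $\psi_{ij}$. The set \<open>aut_coords\<close> indexes the
  coordinates of the affine space that contains the automorphism group.\<close>

definition aut_coords :: "nat \<Rightarrow> (nat \<Rightarrow> nat) \<Rightarrow> (nat \<Rightarrow> nat) \<Rightarrow> (var \<times> var mono) set" where
  "aut_coords n l q = {(v, m). v \<in> vars n l \<and> Poly_Mapping.keys m \<subseteq> vars n l \<and> wdeg q m = q (fst v)}"

definition aut_coord :: "((var, 'k::comm_ring_1) mpoly \<Rightarrow> (var, 'k) mpoly) \<Rightarrow> var \<times> var mono \<Rightarrow> 'k" where
  "aut_coord g = (\<lambda>(v, m). Poly_Mapping.lookup (g (indet v)) m)"

definition zariski_open_auts ::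
  "nat \<Rightarrow> (nat \<Rightarrow> nat) \<Rightarrow> (nat \<Rightarrow> nat) \<Rightarrow> ((var, 'k::comm_ring_1) mpoly \<Rightarrow> (var, 'k) mpoly) set \<Rightarrow> bool" where
  "zariski_open_auts n l q U \<longleftrightarrow>
     (\<exists>P :: (var \<times> var mono, 'k) mpoly set. (\<forall>p\<in>P. indets p \<subseteq> aut_coords n l q) \<and>
        U = {g \<in> graded_auts n l q. \<exists>p\<in>P. eval_mpoly (aut_coord g) p \<noteq> 0})"

definition Gin ::
  "nat \<Rightarrow> (nat \<Rightarrow> nat) \<Rightarrow> (nat \<Rightarrow> nat) \<Rightarrow> (var, 'k::comm_ring_1) mpoly set \<Rightarrow> (var, 'k) mpoly set" where
  "Gin n l q I = (THE J. \<exists>U. zariski_open_auts n l q U \<and> U \<noteq> {} \<and>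
     (\<forall>g\<in>U. initial_ideal n l q (g ` I) = J))"


section \<open>Depth\<close>

definition quot_module :: "('a, 'm) ring_scheme \<Rightarrow> 'a set \<Rightarrow> ('a, 'a set) module" where
  "quot_module R I = \<lparr>carrier = carrier (R Quot I), mult = mult (R Quot I), one = one (R Quot I),
     zero = zero (R Quot I), add = add (R Quot I),
     smult = (\<lambda>r C. mult (R Quot I) (I +>\<^bsub>R\<^esub> r) C)\<rparr>"

text \<open>The submodule $(x_1,\ldots,x_k)M$:\<close>

definition seq_mult_module :: "('a, 'm) ring_scheme \<Rightarrow> ('a, 'b, 'n) module_scheme \<Rightarrow> 'a list \<Rightarrow> 'b set" where
  "seq_mult_module R M xs =
     \<Inter>{N. submodule N R M \<and> (\<forall>x\<in>set xs. \<forall>u\<in>carrier M. x \<odot>\<^bsub>M\<^esub> u \<in> N)}"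

text \<open>$x_i$ is a nonzerodivisor on $M/(x_1,\ldots,x_{i-1})M$ for all $i$, and
  $M \neq (x_1,\ldots,x_r)M$:\<close>

definition regular_seq :: "('a, 'm) ring_scheme \<Rightarrow> ('a, 'b, 'n) module_scheme \<Rightarrow> 'a list \<Rightarrow> bool" where
  "regular_seq R M xs \<longleftrightarrow> set xs \<subseteq> carrier R \<and>
     (\<forall>i<length xs. \<forall>u\<in>carrier M. (xs ! i) \<odot>\<^bsub>M\<^esub> u \<in> seq_mult_module R M (take i xs)
         \<longrightarrow> u \<in> seq_mult_module R M (take i xs)) \<and>
     seq_mult_module R M xs \<noteq> carrier M"

text \<open>Depth with respect to the ideal \<open>A\<close>; the zero module has infinite depth by convention.\<close>

definition depth :: "('a, 'm) ring_scheme \<Rightarrow> 'a set \<Rightarrow> ('a, 'b, 'n) module_scheme \<Rightarrow> enat" where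
  "depth R A M = (if carrier M = {\<zero>\<^bsub>M\<^esub>} then \<infinity>
     else Sup {enat (length xs) | xs. set xs \<subseteq> A \<and> regular_seq R M xs})"

end

theory Submission
  imports Defs "HOL-Computational_Algebra.Polynomial"
begin

text \<open>Write $L(J)$ for the set of leading monomials of a homogeneous ideal $J$; it determines the
  initial ideal. Three facts carry the theorem.

  The first is about ideals $J$ for which $L(J)$ is strongly stable: replacing one variable of a monomial
  in $L(J)$ by a monomial of the same weighted degree in earlier variables never leaves $L(J)$. In the
  degree reverse lexicographic order the monomials that involve the last variables are the smallest
  ones of their degree (\<open>drl_avoiding_greater_meeting\<close>), so adding the last variables to $J$
  adds to $L(J)$ just the monomials that involve them (\<open>leads_adjoin_vars\<close>). Therefore $L(J)$
  decides how many of the variables, taken from the last one backwards, form a regular sequence on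
  $R/J$. Let $x$ be the first variable at which regularity fails, and let $J'$ be $J$ together with the
  variables after $x$. If $ux$ is a leading monomial of $J'$ but $u$ is not, then strong stability
  turns $ux$ into $uy^a$ for every earlier variable $y$, where $a$ is the quotient of the weights of
  $x$ and $y$; this is where the divisibility of the weights enters. So $(J' : x)/J'$ is nonzero and
  lives in finitely many degrees, and an element of its highest degree is annihilated by all variables
  (\<open>socle_if_zero_divisor\<close>). If regularity never fails, the class of $1$ has this property at
  the end. In both cases the length of the regular sequence depends on $L(J)$ only
  (\<open>stable_regular_socle\<close>).

  The second fact is that such a regular sequence computes the depth: once a nonzero element of the
  quotient is annihilated by the irrelevant ideal, no regular sequence can be longer
  (\<open>regular_length_le_if_socle\<close>). This is the invariance of the grade, and it is obtained from
  the vanishing of Koszul cohomology below the length of a regular sequence.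

  The third fact is that $L(gI)$ is constant and strongly stable for generic $g$. The automorphism group
  is irreducible (\<open>Aut_irreducible\<close>), and the number of monomials of $L(gI)$ above a given
  monomial can only drop on a proper closed subset, because independence of vectors is an open condition
  (\<open>count_above_open\<close>). Hence $L(gI)$ is constant on an open set in each degree, and by
  Dickson's lemma on one open set in all degrees (\<open>generic_leads_exist\<close>). If the generic set
  of leading monomials were not strongly stable, a shear $X_v \mapsto X_v + t m$ would produce an ideal
  with more leading monomials above some monomial than the maximum: the linear term in $t$ contributes
  the missing monomial, with a coefficient that is an exponent and hence nonzero in characteristic $0$
  (\<open>shift_in_leads\<close>).

  Now $gI$ for generic $g$ and the monomial ideal $\mathrm{Gin}(I)$ have the same strongly stable set of
  leading monomials, so they have the same depth, and $g$ preserves depth (\<open>depth_Gin\<close>).\<close>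

section \<open>Linear independence as an open condition\<close>

definition independent_rows :: "'s set \<Rightarrow> 'c set \<Rightarrow> ('s \<Rightarrow> 'c \<Rightarrow> 'k::field) \<Rightarrow> bool" where
  "independent_rows S C A \<longleftrightarrow>
     (\<forall>a. (\<forall>c\<in>C. (\<Sum>s\<in>S. a s * A s c) = 0) \<longrightarrow> (\<forall>s\<in>S. a s = 0))"

lemma independent_rowsD:
  assumes "independent_rows S C A" "\<And>c. c \<in> C \<Longrightarrow> (\<Sum>s\<in>S. a s * A s c) = 0" "s \<in> S"
  shows "a s = 0"
  using assms unfolding independent_rows_def by blast

definition pivot :: "'s \<Rightarrow> 'c \<Rightarrow> ('s \<Rightarrow> 'c \<Rightarrow> 'k::field) \<Rightarrow> 's \<Rightarrow> 'c \<Rightarrow> 'k" where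
  "pivot s0 c0 A s c = A s0 c0 * A s c - A s c0 * A s0 c"

text \<open>One elimination step without division. Since the pivot is nonzero, the linear relations between the
  remaining reduced rows correspond to the linear relations between all rows.\<close>

lemma independent_rows_pivot:
  assumes "finite S" "s0 \<in> S" "c0 \<in> C" "A s0 c0 \<noteq> 0"
  shows "independent_rows S C A \<longleftrightarrow> independent_rows (S - {s0}) (C - {c0}) (pivot s0 c0 A)"
proof -
  let ?S = "S - {s0}"
  have split: "(\<Sum>s\<in>S. a s * A s c) = a s0 * A s0 c + (\<Sum>s\<in>?S. a s * A s c)" for a c
    using assms by (simp add: sum.remove)
  have piv: "(\<Sum>s\<in>?S. a s * pivot s0 c0 A s c) =
      A s0 c0 * (\<Sum>s\<in>?S. a s * A s c) - A s0 c * (\<Sum>s\<in>?S. a s * A s c0)" for a c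
    by (simp add: pivot_def sum_distrib_left sum_subtractf[symmetric] algebra_simps)
  show ?thesis
  proof
    assume ind: "independent_rows S C A"
    show "independent_rows ?S (C - {c0}) (pivot s0 c0 A)"
      unfolding independent_rows_def
    proof (intro allI impI ballI)
      fix a s assume a: "\<forall>c\<in>C - {c0}. (\<Sum>s\<in>?S. a s * pivot s0 c0 A s c) = 0" and s: "s \<in> ?S"
      \<comment> \<open>The coefficient of the pivot row is chosen to cancel the pivot column.\<close>
      define b where "b t = (if t = s0 then - (\<Sum>s\<in>?S. a s * A s c0) else A s0 c0 * a t)" for t
      have b: "(\<Sum>s\<in>S. b s * A s c) = (\<Sum>s\<in>?S. a s * pivot s0 c0 A s c)" for c
      proof -
        have "(\<Sum>s\<in>?S. b s * A s c) = A s0 c0 * (\<Sum>s\<in>?S. a s * A s c)"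
          unfolding sum_distrib_left by (rule sum.cong) (auto simp: b_def)
        then show ?thesis
          unfolding split piv by (simp add: b_def)
      qed
      have "(\<Sum>s\<in>S. b s * A s c) = 0" if "c \<in> C" for c
      proof (cases "c = c0")
        case True
        then show ?thesis unfolding b piv by simp
      qed (use a that b in auto)
      then have "b s = 0"
        using ind s by (auto intro: independent_rowsD)
      then show "a s = 0"
        using s assms(4) by (auto simp: b_def)
    qed
  next
    assume ind: "independent_rows ?S (C - {c0}) (pivot s0 c0 A)"
    show "independent_rows S C A"
      unfolding independent_rows_def
    proof (intro allI impI)
      fix a assume a: "\<forall>c\<in>C. (\<Sum>s\<in>S. a s * A s c) = 0"
      have rest: "(\<Sum>s\<in>?S. a s * A s c) = - (a s0 * A s0 c)" if "c \<in> C" for c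
        using a that unfolding split by (simp add: eq_neg_iff_add_eq_0 add.commute)
      have "a s = 0" if "s \<in> ?S" for s
        using ind
      proof (rule independent_rowsD)
        fix c assume "c \<in> C - {c0}"
        then show "(\<Sum>s\<in>?S. a s * pivot s0 c0 A s c) = 0"
          unfolding piv using rest[of c] rest[of c0] assms(3) by simp
      qed fact
      moreover from this have "a s0 = 0"
        using rest[OF assms(3)] assms(4) by (simp add: sum.neutral)
      ultimately show "\<forall>s\<in>S. a s = 0" by blast
    qed
  qed
qed

lemma independent_rows_pivot_exists:
  assumes "independent_rows S C A" "finite S" "s0 \<in> S"
  shows "\<exists>c0\<in>C. A s0 c0 \<noteq> 0"
proof (rule ccontr)
  assume "\<not> ?thesis"
  then have "(\<Sum>s\<in>S. (if s = s0 then 1 else 0) * A s c) = 0" if "c \<in> C" for c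
    using that by (intro sum.neutral) auto
  from independent_rowsD[OF assms(1) this assms(3)] show False by simp
qed

lemma independent_rows_card_le:
  assumes "independent_rows S C A" "finite S" "finite C"
  shows "card S \<le> card C"
  using assms
proof (induction "card S" arbitrary: S C A)
  case (Suc k)
  then obtain s0 where s0: "s0 \<in> S" by fastforce
  obtain c0 where c0: "c0 \<in> C" "A s0 c0 \<noteq> 0"
    using independent_rows_pivot_exists[OF Suc.prems(1) _ s0] Suc.prems(2) by blast
  have "card (S - {s0}) \<le> card (C - {c0})"
  proof (rule Suc.hyps(1))
    show "independent_rows (S - {s0}) (C - {c0}) (pivot s0 c0 A)"
      using independent_rows_pivot[of S s0 c0 C A] s0 c0 Suc.prems by simp
  qed (use Suc s0 in auto)
  moreover have "0 < card S" "0 < card C"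
    using Suc.prems s0 c0 by (auto simp: card_gt_0_iff)
  ultimately show ?case
    using s0 c0 Suc.prems by (simp add: card_Diff_singleton)
qed simp

text \<open>Independence has to be followed along a line in the automorphism group and over the whole group.
  A ring of functions covers both: polynomial functions of one parameter and polynomial functions of the
  coordinates of an automorphism.\<close>

locale function_ring =
  fixes P :: "('g \<Rightarrow> 'k::comm_ring_1) set"
  assumes fr_const: "(\<lambda>_. c) \<in> P"
    and fr_add: "u \<in> P \<Longrightarrow> v \<in> P \<Longrightarrow> (\<lambda>g. u g + v g) \<in> P"
    and fr_mult: "u \<in> P \<Longrightarrow> v \<in> P \<Longrightarrow> (\<lambda>g. u g * v g) \<in> P"
begin

lemma fr_diff: "u \<in> P \<Longrightarrow> v \<in> P \<Longrightarrow> (\<lambda>g. u g - v g) \<in> P"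
  using fr_add[of u "\<lambda>g. (- 1) * v g"] fr_mult[OF fr_const, of v "- 1"] by simp

lemma fr_sum: "(\<And>i. i \<in> X \<Longrightarrow> u i \<in> P) \<Longrightarrow> (\<lambda>g. \<Sum>i\<in>X. u i g) \<in> P"
  by (induction X rule: infinite_finite_induct) (auto intro: fr_const fr_add)

lemma fr_prod: "(\<And>i. i \<in> X \<Longrightarrow> u i \<in> P) \<Longrightarrow> (\<lambda>g. \<Prod>i\<in>X. u i g) \<in> P"
  by (induction X rule: infinite_finite_induct) (auto intro: fr_const fr_mult)

lemma fr_power: "u \<in> P \<Longrightarrow> (\<lambda>g. u g ^ k) \<in> P"
  by (induction k) (auto intro: fr_const fr_mult)

end

text \<open>Gaussian elimination without division keeps all entries in the ring of functions. The product
  of the pivots that occur at the given point therefore certifies independence at every point where it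
  does not vanish.\<close>

lemma independent_rows_open:
  fixes P :: "('g \<Rightarrow> 'k::field) set"
  assumes "function_ring P" "finite S"
    and "\<And>s c. s \<in> S \<Longrightarrow> c \<in> C \<Longrightarrow> (\<lambda>g. A g s c) \<in> P"
    and "independent_rows S C (A g0)"
  obtains p where "p \<in> P" "p g0 \<noteq> 0" "\<And>g. p g \<noteq> 0 \<Longrightarrow> independent_rows S C (A g)"
proof -
  interpret function_ring P by fact
  have "\<exists>p\<in>P. p g0 \<noteq> 0 \<and> (\<forall>g. p g \<noteq> 0 \<longrightarrow> independent_rows S C (A g))"
    using assms(2-)
  proof (induction "card S" arbitrary: S C A)
    case 0
    then show ?case
      by (intro bexI[of _ "\<lambda>_. 1"]) (auto simp: independent_rows_def intro: fr_const)
  next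
    case (Suc k)
    then obtain s0 where s0: "s0 \<in> S" by fastforce
    obtain c0 where c0: "c0 \<in> C" "A g0 s0 c0 \<noteq> 0"
        using independent_rows_pivot_exists[OF Suc.prems(3,1) s0] by blast
    have "\<exists>p\<in>P. p g0 \<noteq> 0 \<and>
        (\<forall>g. p g \<noteq> 0 \<longrightarrow> independent_rows (S - {s0}) (C - {c0}) (pivot s0 c0 (A g)))"
    proof (rule Suc.hyps(1))
      show "k = card (S - {s0})" using Suc s0 by simp
      show "independent_rows (S - {s0}) (C - {c0}) (pivot s0 c0 (A g0))"
        using independent_rows_pivot[of S s0 c0 C "A g0"] s0 c0 Suc.prems by simp
      show "(\<lambda>g. pivot s0 c0 (A g) s c) \<in> P" if "s \<in> S - {s0}" "c \<in> C - {c0}" for s c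
        unfolding pivot_def using that s0 c0 by (intro fr_diff fr_mult Suc.prems(2)) auto
    qed (use Suc.prems in auto)
    then obtain p where p: "p \<in> P" "p g0 \<noteq> 0"
      "\<And>g. p g \<noteq> 0 \<Longrightarrow> independent_rows (S - {s0}) (C - {c0}) (pivot s0 c0 (A g))"
      by blast
    show ?case
    proof (intro bexI conjI allI impI)
      show "(\<lambda>g. A g s0 c0 * p g) \<in> P"
        by (intro fr_mult Suc.prems(2) s0 c0(1) p)
      show "A g0 s0 c0 * p g0 \<noteq> 0" using c0 p by simp
      show "independent_rows S C (A g)" if "A g s0 c0 * p g \<noteq> 0" for g
        using that p(3)[of g] independent_rows_pivot[of S s0 c0 C "A g"] s0 c0 Suc.prems by simp
    qed
  qed
  then show ?thesis using that by blast
qed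

definition poly_functions :: "('k::comm_ring_1 \<Rightarrow> 'k) set" where
  "poly_functions = range poly"

lemma function_ring_poly_functions: "function_ring (poly_functions :: ('k::comm_ring_1 \<Rightarrow> 'k) set)"
proof
  show "(\<lambda>_. c) \<in> poly_functions" for c :: 'k
    unfolding poly_functions_def by (rule range_eqI[of _ _ "[:c:]"]) auto
next
  fix u v :: "'k \<Rightarrow> 'k" assume "u \<in> poly_functions" "v \<in> poly_functions"
  then obtain p p' where uv: "u = poly p" "v = poly p'" by (auto simp: poly_functions_def)
  show "(\<lambda>g. u g + v g) \<in> poly_functions"
    unfolding poly_functions_def uv by (rule range_eqI[of _ _ "p + p'"]) auto
  show "(\<lambda>g. u g * v g) \<in> poly_functions"
    unfolding poly_functions_def uv by (rule range_eqI[of _ _ "p * p'"]) auto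
qed

lemma poly_functions_id: "(\<lambda>t. t) \<in> poly_functions"
  unfolding poly_functions_def by (rule range_eqI[of _ _ "[:0, 1:]"]) auto

lemma finite_zeros_poly_function:
  fixes u :: "'k::idom \<Rightarrow> 'k"
  assumes "u \<in> poly_functions" "u t \<noteq> 0"
  shows "finite {t. u t = 0}"
proof -
  from assms obtain p where "u = poly p" by (auto simp: poly_functions_def)
  then show ?thesis using assms(2) by (metis poly_0 poly_roots_finite)
qed


section \<open>Regular sequences and socles\<close>

text \<open>The polynomials in finitely many of the variables form a proper subset of their type. Ideals,
  regular sequences and cochains are therefore taken relative to a subring \<open>R\<close> of the ambient type.\<close>

locale subring_of =
  fixes R :: "'a::comm_ring_1 set"
  assumes R0: "0 \<in> R" and R1: "1 \<in> R"
    and R_add: "x \<in> R \<Longrightarrow> y \<in> R \<Longrightarrow> x + y \<in> R"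
    and R_uminus: "x \<in> R \<Longrightarrow> - x \<in> R"
    and R_mult: "x \<in> R \<Longrightarrow> y \<in> R \<Longrightarrow> x * y \<in> R"
begin

lemma R_diff: "x \<in> R \<Longrightarrow> y \<in> R \<Longrightarrow> x - y \<in> R"
  using R_add[OF _ R_uminus, of x y] by simp

definition is_ideal :: "'a set \<Rightarrow> bool" where
  "is_ideal I \<longleftrightarrow> I \<subseteq> R \<and> 0 \<in> I \<and> (\<forall>x\<in>I. \<forall>y\<in>I. x + y \<in> I) \<and> (\<forall>r\<in>R. \<forall>x\<in>I. r * x \<in> I)"

lemma is_idealD:
  assumes "is_ideal I"
  shows "x \<in> I \<Longrightarrow> x \<in> R" "0 \<in> I" "x \<in> I \<Longrightarrow> y \<in> I \<Longrightarrow> x + y \<in> I"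
    "r \<in> R \<Longrightarrow> x \<in> I \<Longrightarrow> r * x \<in> I"
    "x \<in> I \<Longrightarrow> - x \<in> I" "x \<in> I \<Longrightarrow> y \<in> I \<Longrightarrow> x - y \<in> I"
proof -
  show un: "- x \<in> I" if "x \<in> I" for x
    using assms that R_uminus[OF R1] unfolding is_ideal_def by (metis mult_minus1)
  show "x - y \<in> I" if "x \<in> I" "y \<in> I"
    using assms that un[of y] unfolding is_ideal_def by (metis add_uminus_conv_diff)
qed (use assms in \<open>auto simp: is_ideal_def\<close>)

definition adjoin :: "'a set \<Rightarrow> 'a \<Rightarrow> 'a set" where
  "adjoin I x = {a + x * b | a b. a \<in> I \<and> b \<in> R}"

lemma adjoinI: "a \<in> I \<Longrightarrow> b \<in> R \<Longrightarrow> a + x * b \<in> adjoin I x"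
  by (auto simp: adjoin_def)

lemma is_ideal_adjoin:
  assumes I: "is_ideal I" and x: "x \<in> R"
  shows "is_ideal (adjoin I x)"
  unfolding is_ideal_def
proof (intro conjI ballI subsetI)
  show "0 \<in> adjoin I x" using adjoinI[OF is_idealD(2)[OF I] R0, of x] by simp
next
  fix r assume "r \<in> adjoin I x"
  then show "r \<in> R" using I x by (auto simp: adjoin_def intro!: R_add R_mult dest: is_idealD(1))
next
  fix r s assume "r \<in> adjoin I x" "s \<in> adjoin I x"
  then obtain a b a' b' where rs: "r = a + x * b" "s = a' + x * b'"
    and m: "a \<in> I" "a' \<in> I" "b \<in> R" "b' \<in> R"
    by (auto simp: adjoin_def)
  have "r + s = (a + a') + x * (b + b')" unfolding rs by (simp add: algebra_simps)
  then show "r + s \<in> adjoin I x" using adjoinI[of "a + a'" I "b + b'" x] m I R_add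
    by (auto intro: is_idealD)
next
  fix r s assume r: "r \<in> R" and "s \<in> adjoin I x"
  then obtain a b where s: "s = a + x * b" and m: "a \<in> I" "b \<in> R"
    by (auto simp: adjoin_def)
  have "r * s = r * a + x * (r * b)" unfolding s by (simp add: algebra_simps)
  then show "r * s \<in> adjoin I x" using adjoinI[of "r * a" I "r * b" x] m r I R_mult
    by (auto intro: is_idealD)
qed

lemma adjoin_superset: "a \<in> I \<Longrightarrow> a \<in> adjoin I x"
  using adjoinI[OF _ R0, of a I x] by simp

lemma adjoin_mem: "is_ideal I \<Longrightarrow> b \<in> R \<Longrightarrow> x * b \<in> adjoin I x"
  using adjoinI[of 0 I b x] is_idealD(2)[of I] by simp

lemma adjoin_minimal:
  assumes "is_ideal K" "I \<subseteq> K" "x \<in> K"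
  shows "adjoin I x \<subseteq> K"
proof
  fix r assume "r \<in> adjoin I x"
  then obtain a b where "r = a + b * x" "a \<in> I" "b \<in> R" by (auto simp: adjoin_def mult.commute)
  then show "r \<in> K" using assms by (auto intro!: is_idealD(3,4))
qed

definition adjoin_list :: "'a set \<Rightarrow> 'a list \<Rightarrow> 'a set" where
  "adjoin_list I xs = foldl adjoin I xs"

lemma adjoin_list_Nil [simp]: "adjoin_list I [] = I"
  and adjoin_list_Cons [simp]: "adjoin_list I (x # xs) = adjoin_list (adjoin I x) xs"
  by (auto simp: adjoin_list_def)

lemma is_ideal_adjoin_list: "is_ideal I \<Longrightarrow> set xs \<subseteq> R \<Longrightarrow> is_ideal (adjoin_list I xs)"
  by (induction xs arbitrary: I) (auto intro: is_ideal_adjoin)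

lemma adjoin_list_superset: "I \<subseteq> adjoin_list I xs"
proof (induction xs arbitrary: I)
  case (Cons x xs)
  have "I \<subseteq> adjoin I x" by (auto intro: adjoin_superset)
  with Cons[of "adjoin I x"] show ?case by simp
qed simp

lemma adjoin_list_mem:
  assumes "is_ideal I" "set xs \<subseteq> R" "x \<in> set xs"
  shows "x \<in> adjoin_list I xs"
  using assms
proof (induction xs arbitrary: I)
  case (Cons y ys)
  show ?case
  proof (cases "x = y")
    case True
    then have "x \<in> adjoin I y" using adjoin_mem[of I 1 y] Cons.prems R1 by simp
    then show ?thesis using adjoin_list_superset by auto
  qed (use Cons in \<open>auto intro!: Cons.IH is_ideal_adjoin\<close>)
qed simp

lemma adjoin_list_minimal:
  "is_ideal K \<Longrightarrow> I \<subseteq> K \<Longrightarrow> set xs \<subseteq> K \<Longrightarrow> adjoin_list I xs \<subseteq> K"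
  by (induction xs arbitrary: I) (auto dest: adjoin_minimal)

text \<open>A regular sequence on the quotient by \<open>I\<close>, without the condition that the last quotient is
  nonzero.\<close>

fun weakly_regular :: "'a set \<Rightarrow> 'a list \<Rightarrow> bool" where
  "weakly_regular I [] \<longleftrightarrow> True"
| "weakly_regular I (x # xs) \<longleftrightarrow>
     (\<forall>u\<in>R. x * u \<in> I \<longrightarrow> u \<in> I) \<and> weakly_regular (adjoin I x) xs"

lemma weakly_regular_iff_nth:
  "weakly_regular I xs \<longleftrightarrow>
     (\<forall>i<length xs. \<forall>u\<in>R. xs ! i * u \<in> adjoin_list I (take i xs) \<longrightarrow> u \<in> adjoin_list I (take i xs))"
proof (induction xs arbitrary: I)
  case (Cons x xs)
  show ?case
    by (simp add: Cons All_less_Suc2)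
qed simp

text \<open>The Koszul complex of the sequence \<open>ys\<close> with coefficients in the ring. A cochain assigns a
  coefficient to each subset of the positions of \<open>ys\<close>, encoded as a list of booleans;
  \<open>koszul_cochain ys (Suc i)\<close> consists of the cochains of degree \<open>i\<close>. The shift leaves room for the zero
  module in degree \<open>-1\<close>. The recursion describes the complex as the mapping cone of
  multiplication by the first entry.\<close>

definition koszul_cochain :: "'a list \<Rightarrow> nat \<Rightarrow> (bool list \<Rightarrow> 'a) set" where
  "koszul_cochain ys j = {c. range c \<subseteq> R \<and>
     (\<forall>bs. c bs \<noteq> 0 \<longrightarrow> length bs = length ys \<and> Suc (length (filter (\<lambda>b. b) bs)) = j)}"

fun koszul_diff :: "'a list \<Rightarrow> (bool list \<Rightarrow> 'a) \<Rightarrow> bool list \<Rightarrow> 'a" where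
  "koszul_diff (y # ys) c (False # bs) = koszul_diff ys (\<lambda>t. c (False # t)) bs"
| "koszul_diff (y # ys) c (True # bs) = y * c (False # bs) - koszul_diff ys (\<lambda>t. c (True # t)) bs"
| "koszul_diff _ c _ = 0"

lemma koszul_diff_linear:
  "koszul_diff ys (\<lambda>t. c t + x * e t) bs = koszul_diff ys c bs + x * koszul_diff ys e bs"
  by (induction ys c bs arbitrary: e rule: koszul_diff.induct) (auto simp: algebra_simps)

lemma koszul_diff_zero: "koszul_diff ys (\<lambda>t. 0) bs = 0"
  using koszul_diff_linear[of ys "\<lambda>t. 0" 1 "\<lambda>t. 0" bs] by simp

lemma koszul_diff_uminus: "koszul_diff ys (\<lambda>t. - c t) bs = - koszul_diff ys c bs"
  using koszul_diff_linear[of ys "\<lambda>t. 0" "- 1" c bs] by (simp add: koszul_diff_zero)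

lemma koszul_diff_diff: "koszul_diff ys (\<lambda>t. c t - e t) bs = koszul_diff ys c bs - koszul_diff ys e bs"
  using koszul_diff_linear[of ys c "- 1" e bs] by simp

lemma koszul_diff_mem:
  assumes "is_ideal I" "set ys \<subseteq> R" "\<And>t. c t \<in> I"
  shows "koszul_diff ys c bs \<in> I"
  using assms(2-)
  by (induction ys c bs rule: koszul_diff.induct)
    (auto intro!: is_idealD(2,4,6)[OF assms(1)])

lemma koszul_diff_mem_R:
  assumes "set ys \<subseteq> R" "\<And>t. c t \<in> R"
  shows "koszul_diff ys c bs \<in> R"
  using assms
  by (induction ys c bs rule: koszul_diff.induct) (auto intro!: R0 R_diff R_mult)

lemma koszul_diff_diff_zero: "koszul_diff ys (koszul_diff ys c) bs = 0"
proof (induction ys c bs rule: koszul_diff.induct)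
  case (2 y ys c bs)
  then show ?case
    using koszul_diff_linear[of ys "\<lambda>t. - koszul_diff ys (\<lambda>t. c (True # t)) t" y "\<lambda>t. c (False # t)" bs]
    by (simp add: koszul_diff_uminus)
qed auto

lemma koszul_cochain_diff:
  assumes "set ys \<subseteq> R" "c \<in> koszul_cochain ys j"
  shows "koszul_diff ys c \<in> koszul_cochain ys (Suc j)"
proof -
  have "length bs = length ys \<and> length (filter (\<lambda>b. b) bs) = j" if
    "koszul_diff ys c bs \<noteq> 0" "\<And>bs. c bs \<noteq> 0 \<Longrightarrow> length bs = length ys \<and> Suc (length (filter (\<lambda>b. b) bs)) = j" for bs
    using that
  proof (induction ys c bs arbitrary: j rule: koszul_diff.induct)
    case (1 y ys c bs)
    have "length bs = length ys \<and> length (filter (\<lambda>b. b) bs) = j"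
    proof (rule 1(1))
      show "koszul_diff ys (\<lambda>t. c (False # t)) bs \<noteq> 0" using 1(2) by simp
      show "length t = length ys \<and> Suc (length (filter (\<lambda>b. b) t)) = j" if "c (False # t) \<noteq> 0" for t
        using 1(3)[OF that] by simp
    qed
    then show ?case by simp
  next
    case (2 y ys c bs)
    show ?case
    proof (cases "c (False # bs) = 0")
      case True
      with 2(2) have nz: "koszul_diff ys (\<lambda>t. c (True # t)) bs \<noteq> 0" by simp
      have "j \<noteq> 0"
      proof
        assume "j = 0"
        then have "(\<lambda>t. c (True # t)) = (\<lambda>t. 0)" using 2(3) by fastforce
        then show False using nz koszul_diff_zero by simp
      qed
      have "length bs = length ys \<and> length (filter (\<lambda>b. b) bs) = j - 1"
      proof (rule 2(1)[OF nz])
        show "length t = length ys \<and> Suc (length (filter (\<lambda>b. b) t)) = j - 1" if "c (True # t) \<noteq> 0" for t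
          using 2(3)[OF that] by auto
      qed
      then show ?thesis using \<open>j \<noteq> 0\<close> by simp
    next
      case False
      then show ?thesis using 2(3)[of "False # bs"] by simp
    qed
  qed auto
  then show ?thesis
    using assms koszul_diff_mem_R[OF assms(1), of c] unfolding koszul_cochain_def by blast
qed

text \<open>Vanishing of the Koszul cohomology of the quotient by \<open>I\<close> in degrees below \<open>k\<close>.\<close>

definition koszul_exact :: "'a list \<Rightarrow> 'a set \<Rightarrow> nat \<Rightarrow> bool" where
  "koszul_exact ys I k \<longleftrightarrow> (\<forall>j\<le>k. \<forall>c\<in>koszul_cochain ys j. (\<forall>bs. koszul_diff ys c bs \<in> I) \<longrightarrow>
     (\<exists>b\<in>koszul_cochain ys (j - 1). \<forall>bs. c bs - koszul_diff ys b bs \<in> I))"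

lemma koszul_exactD:
  assumes "koszul_exact ys I k" "j \<le> k" "c \<in> koszul_cochain ys j" "\<And>bs. koszul_diff ys c bs \<in> I"
  obtains b where "b \<in> koszul_cochain ys (j - 1)" "\<And>bs. c bs - koszul_diff ys b bs \<in> I"
  using assms unfolding koszul_exact_def by blast

lemma koszul_cochain_zero: "c \<in> koszul_cochain ys 0 \<longleftrightarrow> c = (\<lambda>_. 0)"
  using R0 by (auto simp: koszul_cochain_def)

lemma koszul_cochain_subset_support:
  assumes "c \<in> koszul_cochain ys j" "\<And>t. e t \<in> R" "\<And>t. c t = 0 \<Longrightarrow> e t = 0"
  shows "e \<in> koszul_cochain ys j"
  using assms unfolding koszul_cochain_def by fastforce

lemma koszul_cochain_diff_pred:
  assumes "set ys \<subseteq> R" "b \<in> koszul_cochain ys (j - 1)"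
  shows "koszul_diff ys b \<in> koszul_cochain ys j"
proof (cases j)
  case 0
  then show ?thesis using assms(2) koszul_diff_zero by (auto simp: koszul_cochain_zero)
next
  case (Suc i)
  then show ?thesis using koszul_cochain_diff[OF assms] by simp
qed

lemma koszul_cochain_linear:
  assumes "c \<in> koszul_cochain ys j" "e \<in> koszul_cochain ys j" "x \<in> R"
  shows "(\<lambda>t. c t - x * e t) \<in> koszul_cochain ys j"
proof -
  have "c t - x * e t \<in> R" for t
    using assms by (auto simp: koszul_cochain_def intro!: R_diff R_mult)
  moreover have "c t \<noteq> 0 \<or> e t \<noteq> 0" if "c t - x * e t \<noteq> 0" for t
    using that by auto
  ultimately show ?thesis
    using assms(1,2) unfolding koszul_cochain_def by blast
qed

lemma adjoin_decompose:
  assumes "\<And>t. w t \<in> adjoin I x" "w \<in> koszul_cochain ys j" "is_ideal I"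
  obtains e where "e \<in> koszul_cochain ys j" "\<And>t. w t - x * e t \<in> I"
proof -
  have "\<exists>e. e \<in> R \<and> w t - x * e \<in> I \<and> (w t = 0 \<longrightarrow> e = 0)" for t
  proof (cases "w t = 0")
    case True
    then show ?thesis using R0 is_idealD(2)[OF assms(3)] by auto
  next
    case False
    obtain a b where "w t = a + x * b" "a \<in> I" "b \<in> R"
      using assms(1)[of t] by (auto simp: adjoin_def)
    then show ?thesis using False by (intro exI[of _ b]) auto
  qed
  then obtain e where "\<And>t. e t \<in> R \<and> w t - x * e t \<in> I \<and> (w t = 0 \<longrightarrow> e t = 0)" by metis
  then show ?thesis
    using that koszul_cochain_subset_support[OF assms(2), of e] by blast
qed

lemma koszul_exact_0: "is_ideal I \<Longrightarrow> koszul_exact ys I 0"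
  unfolding koszul_exact_def by (auto simp: koszul_cochain_zero koszul_diff_zero is_idealD)

text \<open>The complex of \<open>y # ys\<close> is the mapping cone of \<open>y\<close> on the complex of \<open>ys\<close>. For a cocycle
  with components \<open>a\<close> and \<open>b\<close> one has \<open>y * a = koszul_diff ys b\<close> modulo \<open>I\<close>, so \<open>b\<close> is a cocycle modulo \<open>y\<close>
  and hence a coboundary modulo \<open>y\<close>; cancelling \<open>y\<close> then exhibits \<open>a\<close> as a coboundary.\<close>

lemma koszul_exact_Cons:
  assumes I: "is_ideal I" and R: "y \<in> R" "set ys \<subseteq> R"
    and nzd: "\<And>u. u \<in> R \<Longrightarrow> y * u \<in> I \<Longrightarrow> u \<in> I"
    and exact: "koszul_exact ys (adjoin I y) k"
  shows "koszul_exact (y # ys) I (Suc k)"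
  unfolding koszul_exact_def
proof (intro allI impI ballI)
  fix j c assume j: "j \<le> Suc k" and c: "c \<in> koszul_cochain (y # ys) j"
    and Dc: "\<forall>bs. koszul_diff (y # ys) c bs \<in> I"
  show "\<exists>b\<in>koszul_cochain (y # ys) (j - 1). \<forall>bs. c bs - koszul_diff (y # ys) b bs \<in> I"
  proof (cases j)
    case 0
    then show ?thesis using c I
      by (auto simp: koszul_cochain_zero koszul_diff_zero is_idealD)
  next
    case (Suc i)
    have aR: "c t \<in> R" for t using c by (auto simp: koszul_cochain_def)
    have supp: "length t = Suc (length ys) \<and> length (filter (\<lambda>b. b) t) = i" if "c t \<noteq> 0" for t
      using c that Suc by (auto simp: koszul_cochain_def)
    define a where "a = (\<lambda>t. c (False # t))"
    define b where "b = (\<lambda>t. c (True # t))"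
    have bmem: "b \<in> koszul_cochain ys i"
      using supp[of "True # _"] aR unfolding koszul_cochain_def b_def by fastforce
    have yab: "y * a t - koszul_diff ys b t \<in> I" for t
      using Dc[rule_format, of "True # t"] by (simp add: a_def b_def)
    have "koszul_diff ys b t \<in> adjoin I y" for t
    proof -
      have "koszul_diff ys b t = - (y * a t - koszul_diff ys b t) + y * a t" by simp
      then show ?thesis using adjoinI[OF is_idealD(5)[OF I yab[of t]], of "a t" y] aR
        by (simp add: a_def)
    qed
    moreover have "i \<le> k" using j Suc by simp
    ultimately obtain b1 where b1: "b1 \<in> koszul_cochain ys (i - 1)"
      "\<And>t. b t - koszul_diff ys b1 t \<in> adjoin I y"
      using koszul_exactD[OF exact _ bmem] by metis
    have Db1: "koszul_diff ys b1 \<in> koszul_cochain ys i"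
      by (rule koszul_cochain_diff_pred[OF R(2) b1(1)])
    have "(\<lambda>t. b t - koszul_diff ys b1 t) \<in> koszul_cochain ys i"
      using koszul_cochain_linear[OF bmem Db1 R1] by simp
    then obtain e where e: "e \<in> koszul_cochain ys i"
      "\<And>t. b t - koszul_diff ys b1 t - y * e t \<in> I"
      using adjoin_decompose[of "\<lambda>t. b t - koszul_diff ys b1 t", OF b1(2) _ I] by metis
    have ae: "a t - koszul_diff ys e t \<in> I" for t
    proof (rule nzd)
      have "koszul_diff ys (\<lambda>t. b t - koszul_diff ys b1 t + (- y) * e t) t \<in> I"
        using e(2) by (intro koszul_diff_mem I R) simp
      then have "koszul_diff ys b t - y * koszul_diff ys e t \<in> I"
        unfolding koszul_diff_linear koszul_diff_diff koszul_diff_diff_zero by simp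
      from is_idealD(3)[OF I yab[of t] this] show "y * (a t - koszul_diff ys e t) \<in> I"
        by (simp add: algebra_simps)
      have "e t \<in> R" for t using e(1) by (auto simp: koszul_cochain_def)
      then show "a t - koszul_diff ys e t \<in> R"
        using aR by (auto simp: a_def intro!: R_diff koszul_diff_mem_R R)
    qed
    define B where "B bs = (case bs of [] \<Rightarrow> 0 | False # t \<Rightarrow> e t | True # t \<Rightarrow> - b1 t)" for bs
    have B: "B [] = 0" "\<And>t. B (False # t) = e t" "\<And>t. B (True # t) = - b1 t"
      by (simp_all add: B_def)
    have "B bs \<in> R" for bs
    proof -
      have "e t \<in> R" "b1 t \<in> R" for t using e(1) b1(1) by (auto simp: koszul_cochain_def)
      then show ?thesis
        by (cases bs rule: list.exhaust) (auto simp: B_def R0 R_uminus split: bool.split)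
    qed
    moreover have "length bs = Suc (length ys) \<and> Suc (length (filter (\<lambda>b. b) bs)) = i" if "B bs \<noteq> 0" for bs
    proof (cases bs)
      case (Cons q t)
      then show ?thesis using that e(1) b1(1)
        by (cases q) (fastforce simp: B koszul_cochain_def)+
    qed (use that B in auto)
    ultimately have Bmem: "B \<in> koszul_cochain (y # ys) (j - 1)"
      using Suc by (auto simp: koszul_cochain_def)
    have "c bs - koszul_diff (y # ys) B bs \<in> I" for bs
    proof (cases bs)
      case Nil
      have "c [] = 0" using supp[of "[]"] by auto
      then show ?thesis using Nil I by (simp add: is_idealD)
    next
      case (Cons q t)
      have eta: "(\<lambda>t. e t) = e" "koszul_diff ys (\<lambda>t. - b1 t) t = - koszul_diff ys b1 t"
        by (simp_all add: koszul_diff_uminus)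
      show ?thesis
      proof (cases q)
        case True
        then show ?thesis using Cons e(2)[of t]
          by (simp add: B koszul_diff_uminus b_def algebra_simps)
      next
        case False
        then show ?thesis using Cons ae[of t] by (simp add: B a_def)
      qed
    qed
    then show ?thesis using Bmem by blast
  qed
qed

lemma koszul_exact_regular:
  "is_ideal I \<Longrightarrow> set ys \<subseteq> R \<Longrightarrow> weakly_regular I ys \<Longrightarrow> koszul_exact ys I (length ys)"
proof (induction ys arbitrary: I)
  case (Cons y ys)
  have "koszul_exact ys (adjoin I y) (length ys)"
    using Cons.prems by (intro Cons.IH is_ideal_adjoin) auto
  with Cons.prems show ?case by (auto intro!: koszul_exact_Cons)
qed (simp add: koszul_exact_0)

text \<open>The long exact sequence of multiplication by a nonzerodivisor \<open>x\<close>: passing to the quotient by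
  \<open>x\<close> loses one degree of exactness.\<close>

lemma koszul_exact_adjoin:
  assumes I: "is_ideal I" and R: "x \<in> R" "set ys \<subseteq> R"
    and nzd: "\<And>u. u \<in> R \<Longrightarrow> x * u \<in> I \<Longrightarrow> u \<in> I"
    and exact: "koszul_exact ys I (Suc k)"
  shows "koszul_exact ys (adjoin I x) k"
  unfolding koszul_exact_def
proof (intro allI impI ballI)
  fix j c assume j: "j \<le> k" and c: "c \<in> koszul_cochain ys j"
    and Dc: "\<forall>bs. koszul_diff ys c bs \<in> adjoin I x"
  obtain e where e: "e \<in> koszul_cochain ys (Suc j)" "\<And>t. koszul_diff ys c t - x * e t \<in> I"
    using adjoin_decompose[of "koszul_diff ys c", OF _ koszul_cochain_diff[OF R(2) c] I] Dc by blast
  have eR: "e t \<in> R" for t using e(1) by (auto simp: koszul_cochain_def)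
  have "koszul_diff ys e t \<in> I" for t
  proof (rule nzd)
    have "koszul_diff ys (\<lambda>t. koszul_diff ys c t + (- x) * e t) t \<in> I"
      using e(2) by (intro koszul_diff_mem I R) simp
    then have "- (x * koszul_diff ys e t) \<in> I"
      unfolding koszul_diff_linear koszul_diff_diff_zero by simp
    then show "x * koszul_diff ys e t \<in> I" using is_idealD(5)[OF I] by fastforce
  qed (intro koszul_diff_mem_R R eR)
  then obtain b where b: "b \<in> koszul_cochain ys (Suc j - 1)" "\<And>t. e t - koszul_diff ys b t \<in> I"
    using koszul_exactD[OF exact _ e(1)] j by (metis Suc_le_mono)
  have cb: "(\<lambda>t. c t - x * b t) \<in> koszul_cochain ys j"
    using koszul_cochain_linear[OF c _ R(1)] b(1) by simp
  have "koszul_diff ys (\<lambda>t. c t - x * b t) t \<in> I" for t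
  proof -
    have "koszul_diff ys (\<lambda>t. c t - x * b t) t = koszul_diff ys c t - x * koszul_diff ys b t"
      using koszul_diff_linear[of ys c "- x" b t] by simp
    also have "\<dots> = (koszul_diff ys c t - x * e t) + x * (e t - koszul_diff ys b t)"
      by (simp add: algebra_simps)
    finally show ?thesis using e(2) b(2) R by (auto intro!: is_idealD(3,4)[OF I])
  qed
  then obtain b' where b': "b' \<in> koszul_cochain ys (j - 1)"
    "\<And>t. c t - x * b t - koszul_diff ys b' t \<in> I"
    using koszul_exactD[OF exact _ cb] j by (metis le_SucI)
  have "c t - koszul_diff ys b' t \<in> adjoin I x" for t
  proof -
    have "b t \<in> R" using b(1) by (auto simp: koszul_cochain_def)
    then show ?thesis using adjoinI[OF b'(2)[of t], of "b t" x] by simp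
  qed
  then show "\<exists>b\<in>koszul_cochain ys (j - 1). \<forall>bs. c bs - koszul_diff ys b bs \<in> adjoin I x"
    using b'(1) by blast
qed

lemma koszul_exact_adjoin_list:
  assumes "is_ideal I" "set xs \<subseteq> R" "set ys \<subseteq> R" "weakly_regular I xs"
    "koszul_exact ys I (length xs + k)"
  shows "koszul_exact ys (adjoin_list I xs) k"
  using assms
proof (induction xs arbitrary: I)
  case (Cons x xs)
  have "koszul_exact ys (adjoin I x) (length xs + k)"
    using Cons.prems by (intro koszul_exact_adjoin) auto
  then show ?case using Cons.prems by (auto intro!: Cons.IH is_ideal_adjoin)
qed simp

text \<open>Cohomology in degree zero consists of the elements that are annihilated by all entries of the
  sequence.\<close>

lemma koszul_exact_socle:
  assumes "koszul_exact ys I 1" "is_ideal I" "f \<in> R" "\<And>y. y \<in> set ys \<Longrightarrow> y * f \<in> I"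
  shows "f \<in> I"
proof -
  define c where "c ys bs = (if bs = replicate (length ys) False then f else 0)" for ys :: "'a list" and bs
  have "koszul_diff ys (c ys) bs \<in> I" if "\<And>y. y \<in> set ys \<Longrightarrow> y * f \<in> I" for bs
    using that
  proof (induction ys arbitrary: bs)
    case (Cons y ys)
    have cc: "(\<lambda>t. c (y # ys) (False # t)) = c ys" "(\<lambda>t. c (y # ys) (True # t)) = (\<lambda>t. 0)"
      by (auto simp: c_def)
    have cf: "c (y # ys) (False # t) = c ys t" for t by (auto simp: c_def)
    show ?case
    proof (cases bs)
      case (Cons q t)
      show ?thesis
      proof (cases q)
        case True
        have "y * c ys t \<in> I" using Cons.prems is_idealD(2)[OF assms(2)] by (auto simp: c_def)
        then show ?thesis using True \<open>bs = q # t\<close> by (simp add: cc cf koszul_diff_zero)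
      qed (use Cons.IH Cons.prems \<open>bs = q # t\<close> in \<open>simp add: cc\<close>)
    qed (simp add: is_idealD assms)
  qed (use assms in \<open>auto simp: is_idealD\<close>)
  moreover have "c ys \<in> koszul_cochain ys 1"
    using assms(3) R0 by (auto simp: koszul_cochain_def c_def)
  ultimately obtain b where "b \<in> koszul_cochain ys (1 - 1)" "\<And>bs. c ys bs - koszul_diff ys b bs \<in> I"
    using koszul_exactD[OF assms(1) order_refl, of "c ys"] assms(4) by blast
  from this(2)[of "replicate (length ys) False"] this(1) show ?thesis
    by (simp add: koszul_cochain_zero koszul_diff_zero c_def)
qed

text \<open>If \<open>ys\<close> were longer than \<open>xs\<close>, its Koszul complex would still be exact in degree zero after
  dividing out the \<open>length xs\<close> nonzerodivisors \<open>xs\<close>, and \<open>f\<close> would be zero in that quotient.\<close>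

theorem regular_length_le_if_socle:
  assumes I: "is_ideal I" and xs: "set xs \<subseteq> R" "weakly_regular I xs"
    and ys: "set ys \<subseteq> R" "weakly_regular I ys"
    and f: "f \<in> R" "f \<notin> adjoin_list I xs" "\<And>y. y \<in> set ys \<Longrightarrow> y * f \<in> adjoin_list I xs"
  shows "length ys \<le> length xs"
proof (rule ccontr)
  assume "\<not> ?thesis"
  then have "koszul_exact ys I (length xs + 1)"
    using koszul_exact_regular[OF I ys] unfolding koszul_exact_def by auto
  then have "koszul_exact ys (adjoin_list I xs) 1"
    by (rule koszul_exact_adjoin_list[OF I xs(1) ys(1) xs(2)])
  then have "f \<in> adjoin_list I xs"
    by (rule koszul_exact_socle) (use f I xs in \<open>auto intro: is_ideal_adjoin_list\<close>)
  then show False using f(2) by simp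
qed

end

section \<open>Polynomials and substitution\<close>

abbreviation keys where "keys \<equiv> Poly_Mapping.keys"
abbreviation lookup where "lookup \<equiv> Poly_Mapping.lookup"
abbreviation single where "single \<equiv> Poly_Mapping.single"

lemma poly_mapping_sum_single:
  fixes f :: "'a \<Rightarrow>\<^sub>0 'b::comm_monoid_add"
  shows "f = (\<Sum>m\<in>keys f. single m (lookup f m))"
proof (rule poly_mapping_eqI)
  fix k
  have "(\<Sum>m\<in>keys f. lookup (single m (lookup f m)) k) = (\<Sum>m\<in>keys f. if m = k then lookup f m else 0)"
    by (rule sum.cong) (auto simp: lookup_single when_def)
  also have "\<dots> = lookup f k" by (simp add: in_keys_iff)
  finally show "lookup f k = lookup (\<Sum>m\<in>keys f. single m (lookup f m)) k"
    by (simp add: lookup_sum)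
qed

lemma poly_mapping_induct_on [consumes 1, case_names zero single add]:
  fixes f :: "'a \<Rightarrow>\<^sub>0 'b::comm_monoid_add"
  assumes "keys f \<subseteq> A" "P 0" "\<And>m c. m \<in> A \<Longrightarrow> P (single m c)"
    "\<And>f g. keys f \<subseteq> A \<Longrightarrow> keys g \<subseteq> A \<Longrightarrow> P f \<Longrightarrow> P g \<Longrightarrow> P (f + g)"
  shows "P f"
proof -
  have "P (\<Sum>m\<in>B. single m (lookup f m)) \<and> keys (\<Sum>m\<in>B. single m (lookup f m)) \<subseteq> A"
    if "finite B" "B \<subseteq> A" for B
    using that
  proof (induction B rule: finite_induct)
    case (insert m B)
    then have "keys (single m (lookup f m) + (\<Sum>m\<in>B. single m (lookup f m))) \<subseteq> A"
      using keys_add[of "single m (lookup f m)" "\<Sum>m\<in>B. single m (lookup f m)"]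
      by (auto split: if_splits)
    then show ?case using insert by (auto intro!: assms(3,4) split: if_splits)
  qed (auto simp: assms(2))
  from this[of "keys f"] show ?thesis
    using assms(1) poly_mapping_sum_single[of f] by simp
qed

lemma mono_decompositions_finite: "finite {ab. fst ab + snd ab = (m :: 'x mono)}"
proof -
  have "finite {a :: 'x mono. \<exists>b. a + b = m}"
  proof (rule finite_imageD[where f = lookup])
    let ?B = "{..\<Sum>x\<in>keys m. lookup m x}"
    let ?F = "{f. \<forall>x. (x \<in> keys m \<longrightarrow> f x \<in> ?B) \<and> (x \<notin> keys m \<longrightarrow> f x = 0)}"
    have "lookup a \<in> ?F" if "a + b = m" for a b
    proof -
      have le: "lookup a x \<le> lookup m x" for x using that by (auto simp: lookup_add)
      moreover have "lookup m x \<le> (\<Sum>x\<in>keys m. lookup m x)" if "x \<in> keys m" for x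
        by (rule member_le_sum) (use that in auto)
      moreover have "lookup a x = 0" if "x \<notin> keys m" for x
        using le[of x] that by (simp add: in_keys_iff)
      ultimately show ?thesis by (auto intro: order_trans)
    qed
    then have "lookup ` {a. \<exists>b. a + b = m} \<subseteq> ?F" by (intro image_subsetI) blast
    moreover have "finite ?F" by (rule finite_set_of_finite_funs) auto
    ultimately show "finite (lookup ` {a. \<exists>b. a + b = m})" by (rule finite_subset)
  qed (simp add: inj_on_def poly_mapping_eqI)
  then have "finite ((\<lambda>a. (a, m - a)) ` {a. \<exists>b. a + b = m})" by simp
  then show ?thesis
    by (rule rev_finite_subset) (auto simp: image_iff)
qed

lemma lookup_mult_sum:
  fixes f g :: "('x, 'k::comm_ring_1) mpoly"
  shows "lookup (f * g) c = (\<Sum>ab | fst ab + snd ab = c. lookup f (fst ab) * lookup g (snd ab))"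
proof -
  have "lookup (f * g) c = (\<Sum>l. lookup f l * (\<Sum>r. lookup g r when c = l + r))"
    by (rule lookup_mult)
  also have "\<dots> = prod_fun (lookup f) (lookup g) c"
    by (simp add: prod_fun_def)
  also have "\<dots> = (\<Sum>(a, b). lookup f a * lookup g b when c = a + b)"
    by (rule prod_fun_unfold_prod) simp_all
  also have "\<dots> = (\<Sum>ab | fst ab + snd ab = c. lookup f (fst ab) * lookup g (snd ab))"
    by (subst Sum_any.expand_superset[OF mono_decompositions_finite[of c]])
      (auto simp: case_prod_unfold intro!: sum.cong)
  finally show ?thesis .
qed

lemma lookup_const_mult [simp]: "lookup (const a * f) m = a * lookup f m"
  for f :: "('x, 'k::comm_ring_1) mpoly"
  unfolding const_def mult_map_scale_conv_mult[symmetric] by (simp add: Poly_Mapping.map.rep_eq when_def)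

lemma lookup_const: "lookup (const a) m = (a when m = 0)"
  by (auto simp: const_def lookup_single when_def)

lemma const_hom:
  "const 0 = 0" "const 1 = 1" "const (a + b) = const a + const b" "const (a * b) = const a * const b"
  by (simp_all add: const_def single_add mult_single)

lemma const_mult_single: "const a * single m b = single m (a * b)"
  by (simp add: const_def mult_single)

lemma single_eq_const_monomial: "single m a = const a * monomial m"
  by (simp add: const_def monomial_def mult_single)

lemma monomial_add: "monomial (s + t) = monomial s * monomial t"
  by (simp add: monomial_def mult_single)

lemma lookup_monomial_mult:
  fixes f :: "('x, 'k::comm_ring_1) mpoly"
  shows "lookup (monomial s * f) (s + m) = lookup f m"
proof -
  have "lookup (monomial s * f) (s + m) =
      (\<Sum>ab | fst ab + snd ab = s + m. if ab = (s, m) then lookup f m else 0)"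
    unfolding lookup_mult_sum by (rule sum.cong) (auto simp: monomial_def lookup_single when_def)
  then show ?thesis using mono_decompositions_finite[of "s + m"] by (simp add: sum.delta)
qed

lemma keys_monomial_mult:
  fixes f :: "('x, 'k::comm_ring_1) mpoly"
  shows "keys (monomial s * f) = (+) s ` keys f"
proof
  show "keys (monomial s * f) \<subseteq> (+) s ` keys f"
    using keys_mult[of "monomial s" f] by (auto simp: monomial_def split: if_splits)
  show "(+) s ` keys f \<subseteq> keys (monomial s * f)"
    by (auto simp: in_keys_iff lookup_monomial_mult)
qed

definition mono_val :: "('x \<Rightarrow> 'a::comm_ring_1) \<Rightarrow> 'x mono \<Rightarrow> 'a" where
  "mono_val \<sigma> m = (\<Prod>v\<in>keys m. \<sigma> v ^ lookup m v)"

lemma mono_val_superset: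
  "finite A \<Longrightarrow> keys m \<subseteq> A \<Longrightarrow> mono_val \<sigma> m = (\<Prod>v\<in>A. \<sigma> v ^ lookup m v)"
  unfolding mono_val_def by (rule prod.mono_neutral_left) (auto simp: in_keys_iff)

lemma mono_val_zero [simp]: "mono_val \<sigma> 0 = 1"
  by (simp add: mono_val_def)

lemma mono_val_single [simp]: "mono_val \<sigma> (single v k) = \<sigma> v ^ k"
  by (simp add: mono_val_def)

lemma mono_val_add: "mono_val \<sigma> (s + t) = mono_val \<sigma> s * mono_val \<sigma> t"
proof -
  let ?A = "keys s \<union> keys t"
  have "mono_val \<sigma> (s + t) = (\<Prod>v\<in>?A. \<sigma> v ^ lookup (s + t) v)"
    by (intro mono_val_superset keys_add) simp
  also have "\<dots> = mono_val \<sigma> s * mono_val \<sigma> t"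
    by (simp add: mono_val_superset[of ?A s] mono_val_superset[of ?A t] lookup_add power_add prod.distrib)
  finally show ?thesis .
qed

text \<open>Evaluation at scalars and substitution of polynomials are the same construction for two choices
  of the map \<open>h\<close> on coefficients.\<close>

definition mpoly_hom :: "('k::comm_ring_1 \<Rightarrow> 'a::comm_ring_1) \<Rightarrow> ('x \<Rightarrow> 'a) \<Rightarrow> ('x, 'k) mpoly \<Rightarrow> 'a" where
  "mpoly_hom h \<sigma> f = (\<Sum>m\<in>keys f. h (lookup f m) * mono_val \<sigma> m)"

locale coefficient_hom =
  fixes h :: "'k::comm_ring_1 \<Rightarrow> 'a::comm_ring_1"
  assumes h: "h 0 = 0" "h 1 = 1" "h (a + b) = h a + h b" "h (a * b) = h a * h b"
begin

lemma mpoly_hom_zero [simp]: "mpoly_hom h \<sigma> 0 = 0"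
  by (simp add: mpoly_hom_def)

lemma mpoly_hom_single [simp]: "mpoly_hom h \<sigma> (single m a) = h a * mono_val \<sigma> m"
  by (simp add: mpoly_hom_def h)

lemma mpoly_hom_const [simp]: "mpoly_hom h \<sigma> (const a) = h a"
  by (simp add: const_def)

lemma mpoly_hom_one [simp]: "mpoly_hom h \<sigma> 1 = 1"
  using mpoly_hom_const[of \<sigma> 1] by (simp add: const_hom h)

lemma mpoly_hom_indet [simp]: "mpoly_hom h \<sigma> (indet v) = \<sigma> v"
  by (simp add: indet_def monomial_def h)

lemma mpoly_hom_add: "mpoly_hom h \<sigma> (f + g) = mpoly_hom h \<sigma> f + mpoly_hom h \<sigma> g"
  unfolding mpoly_hom_def
  by (rule setsum_keys_plus_distrib) (auto simp: h algebra_simps)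

lemma mpoly_hom_sum: "mpoly_hom h \<sigma> (\<Sum>i\<in>X. F i) = (\<Sum>i\<in>X. mpoly_hom h \<sigma> (F i))"
  by (induction X rule: infinite_finite_induct) (auto simp: mpoly_hom_add)

lemma mpoly_hom_mult: "mpoly_hom h \<sigma> (f * g) = mpoly_hom h \<sigma> f * mpoly_hom h \<sigma> g"
proof (induction f rule: poly_mapping_induct_on[where A = UNIV, OF subset_UNIV])
  case (2 m a)
  show ?case
    by (induction g rule: poly_mapping_induct_on[where A = UNIV, OF subset_UNIV])
      (auto simp: mult_single h mono_val_add mpoly_hom_add algebra_simps)
qed (auto simp: mpoly_hom_add algebra_simps)

lemma mpoly_hom_prod: "mpoly_hom h \<sigma> (\<Prod>i\<in>X. F i) = (\<Prod>i\<in>X. mpoly_hom h \<sigma> (F i))"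
  by (induction X rule: infinite_finite_induct) (auto simp: mpoly_hom_mult)

end

lemma eval_mpoly_eq_mpoly_hom: "eval_mpoly c f = mpoly_hom (\<lambda>a. a) c f"
  by (simp add: eval_mpoly_def mpoly_hom_def mono_val_def)

global_interpretation evaluation: coefficient_hom "\<lambda>a :: 'k::comm_ring_1. a"
  by unfold_locales simp_all

abbreviation subst :: "('x \<Rightarrow> ('x, 'k::comm_ring_1) mpoly) \<Rightarrow> ('x, 'k) mpoly \<Rightarrow> ('x, 'k) mpoly" where
  "subst \<equiv> mpoly_hom const"

global_interpretation substitution: coefficient_hom "const :: 'k::comm_ring_1 \<Rightarrow> ('x, 'k) mpoly"
  by unfold_locales (simp_all add: const_hom)

lemma mono_val_indet:
  "mono_val (indet :: 'x \<Rightarrow> ('x, 'k::comm_ring_1) mpoly) m = monomial m"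
proof -
  have pow: "indet v ^ k = (monomial (single v k) :: ('x, 'k) mpoly)" for v :: 'x and k
  proof (induction k)
    case 0
    show ?case by (simp add: monomial_def)
  next
    case (Suc k)
    have "single v (Suc k) = single v 1 + single v k" by (simp flip: single_add)
    then show ?case using Suc by (simp add: indet_def flip: monomial_add)
  qed
  have "(\<Prod>v\<in>A. monomial (single v (lookup m v))) = (monomial (\<Sum>v\<in>A. single v (lookup m v)) :: ('x, 'k) mpoly)"
    for A :: "'x set"
    by (induction A rule: infinite_finite_induct) (auto simp: monomial_add, simp_all add: monomial_def)
  then show ?thesis
    unfolding mono_val_def pow by (simp flip: poly_mapping_sum_single)
qed

lemma subst_indet [simp]: "subst indet f = f"
  unfolding mpoly_hom_def mono_val_indet
  by (simp flip: single_eq_const_monomial poly_mapping_sum_single)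

lemma in_indets_subset_iff: "indets f \<subseteq> A \<longleftrightarrow> (\<forall>m\<in>keys f. keys m \<subseteq> A)"
  by (auto simp: indets_def)

lemma subring_of_polys: "subring_of {f :: ('x, 'k::comm_ring_1) mpoly. indets f \<subseteq> A}"
proof
  fix f g :: "('x, 'k) mpoly" assume f: "f \<in> {f. indets f \<subseteq> A}"
  show "- f \<in> {f. indets f \<subseteq> A}"
  proof -
    have "keys (- f) = keys f" by (auto simp: in_keys_iff)
    then show ?thesis using f by (simp add: in_indets_subset_iff)
  qed
  assume g: "g \<in> {f. indets f \<subseteq> A}"
  show "f + g \<in> {f. indets f \<subseteq> A}"
    using f g keys_add[of f g] by (auto simp: in_indets_subset_iff)
  show "f * g \<in> {f. indets f \<subseteq> A}"
  proof -
    have "keys m \<subseteq> A" if m: "m \<in> keys (f * g)" for m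
    proof -
      obtain s t where st: "m = s + t" "s \<in> keys f" "t \<in> keys g" using m keys_mult[of f g] by auto
      then have "keys s \<subseteq> A" "keys t \<subseteq> A" using f g by (auto simp: in_indets_subset_iff)
      then show ?thesis using st(1) keys_add[of s t] by blast
    qed
    then show ?thesis by (simp add: in_indets_subset_iff)
  qed
qed (auto simp: in_indets_subset_iff)

lemma mpoly_hom_cong:
  assumes "indets f \<subseteq> A" "\<And>v. v \<in> A \<Longrightarrow> \<sigma> v = \<tau> v"
  shows "mpoly_hom h \<sigma> f = mpoly_hom h \<tau> f"
proof -
  have "mono_val \<sigma> m = mono_val \<tau> m" if "m \<in> keys f" for m
  proof -
    have "keys m \<subseteq> A" using assms(1) that by (simp add: in_indets_subset_iff)
    then show ?thesis unfolding mono_val_def using assms(2) by (intro prod.cong) auto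
  qed
  then show ?thesis unfolding mpoly_hom_def by simp
qed

subsection \<open>Functions that depend polynomially on a parameter\<close>

context function_ring
begin

lemma fr_mono_val:
  assumes "\<And>v. v \<in> keys m \<Longrightarrow> (\<lambda>g. u g v) \<in> P"
  shows "(\<lambda>g. mono_val (u g) m) \<in> P"
  unfolding mono_val_def by (intro fr_prod fr_power assms)

lemma fr_eval_mpoly:
  assumes "indets p \<subseteq> A" "\<And>v. v \<in> A \<Longrightarrow> (\<lambda>g. u g v) \<in> P"
  shows "(\<lambda>g. eval_mpoly (u g) p) \<in> P"
  unfolding eval_mpoly_eq_mpoly_hom mpoly_hom_def
  using assms by (intro fr_sum fr_mult fr_const fr_mono_val) (auto simp: in_indets_subset_iff)

definition coeffs_in :: "('g \<Rightarrow> ('x, 'k) mpoly) \<Rightarrow> bool" where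
  "coeffs_in F \<longleftrightarrow> (\<forall>c. (\<lambda>g. lookup (F g) c) \<in> P)"

lemma coeffs_in_mult: "coeffs_in F \<Longrightarrow> coeffs_in G \<Longrightarrow> coeffs_in (\<lambda>g. F g * G g)"
  unfolding coeffs_in_def lookup_mult_sum by (intro allI fr_sum fr_mult) auto

lemma coeffs_in_const: "coeffs_in (\<lambda>_. f)"
  unfolding coeffs_in_def by (auto intro: fr_const)

lemma coeffs_in_power: "coeffs_in F \<Longrightarrow> coeffs_in (\<lambda>g. F g ^ k)"
  by (induction k) (auto intro: coeffs_in_mult coeffs_in_const)

lemma coeffs_in_sum: "(\<And>i. i \<in> X \<Longrightarrow> coeffs_in (F i)) \<Longrightarrow> coeffs_in (\<lambda>g. \<Sum>i\<in>X. F i g)"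
  unfolding coeffs_in_def lookup_sum by (auto intro!: fr_sum)

lemma coeffs_in_prod: "(\<And>i. i \<in> X \<Longrightarrow> coeffs_in (F i)) \<Longrightarrow> coeffs_in (\<lambda>g. \<Prod>i\<in>X. F i g)"
  by (induction X rule: infinite_finite_induct) (auto intro: coeffs_in_mult coeffs_in_const)

lemma coeffs_in_subst:
  assumes "indets f \<subseteq> A" "\<And>v. v \<in> A \<Longrightarrow> coeffs_in (\<lambda>g. \<sigma> g v)"
  shows "coeffs_in (\<lambda>g. subst (\<sigma> g) f)"
  unfolding mpoly_hom_def mono_val_def
proof (intro coeffs_in_sum coeffs_in_mult[OF coeffs_in_const] coeffs_in_prod coeffs_in_power)
  fix m v assume "m \<in> keys f" "v \<in> keys m"
  then show "coeffs_in (\<lambda>g. \<sigma> g v)" using assms by (auto simp: in_indets_subset_iff)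
qed

end

text \<open>The polynomial functions on a set \<open>G\<close> that is embedded in an affine space by the
  coordinates \<open>x\<close>.\<close>

definition coordinate_functions :: "'g set \<Rightarrow> ('g \<Rightarrow> 'x \<Rightarrow> 'k::comm_ring_1) \<Rightarrow> 'x set \<Rightarrow> ('g \<Rightarrow> 'k) set" where
  "coordinate_functions G x X = {u. \<exists>p. indets p \<subseteq> X \<and> (\<forall>g\<in>G. u g = eval_mpoly (x g) p)}"

lemma function_ring_coordinate_functions: "function_ring (coordinate_functions G x X)"
proof -
  interpret S: subring_of "{f. indets f \<subseteq> X}" by (rule subring_of_polys)
  show ?thesis
  proof
    fix c
    show "(\<lambda>_. c) \<in> coordinate_functions G x X"
      unfolding coordinate_functions_def eval_mpoly_eq_mpoly_hom
      by (clarsimp, rule exI[of _ "const c"]) (auto simp: in_indets_subset_iff const_def split: if_splits)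
  next
    fix u v assume "u \<in> coordinate_functions G x X" "v \<in> coordinate_functions G x X"
    then obtain a b where ab: "indets a \<subseteq> X" "\<And>g. g \<in> G \<Longrightarrow> u g = eval_mpoly (x g) a"
        "indets b \<subseteq> X" "\<And>g. g \<in> G \<Longrightarrow> v g = eval_mpoly (x g) b"
      by (auto simp: coordinate_functions_def)
    show "(\<lambda>g. u g + v g) \<in> coordinate_functions G x X"
      unfolding coordinate_functions_def mem_Collect_eq
      by (rule exI[of _ "a + b"]) (use ab S.R_add[of a b] in \<open>auto simp: eval_mpoly_eq_mpoly_hom evaluation.mpoly_hom_add\<close>)
    show "(\<lambda>g. u g * v g) \<in> coordinate_functions G x X"
      unfolding coordinate_functions_def mem_Collect_eq
      by (rule exI[of _ "a * b"]) (use ab S.R_mult[of a b] in \<open>auto simp: eval_mpoly_eq_mpoly_hom evaluation.mpoly_hom_mult\<close>)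
  qed
qed

lemma coordinate_functions_coordinate: "c \<in> X \<Longrightarrow> (\<lambda>g. x g c) \<in> coordinate_functions G x X"
  unfolding coordinate_functions_def mem_Collect_eq
  by (rule exI[of _ "indet c"])
    (auto simp: eval_mpoly_eq_mpoly_hom indet_def monomial_def indets_def split: if_splits)

section \<open>Monomials, leading monomials and homogeneous ideals\<close>

lemma finite_has_greatest:
  assumes "finite A" "A \<noteq> {}"
    and trans: "\<And>x y z. gt x y \<Longrightarrow> gt y z \<Longrightarrow> gt x z"
    and total: "\<And>x y. x \<in> A \<Longrightarrow> y \<in> A \<Longrightarrow> x \<noteq> y \<Longrightarrow> gt x y \<or> gt y x"
  shows "\<exists>s\<in>A. \<forall>t\<in>A. t \<noteq> s \<longrightarrow> gt s t"
  using assms(1,2) total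
proof (induction A rule: finite_ne_induct)
  case (insert x F)
  then obtain s where s: "s \<in> F" "\<forall>t\<in>F. t \<noteq> s \<longrightarrow> gt s t" by auto
  consider "gt x s" | "gt s x"
    using insert.prems[of x s] insert.hyps s(1) by auto
  then show ?case
  proof cases
    case 1
    then show ?thesis using s trans by (intro bexI[of _ x]) auto
  next
    case 2
    then show ?thesis using s by (intro bexI[of _ s]) auto
  qed
qed simp

lemma wdeg_superset:
  "finite A \<Longrightarrow> keys m \<subseteq> A \<Longrightarrow> wdeg q m = (\<Sum>v\<in>A. q (fst v) * lookup m v)"
  unfolding wdeg_def by (rule sum.mono_neutral_left) (auto simp: in_keys_iff)

lemma wdeg_zero [simp]: "wdeg q 0 = 0"
  by (simp add: wdeg_def)

lemma wdeg_single [simp]: "wdeg q (single v k) = q (fst v) * k"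
  by (simp add: wdeg_def)

lemma wdeg_add: "wdeg q (s + t) = wdeg q s + wdeg q t"
proof -
  let ?A = "keys s \<union> keys t"
  have "wdeg q (s + t) = (\<Sum>v\<in>?A. q (fst v) * lookup (s + t) v)"
    by (intro wdeg_superset keys_add) simp
  then show ?thesis
    by (simp add: wdeg_superset[of ?A s] wdeg_superset[of ?A t] lookup_add algebra_simps sum.distrib)
qed

lemma keys_add_mono: "keys (s + t) = keys s \<union> keys t" for s t :: "'x mono"
  by (auto simp: in_keys_iff lookup_add)

lemma mono_diff_single: "v \<in> keys m \<Longrightarrow> (m - single v 1) + single v 1 = m" for m :: "'x mono"
  by (rule poly_mapping_eqI) (auto simp: lookup_add lookup_minus lookup_single when_def in_keys_iff)

lemma drl_greater_irrefl: "\<not> drl_greater q s s"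
  by (simp add: drl_greater_def)

lemma drl_greater_trans:
  assumes "drl_greater q s t" "drl_greater q t u"
  shows "drl_greater q s u"
proof (cases "wdeg q s = wdeg q t \<and> wdeg q t = wdeg q u")
  case True
  with assms obtain v w where v: "lookup s v < lookup t v" "\<forall>x. var_after x v \<longrightarrow> lookup s x = lookup t x"
    and w: "lookup t w < lookup u w" "\<forall>x. var_after x w \<longrightarrow> lookup t x = lookup u x"
    by (auto simp: drl_greater_def)
  have tot: "v = w \<or> var_after v w \<or> var_after w v"
    by (auto simp: var_after_def prod_eq_iff)
  have tr: "var_after x y \<Longrightarrow> var_after y z \<Longrightarrow> var_after x z" for x y z
    by (auto simp: var_after_def)
  have "\<exists>z. lookup s z < lookup u z \<and> (\<forall>x. var_after x z \<longrightarrow> lookup s x = lookup u x)"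
    using tot
  proof (elim disjE)
    assume "v = w"
    then show ?thesis using v w by (intro exI[of _ v]) auto
  next
    assume vw: "var_after v w"
    then have "lookup t v = lookup u v" using w(2) by blast
    then show ?thesis using vw v w tr by (intro exI[of _ v]) metis
  next
    assume wv: "var_after w v"
    then have "lookup s w = lookup t w" using v(2) by blast
    then show ?thesis using wv v w tr by (intro exI[of _ w]) metis
  qed
  with True show ?thesis by (auto simp: drl_greater_def)
qed (use assms in \<open>auto simp: drl_greater_def\<close>)

lemma drl_greater_total:
  assumes "s \<noteq> t"
  shows "drl_greater q s t \<or> drl_greater q t s"
proof -
  let ?D = "{v. lookup s v \<noteq> lookup t v}"
  have "finite ?D"
    by (rule finite_subset[of _ "keys s \<union> keys t"]) (auto simp: in_keys_iff)
  moreover have "?D \<noteq> {}" using assms poly_mapping_eqI[of s t] by auto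
  ultimately have "\<exists>v\<in>?D. \<forall>w\<in>?D. w \<noteq> v \<longrightarrow> var_after v w"
    by (rule finite_has_greatest) (auto simp: var_after_def prod_eq_iff)
  then obtain v where "v \<in> ?D" "\<forall>w\<in>?D. w \<noteq> v \<longrightarrow> var_after v w" by blast
  moreover have "\<not> var_after w v" if "var_after v w \<or> w = v" for w
    using that by (auto simp: var_after_def)
  ultimately have "lookup s v \<noteq> lookup t v" "\<forall>w. var_after w v \<longrightarrow> lookup s w = lookup t w"
    by blast+
  then consider "lookup s v < lookup t v" "\<forall>w. var_after w v \<longrightarrow> lookup s w = lookup t w"
    | "lookup t v < lookup s v" "\<forall>w. var_after w v \<longrightarrow> lookup t w = lookup s w"
    by (metis linorder_neqE_nat)
  then show ?thesis
    unfolding drl_greater_def by (metis linorder_neqE_nat)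
qed

lemma drl_greater_add: "drl_greater q (u + s) (u + t) \<longleftrightarrow> drl_greater q s t"
  by (simp add: drl_greater_def wdeg_add lookup_add)

lemma drl_greater_asym: "drl_greater q s t \<Longrightarrow> \<not> drl_greater q t s"
  using drl_greater_trans drl_greater_irrefl by blast

lemma lead_mono:
  assumes "f \<noteq> 0"
  shows "lead_mono q f \<in> keys f" "\<And>t. t \<in> keys f \<Longrightarrow> t \<noteq> lead_mono q f \<Longrightarrow> drl_greater q (lead_mono q f) t"
proof -
  have "keys f \<noteq> {}" using assms by (metis keys_zero poly_mapping_eqI in_keys_iff empty_iff lookup_zero)
  then have ex: "\<exists>s\<in>keys f. \<forall>t\<in>keys f. t \<noteq> s \<longrightarrow> drl_greater q s t"
    using drl_greater_trans drl_greater_total by (intro finite_has_greatest) auto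
  then obtain s where s: "s \<in> keys f" "\<forall>t\<in>keys f. t \<noteq> s \<longrightarrow> drl_greater q s t" by blast
  have "lead_mono q f = s"
    unfolding lead_mono_def
  proof (rule the_equality)
    fix u assume "u \<in> keys f \<and> (\<forall>t\<in>keys f. t \<noteq> u \<longrightarrow> drl_greater q u t)"
    then show "u = s" using s drl_greater_asym[of q u s] by metis
  qed (use s in blast)
  then show "lead_mono q f \<in> keys f"
    "\<And>t. t \<in> keys f \<Longrightarrow> t \<noteq> lead_mono q f \<Longrightarrow> drl_greater q (lead_mono q f) t"
    using s by auto
qed

lemma lead_mono_eqI:
  assumes "s \<in> keys f" "\<And>t. t \<in> keys f \<Longrightarrow> t \<noteq> s \<Longrightarrow> drl_greater q s t"
  shows "lead_mono q f = s"
proof -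
  have "f \<noteq> 0" using assms(1) by auto
  from lead_mono[OF this, where q = q] show ?thesis
    using assms drl_greater_asym[of q s "lead_mono q f"] by metis
qed

lemma lead_mono_monomial_mult:
  fixes f :: "(var, 'k::comm_ring_1) mpoly"
  assumes "f \<noteq> 0"
  shows "lead_mono q (monomial s * f) = s + lead_mono q f"
proof (rule lead_mono_eqI)
  show "s + lead_mono q f \<in> keys (monomial s * f)"
    using lead_mono(1)[OF assms] by (simp add: keys_monomial_mult)
  fix t assume t: "t \<in> keys (monomial s * f)" "t \<noteq> s + lead_mono q f"
  then obtain u where "t = s + u" "u \<in> keys f" by (auto simp: keys_monomial_mult)
  then show "drl_greater q (s + lead_mono q f) t"
    using t lead_mono(2)[OF assms, of u q] by (auto simp: drl_greater_add)
qed

lemma monomial_mult_eq_0_iff: "monomial s * f = 0 \<longleftrightarrow> f = 0"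
  for f :: "('x, 'k::comm_ring_1) mpoly"
proof
  assume "monomial s * f = 0"
  then show "f = 0" using keys_monomial_mult[of s f] by (metis image_is_empty keys_zero in_keys_iff empty_iff poly_mapping_eqI lookup_zero)
qed simp

lemma lookup_hom_component: "lookup (hom_component q d f) m = (if wdeg q m = d then lookup f m else 0)"
proof -
  have "lookup (hom_component q d f) m =
      (\<Sum>s\<in>{s \<in> keys f. wdeg q s = d}. if s = m then lookup f s else 0)"
    unfolding hom_component_def lookup_sum by (rule sum.cong) (auto simp: lookup_single when_def)
  then show ?thesis by (auto simp: sum.delta in_keys_iff)
qed

lemma keys_hom_component: "keys (hom_component q d f) = {m \<in> keys f. wdeg q m = d}"
  by (auto simp: in_keys_iff lookup_hom_component split: if_splits)

lemma homogeneous_hom_component: "homogeneous q d (hom_component q d f)"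
  by (auto simp: homogeneous_def keys_hom_component)

lemma hom_component_add: "hom_component q d (f + g) = hom_component q d f + hom_component q d g"
  by (rule poly_mapping_eqI) (simp add: lookup_hom_component lookup_add)

lemma hom_component_homogeneous:
  "homogeneous q d f \<Longrightarrow> hom_component q e f = (if e = d then f else 0)"
  by (rule poly_mapping_eqI) (auto simp: lookup_hom_component homogeneous_def in_keys_iff)

lemma sum_hom_components: "f = (\<Sum>d\<in>wdeg q ` keys f. hom_component q d f)"
proof (rule poly_mapping_eqI)
  fix m
  have "lookup (\<Sum>d\<in>wdeg q ` keys f. hom_component q d f) m =
      (\<Sum>d\<in>wdeg q ` keys f. if d = wdeg q m then lookup f m else 0)"
    unfolding lookup_sum by (rule sum.cong) (auto simp: lookup_hom_component)
  then show "lookup f m = lookup (\<Sum>d\<in>wdeg q ` keys f. hom_component q d f) m"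
    by (auto simp: in_keys_iff)
qed

lemma homogeneous_add: "homogeneous q d f \<Longrightarrow> homogeneous q d g \<Longrightarrow> homogeneous q d (f + g)"
  using keys_add[of f g] by (auto simp: homogeneous_def)

lemma homogeneous_zero [simp]: "homogeneous q d 0"
  by (simp add: homogeneous_def)

lemma homogeneous_sum: "(\<And>i. i \<in> X \<Longrightarrow> homogeneous q d (F i)) \<Longrightarrow> homogeneous q d (\<Sum>i\<in>X. F i)"
  by (induction X rule: infinite_finite_induct) (auto intro: homogeneous_add)

lemma homogeneous_const_mult: "homogeneous q d f \<Longrightarrow> homogeneous q d (const a * f)"
  for f :: "(var, 'k::comm_ring_1) mpoly"
  by (auto simp: homogeneous_def in_keys_iff)

lemma homogeneous_mult:
  fixes f g :: "(var, 'k::comm_ring_1) mpoly"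
  assumes "homogeneous q d f" "homogeneous q e g"
  shows "homogeneous q (d + e) (f * g)"
  unfolding homogeneous_def
proof
  fix m assume "m \<in> keys (f * g)"
  then obtain s t where "m = s + t" "s \<in> keys f" "t \<in> keys g" using keys_mult[of f g] by blast
  then show "wdeg q m = d + e" using assms by (simp add: homogeneous_def wdeg_add)
qed

lemma homogeneous_single: "wdeg q m = d \<Longrightarrow> homogeneous q d (single m a)"
  by (auto simp: homogeneous_def)

lemma keys_sum_subset: "keys (\<Sum>i\<in>X. F i) \<subseteq> (\<Union>i\<in>X. keys (F i))"
proof (induction X rule: infinite_finite_induct)
  case (insert i X)
  then show ?case using keys_add[of "F i" "\<Sum>i\<in>X. F i"] by auto
qed auto

lemma drl_has_greatest:
  assumes "finite A" "A \<noteq> {}"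
  shows "\<exists>s\<in>A. \<forall>t\<in>A. t \<noteq> s \<longrightarrow> drl_greater q s t"
  using assms by (rule finite_has_greatest) (blast intro: drl_greater_trans dest: drl_greater_total)+

text \<open>The parameter \<open>R\<close>, although determined by \<open>n\<close> and \<open>l\<close>, ties the locale to one field of
  coefficients.\<close>

locale weighted_ring =
  fixes n :: nat and l q :: "nat \<Rightarrow> nat" and R :: "(var, 'k::field) mpoly set"
  assumes q_pos: "\<And>i. i \<in> {1..n} \<Longrightarrow> 0 < q i"
    and R_def: "R = {f. indets f \<subseteq> vars n l}"
begin

abbreviation "V \<equiv> vars n l"
abbreviation greater (infix "\<succ>" 50) where "s \<succ> t \<equiv> drl_greater q s t"
abbreviation lead where "lead \<equiv> lead_mono q"

sublocale subring_of R
  unfolding R_def by (rule subring_of_polys)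

lemma finite_V: "finite V"
  by (simp add: vars_def)

lemma in_R_iff: "f \<in> R \<longleftrightarrow> (\<forall>m\<in>keys f. keys m \<subseteq> V)"
  by (simp add: R_def in_indets_subset_iff)

lemma q_pos_V: "v \<in> V \<Longrightarrow> 0 < q (fst v)"
  by (auto simp: vars_def intro: q_pos)

definition Mon :: "var mono set" where "Mon = {m. keys m \<subseteq> V}"
definition Mon_deg :: "nat \<Rightarrow> var mono set" where "Mon_deg d = {m \<in> Mon. wdeg q m = d}"

lemma in_R_Mon: "f \<in> R \<longleftrightarrow> keys f \<subseteq> Mon"
  by (auto simp: in_R_iff Mon_def)

lemma Mon_add: "s + t \<in> Mon \<longleftrightarrow> s \<in> Mon \<and> t \<in> Mon"
  by (auto simp: Mon_def keys_add_mono)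

lemma Mon_zero [simp]: "0 \<in> Mon"
  by (simp add: Mon_def)

lemma Mon_single: "v \<in> V \<Longrightarrow> single v k \<in> Mon"
  by (simp add: Mon_def)

lemma single_in_R: "m \<in> Mon \<Longrightarrow> single m a \<in> R"
  by (simp add: in_R_Mon)

lemma monomial_in_R: "m \<in> Mon \<Longrightarrow> monomial m \<in> R"
  by (simp add: single_in_R monomial_def)

lemma const_in_R: "const a \<in> R"
  by (simp add: const_def single_in_R)

lemma indet_in_R: "v \<in> V \<Longrightarrow> indet v \<in> R"
  by (simp add: indet_def monomial_in_R Mon_single)

lemma sum_in_R: "(\<And>i. i \<in> X \<Longrightarrow> F i \<in> R) \<Longrightarrow> (\<Sum>i\<in>X. F i) \<in> R"
  by (induction X rule: infinite_finite_induct) (auto intro: R0 R_add)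

lemma hom_component_in_R: "f \<in> R \<Longrightarrow> hom_component q d f \<in> R"
  by (auto simp: in_R_Mon keys_hom_component)

lemma finite_Mon_deg: "finite (Mon_deg d)"
proof (rule finite_imageD[where f = lookup])
  let ?F = "{f. \<forall>x. (x \<in> V \<longrightarrow> f x \<in> {..d}) \<and> (x \<notin> V \<longrightarrow> f x = 0)}"
  have "lookup m \<in> ?F" if "m \<in> Mon_deg d" for m
  proof -
    have "lookup m v \<le> d" if v: "v \<in> V" for v
    proof -
      have "lookup m v \<le> q (fst v) * lookup m v" using q_pos_V[OF v] by simp
      also have "\<dots> \<le> (\<Sum>v\<in>V. q (fst v) * lookup m v)"
        by (rule member_le_sum) (use v finite_V in auto)
      also have "\<dots> = d" using \<open>m \<in> Mon_deg d\<close> wdeg_superset[OF finite_V, of m q] by (simp add: Mon_deg_def Mon_def)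
      finally show ?thesis .
    qed
    moreover have "lookup m v = 0" if "v \<notin> V" for v
      using that \<open>m \<in> Mon_deg d\<close> by (auto simp: Mon_deg_def Mon_def in_keys_iff)
    ultimately show ?thesis by auto
  qed
  then have "lookup ` Mon_deg d \<subseteq> ?F" by (intro image_subsetI) blast
  moreover have "finite ?F" using finite_V by (rule finite_set_of_finite_funs) auto
  ultimately show "finite (lookup ` Mon_deg d)" by (rule finite_subset)
qed (simp add: inj_on_def poly_mapping_eqI)

lemma Mon_deg_0: "m \<in> Mon \<Longrightarrow> wdeg q m = 0 \<Longrightarrow> m = 0"
proof (rule poly_mapping_eqI)
  fix v assume m: "m \<in> Mon" "wdeg q m = 0"
  show "lookup m v = lookup 0 v"
  proof (cases "v \<in> keys m")
    case True
    then have "q (fst v) * lookup m v = 0" "v \<in> V" using m by (auto simp: wdeg_def Mon_def)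
    then show ?thesis using q_pos_V[of v] by simp
  qed (simp add: in_keys_iff)
qed

subsection \<open>Homogeneous ideals\<close>

definition graded_ideal :: "(var, 'k) mpoly set \<Rightarrow> bool" where
  "graded_ideal I \<longleftrightarrow> is_ideal I \<and> (\<forall>f\<in>I. \<forall>d. hom_component q d f \<in> I)"

definition leads :: "(var, 'k) mpoly set \<Rightarrow> var mono set" where
  "leads I = {lead f | f. f \<in> I \<and> f \<noteq> 0}"

lemma graded_idealD:
  assumes "graded_ideal I"
  shows "is_ideal I" "f \<in> I \<Longrightarrow> hom_component q d f \<in> I"
  using assms by (auto simp: graded_ideal_def)

lemma ideal_const_mult: "is_ideal I \<Longrightarrow> f \<in> I \<Longrightarrow> const a * f \<in> I"
  by (rule is_idealD(4)) (auto intro: const_in_R)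

lemma ideal_sum: "is_ideal I \<Longrightarrow> (\<And>i. i \<in> X \<Longrightarrow> F i \<in> I) \<Longrightarrow> (\<Sum>i\<in>X. F i) \<in> I"
  by (induction X rule: infinite_finite_induct) (auto intro: is_idealD)

lemma leads_Mon: "is_ideal I \<Longrightarrow> leads I \<subseteq> Mon"
proof
  fix m assume I: "is_ideal I" and "m \<in> leads I"
  then obtain f where f: "f \<in> I" "f \<noteq> 0" "m = lead f" by (auto simp: leads_def)
  then show "m \<in> Mon" using lead_mono(1)[of f q] is_idealD(1)[OF I f(1)] by (auto simp: in_R_Mon)
qed

lemma leads_up:
  assumes "is_ideal I" "m \<in> leads I" "t \<in> Mon"
  shows "t + m \<in> leads I"
proof -
  obtain f where "f \<in> I" "f \<noteq> 0" "m = lead f" using assms by (auto simp: leads_def)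
  then show ?thesis
    unfolding leads_def mem_Collect_eq using assms
    by (intro exI[of _ "monomial t * f"])
      (auto simp: lead_mono_monomial_mult monomial_mult_eq_0_iff
        intro!: is_idealD(4)[OF assms(1)] monomial_in_R)
qed

lemma lead_in_leads: "f \<in> I \<Longrightarrow> f \<noteq> 0 \<Longrightarrow> lead f \<in> leads I"
  by (auto simp: leads_def)

lemma leads_representative:
  assumes "graded_ideal I" "m \<in> leads I"
  obtains f where "f \<in> I" "homogeneous q (wdeg q m) f" "lookup f m = 1"
    "\<And>t. t \<in> keys f \<Longrightarrow> t \<noteq> m \<Longrightarrow> m \<succ> t"
proof -
  obtain f where f: "f \<in> I" "f \<noteq> 0" "m = lead f" using assms by (auto simp: leads_def)
  have m: "m \<in> keys f" using lead_mono(1)[OF f(2), where q = q] f(3) by simp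
  define h where "h = const (inverse (lookup f m)) * hom_component q (wdeg q m) f"
  have keys_h: "keys h \<subseteq> keys f" by (auto simp: h_def in_keys_iff lookup_hom_component split: if_splits)
  show ?thesis
  proof (rule that)
    show "h \<in> I" unfolding h_def
      using assms f by (intro ideal_const_mult graded_idealD)
    show "homogeneous q (wdeg q m) h" unfolding h_def
      by (intro homogeneous_const_mult homogeneous_hom_component)
    show "lookup h m = 1" using m by (simp add: h_def lookup_hom_component in_keys_iff)
    show "m \<succ> t" if "t \<in> keys h" "t \<noteq> m" for t
      using that keys_h lead_mono(2)[OF f(2)] f(3) by blast
  qed
qed

text \<open>Division by a homogeneous ideal. Subtracting a multiple of an element of \<open>I\<close> replaces the greatest
  term in \<open>leads I\<close> by smaller ones of the same degree. There are finitely many monomials of that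
  degree, so the process ends; \<open>rank\<close> counts the smaller ones.\<close>

lemma reduce_homogeneous:
  assumes I: "graded_ideal I" and f: "f \<in> R" "homogeneous q d f"
  shows "\<exists>g\<in>R. homogeneous q d g \<and> f - g \<in> I \<and> keys g \<inter> leads I = {} \<and>
    (\<forall>t\<in>keys g. t \<in> keys f \<or> (\<exists>s\<in>keys f \<inter> leads I. s \<succ> t))"
proof -
  have zI: "0 \<in> I" using I by (rule is_idealD(2)[OF graded_idealD(1)])
  define rank where "rank m = card {t \<in> Mon_deg d. m \<succ> t}" for m
  have rank: "rank t < rank m" if "m \<succ> t" "t \<in> Mon_deg d" for m t
    unfolding rank_def
  proof (rule psubset_card_mono)
    show "{u \<in> Mon_deg d. t \<succ> u} \<subset> {t \<in> Mon_deg d. m \<succ> t}"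
      using that drl_greater_irrefl[of q t] drl_greater_trans[of q m t] by blast
  qed (simp add: finite_Mon_deg)
  have main: "\<exists>g\<in>R. homogeneous q d g \<and> f - g \<in> I \<and> keys g \<inter> leads I = {} \<and>
      (\<forall>t\<in>keys g. t \<in> keys f \<or> (\<exists>s\<in>keys f \<inter> leads I. s \<succ> t))"
    if "\<forall>m\<in>keys f \<inter> leads I. rank m < k" "f \<in> R" "homogeneous q d f" for f k
    using that
  proof (induction k arbitrary: f)
    case 0
    then have "keys f \<inter> leads I = {}" by blast
    then show ?case using 0 zI by (intro bexI[of _ f]) auto
  next
    case (Suc k)
    show ?case
    proof (cases "keys f \<inter> leads I = {}")
      case True
      then show ?thesis using Suc.prems zI by (intro bexI[of _ f]) auto
    next
      case False
      then obtain m where m: "m \<in> keys f \<inter> leads I" "\<forall>t\<in>keys f \<inter> leads I. t \<noteq> m \<longrightarrow> m \<succ> t"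
        using drl_has_greatest[of "keys f \<inter> leads I" q] by auto
      have dm: "wdeg q m = d" using m(1) Suc.prems by (auto simp: homogeneous_def)
      obtain h where h: "h \<in> I" "homogeneous q d h" "lookup h m = 1"
          "\<And>t. t \<in> keys h \<Longrightarrow> t \<noteq> m \<Longrightarrow> m \<succ> t"
        using leads_representative[OF I, of m] m(1) unfolding dm by blast
      have hR: "h \<in> R" using h I is_idealD(1)[OF graded_idealD(1)[OF I]] by blast
      define f1 where "f1 = f + const (- lookup f m) * h"
      have lf1: "lookup f1 t = lookup f t - lookup f m * lookup h t" for t
        by (simp add: f1_def lookup_add)
      have f1: "f1 \<in> R" "homogeneous q d f1" "f - f1 \<in> I"
      proof -
        show "f1 \<in> R" unfolding f1_def using Suc.prems hR by (intro R_add R_mult const_in_R)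
        show "homogeneous q d f1" unfolding f1_def
          using Suc.prems h by (intro homogeneous_add homogeneous_const_mult)
        have "f - f1 = const (lookup f m) * h"
          by (rule poly_mapping_eqI) (simp add: lf1 lookup_minus)
        then show "f - f1 \<in> I" using ideal_const_mult h I graded_idealD by metis
      qed
      have k1: "t \<in> keys f \<or> m \<succ> t" "t \<noteq> m" if "t \<in> keys f1" for t
        using that h(4)[of t] h(3) by (cases "t = m"; auto simp: in_keys_iff lf1)+
      have "rank t < k" if t: "t \<in> keys f1 \<inter> leads I" for t
      proof -
        have "m \<succ> t" using k1[of t] t m by blast
        moreover have "t \<in> Mon_deg d"
          using t f1 by (auto simp: Mon_deg_def in_R_Mon homogeneous_def)
        ultimately have "rank t < rank m" by (rule rank)
        moreover have "rank m < Suc k" using Suc.prems(1) m(1) by blast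
        ultimately show ?thesis by simp
      qed
      with f1 Suc.IH[of f1] obtain g where g: "g \<in> R" "homogeneous q d g" "f1 - g \<in> I" "keys g \<inter> leads I = {}"
        "\<forall>t\<in>keys g. t \<in> keys f1 \<or> (\<exists>s\<in>keys f1 \<inter> leads I. s \<succ> t)" by blast
      have "f - g = (f - f1) + (f1 - g)" by simp
      then have "f - g \<in> I" using f1(3) g(3) I by (metis is_idealD(3) graded_idealD(1))
      moreover have "t \<in> keys f \<or> (\<exists>s\<in>keys f \<inter> leads I. s \<succ> t)" if "t \<in> keys g" for t
      proof -
        have "t \<in> keys f \<or> m \<succ> t" if "t \<in> keys f1" using k1(1)[OF that] .
        moreover have "(\<exists>s\<in>keys f \<inter> leads I. s \<succ> t)" if "s \<in> keys f1 \<inter> leads I" "s \<succ> t" for s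
          using k1(1)[of s] that m(1) drl_greater_trans[of q m s t] by blast
        ultimately show ?thesis using g(5) \<open>t \<in> keys g\<close> m(1) by blast
      qed
      ultimately show ?thesis using g by blast
    qed
  qed
  have "\<forall>m\<in>keys f \<inter> leads I. rank m < Suc (Max (insert 0 (rank ` keys f)))"
    by (auto simp: less_Suc_eq_le intro!: Max_ge)
  from main[OF this f] show ?thesis .
qed

lemma reduce:
  assumes I: "graded_ideal I" and f: "f \<in> R"
  obtains g where "g \<in> R" "f - g \<in> I" "keys g \<inter> leads I = {}"
proof -
  have "\<exists>g\<in>R. hom_component q d f - g \<in> I \<and> keys g \<inter> leads I = {}" for d
    using reduce_homogeneous[OF I hom_component_in_R[OF f] homogeneous_hom_component] by blast
  then have "\<forall>d. \<exists>g. g \<in> R \<and> hom_component q d f - g \<in> I \<and> keys g \<inter> leads I = {}" by blast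
  from choice[OF this] obtain g where
    g: "g d \<in> R" "hom_component q d f - g d \<in> I" "keys (g d) \<inter> leads I = {}" for d
    by blast
  define G where "G = (\<Sum>d\<in>wdeg q ` keys f. g d)"
  have "f - G = (\<Sum>d\<in>wdeg q ` keys f. hom_component q d f - g d)"
    using sum_hom_components[of f q] by (simp add: G_def sum_subtractf)
  then have "f - G \<in> I" using g I by (simp add: ideal_sum graded_idealD)
  moreover have "t \<notin> leads I" if "t \<in> keys G" for t
  proof -
    obtain d where "t \<in> keys (g d)"
      using \<open>t \<in> keys G\<close> keys_sum_subset[of g "wdeg q ` keys f"] unfolding G_def by blast
    then show ?thesis using g(3)[of d] by blast
  qed
  moreover have "G \<in> R" unfolding G_def by (intro sum_in_R g)
  ultimately show ?thesis using that by blast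
qed

text \<open>The element of the reduced Groebner basis of one degree that belongs to \<open>m\<close>.\<close>

lemma leads_reduced_representative:
  assumes I: "graded_ideal I" and m: "m \<in> leads I"
  obtains f where "f \<in> I" "homogeneous q (wdeg q m) f" "lookup f m = 1"
    "\<And>t. t \<in> keys f \<Longrightarrow> t \<noteq> m \<Longrightarrow> m \<succ> t \<and> t \<notin> leads I"
proof -
  obtain f where f: "f \<in> I" "homogeneous q (wdeg q m) f" "lookup f m = 1"
    "\<And>t. t \<in> keys f \<Longrightarrow> t \<noteq> m \<Longrightarrow> m \<succ> t"
    using leads_representative[OF I m] by blast
  define f0 where "f0 = f + single m (- 1)"
  have lf0: "lookup f0 t = (if t = m then 0 else lookup f t)" for t
    using f(3) by (auto simp: f0_def lookup_add lookup_single)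
  have "m \<in> Mon" using leads_Mon m I graded_idealD by blast
  then have f0: "f0 \<in> R" "homogeneous q (wdeg q m) f0"
    using f is_idealD(1)[OF graded_idealD(1)[OF I]]
    by (auto simp: f0_def intro!: R_add single_in_R homogeneous_add homogeneous_single)
  obtain g where g: "g \<in> R" "homogeneous q (wdeg q m) g" "f0 - g \<in> I" "keys g \<inter> leads I = {}"
    "\<And>t. t \<in> keys g \<Longrightarrow> t \<in> keys f0 \<or> (\<exists>s\<in>keys f0 \<inter> leads I. s \<succ> t)"
    using reduce_homogeneous[OF I f0] by blast
  have small: "m \<succ> t" if "t \<in> keys f0" for t
    using that f(4)[of t] by (auto simp: in_keys_iff lf0 split: if_splits)
  show ?thesis
  proof (rule that[of "g + single m 1"])
    have "g + single m 1 = f - (f0 - g)"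
      by (rule poly_mapping_eqI) (auto simp: lookup_add lookup_minus lf0 lookup_single f(3) when_def)
    then show "g + single m 1 \<in> I" using f(1) g(3) I by (metis is_idealD(6) graded_idealD(1))
    show "homogeneous q (wdeg q m) (g + single m 1)"
      using g by (intro homogeneous_add homogeneous_single) auto
    show "lookup (g + single m 1) m = 1"
      using g(4) m by (auto simp: lookup_add in_keys_iff)
    show "m \<succ> t \<and> t \<notin> leads I" if "t \<in> keys (g + single m 1)" "t \<noteq> m" for t
    proof -
      have t: "t \<in> keys g" using that by (auto simp: in_keys_iff lookup_add lookup_single)
      then show ?thesis using g(4) g(5)[OF t] small drl_greater_trans[of q m _ t] by blast
    qed
  qed
qed

definition monomial_ideal :: "var mono set \<Rightarrow> (var, 'k) mpoly set" where
  "monomial_ideal T = {f. keys f \<subseteq> T}"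

lemma graded_ideal_monomial_ideal:
  assumes "T \<subseteq> Mon" "\<And>s t. s \<in> T \<Longrightarrow> t \<in> Mon \<Longrightarrow> t + s \<in> T"
  shows "graded_ideal (monomial_ideal T)"
  unfolding graded_ideal_def is_ideal_def
proof (intro conjI ballI allI)
  show "monomial_ideal T \<subseteq> R" using assms(1) by (auto simp: monomial_ideal_def in_R_Mon)
  show "f + g \<in> monomial_ideal T" if "f \<in> monomial_ideal T" "g \<in> monomial_ideal T" for f g
    using that keys_add[of f g] by (auto simp: monomial_ideal_def)
  show "r * f \<in> monomial_ideal T" if "r \<in> R" "f \<in> monomial_ideal T" for r f
    using that keys_mult[of r f] assms(2) by (fastforce simp: monomial_ideal_def in_R_Mon)
qed (auto simp: monomial_ideal_def keys_hom_component)

lemma leads_monomial_ideal: "leads (monomial_ideal T) = T"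
proof
  show "leads (monomial_ideal T) \<subseteq> T"
  proof
    fix m assume "m \<in> leads (monomial_ideal T)"
    then obtain f where "f \<in> monomial_ideal T" "f \<noteq> 0" "m = lead f" by (auto simp: leads_def)
    then show "m \<in> T" using lead_mono(1)[of f q] by (auto simp: monomial_ideal_def)
  qed
  show "T \<subseteq> leads (monomial_ideal T)"
  proof
    fix m assume "m \<in> T"
    moreover have "lead (monomial m :: (var, 'k) mpoly) = m"
      by (rule lead_mono_eqI) (auto simp: monomial_def)
    moreover have "(monomial m :: (var, 'k) mpoly) \<noteq> 0"
      using monomial_mult_eq_0_iff[of m "1 :: (var, 'k) mpoly"] by simp
    ultimately show "m \<in> leads (monomial_ideal T)"
      unfolding leads_def mem_Collect_eq
      by (intro exI[of _ "monomial m"]) (auto simp: monomial_ideal_def monomial_def)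
  qed
qed

lemma one_in_graded_ideal:
  assumes "graded_ideal I" "0 \<in> leads I"
  shows "I = R"
proof -
  obtain f where f: "f \<in> I" "homogeneous q (wdeg q 0) f" "lookup f 0 = 1"
    using leads_representative[OF assms] by metis
  have "f = 1"
  proof (rule poly_mapping_eqI)
    fix m
    have "m = 0" if "m \<in> keys f"
      using that f Mon_deg_0[of m] is_idealD(1)[OF graded_idealD(1)[OF assms(1)] f(1)]
      by (auto simp: homogeneous_def in_R_Mon)
    then show "lookup f m = lookup 1 m"
      using f(3) by (cases "m = 0") (auto simp: lookup_one in_keys_iff)
  qed
  then have "r \<in> I" if "r \<in> R" for r
    using is_idealD(4)[OF graded_idealD(1)[OF assms(1)] that f(1)] by simp
  then show ?thesis using is_idealD(1)[OF graded_idealD(1)[OF assms(1)]] by blast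
qed

end

section \<open>Depth in terms of elements\<close>

context subring_of
begin

definition ring_on :: "'a ring" where
  "ring_on = \<lparr>carrier = R, monoid.mult = (*), one = 1, zero = 0, add = (+)\<rparr>"

lemma ring_on_simps [simp]:
  "carrier ring_on = R" "monoid.mult ring_on = (*)" "one ring_on = 1" "zero ring_on = 0" "add ring_on = (+)"
  by (simp_all add: ring_on_def)

lemma cring_ring_on: "cring ring_on"
proof (rule cringI)
  show "abelian_group ring_on"
  proof (rule abelian_groupI)
    show "\<exists>y\<in>carrier ring_on. y \<oplus>\<^bsub>ring_on\<^esub> x = \<zero>\<^bsub>ring_on\<^esub>" if "x \<in> carrier ring_on" for x
      using that R_uminus by (intro bexI[of _ "- x"]) auto
  qed (auto intro: R0 R_add simp: ac_simps)
  show "comm_monoid ring_on"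
    by (rule comm_monoidI) (auto intro: R1 R_mult simp: ac_simps)
qed (auto simp: algebra_simps)

lemma ring_ring_on: "ring ring_on"
  using cring_ring_on by (rule cring.axioms(1))

lemma a_inv_ring_on: "x \<in> R \<Longrightarrow> \<ominus>\<^bsub>ring_on\<^esub> x = - x"
  using abelian_group.minus_equality[OF ring.is_abelian_group[OF ring_ring_on], of "- x" x] R_uminus
  by simp

lemma ideal_ring_on_iff: "ideal I ring_on \<longleftrightarrow> is_ideal I"
proof
  assume "ideal I ring_on"
  then interpret I: ideal I ring_on .
  show "is_ideal I"
    unfolding is_ideal_def 
    using I.a_subset I.I_l_closed additive_subgroup.zero_closed[OF I.additive_subgroup_axioms]
      additive_subgroup.a_closed[OF I.additive_subgroup_axioms] by auto
next
  assume I: "is_ideal I"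
  show "ideal I ring_on"
  proof (rule idealI[OF ring_ring_on])
    show "subgroup I (add_monoid ring_on)"
    proof (rule group.subgroupI)
      show "Group.group (add_monoid ring_on)"
        by (rule abelian_group.a_group[OF ring.is_abelian_group[OF ring_ring_on]])
      show "I \<subseteq> carrier (add_monoid ring_on)" "I \<noteq> {}" using I by (auto simp: is_ideal_def)
      show "inv\<^bsub>add_monoid ring_on\<^esub> a \<in> I" if "a \<in> I" for a
        using that is_idealD(1,5)[OF I that] a_inv_ring_on[of a] by (simp add: a_inv_def)
    qed (use I in \<open>auto simp: is_ideal_def\<close>)
    show "x \<otimes>\<^bsub>ring_on\<^esub> a \<in> I" "a \<otimes>\<^bsub>ring_on\<^esub> x \<in> I" if "a \<in> I" "x \<in> carrier ring_on" for a x
      using is_idealD(4)[OF I, of x a] that by (simp_all add: mult.commute)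
  qed
qed

abbreviation coset :: "'a set \<Rightarrow> 'a \<Rightarrow> 'a set" where "coset I r \<equiv> I +>\<^bsub>ring_on\<^esub> r"

context
  fixes I assumes I: "is_ideal I"
begin

interpretation I: ideal I ring_on
  using I by (simp add: ideal_ring_on_iff)

lemma coset_def': "coset I r = (\<lambda>i. i + r) ` I"
  by (auto simp: a_r_coset_def r_coset_def)

lemma coset_eq_iff: "r \<in> R \<Longrightarrow> s \<in> R \<Longrightarrow> coset I r = coset I s \<longleftrightarrow> r - s \<in> I"
proof
  assume "coset I r = coset I s"
  moreover have "0 + r \<in> coset I r" unfolding coset_def' using is_idealD(2)[OF I] by blast
  ultimately obtain i where "i \<in> I" "0 + r = i + s" unfolding coset_def' by auto
  then show "r - s \<in> I" by (simp add: algebra_simps)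
next
  assume rs: "r - s \<in> I"
  have "i + r \<in> coset I s" if "i \<in> I" for i
    using is_idealD(3)[OF I that rs] unfolding coset_def' by (intro image_eqI[of _ _ "i + (r - s)"]) auto
  moreover have "i + s \<in> coset I r" if "i \<in> I" for i
    using is_idealD(6)[OF I that rs] unfolding coset_def' by (intro image_eqI[of _ _ "i - (r - s)"]) auto
  ultimately show "coset I r = coset I s" unfolding coset_def' by auto
qed

abbreviation M where "M \<equiv> quot_module ring_on I"

lemma carrier_M: "carrier M = coset I ` R"
  by (auto simp: quot_module_def FactRing_def A_RCOSETS_def RCOSETS_def a_r_coset_def)

lemma M_ops:
  "zero M = coset I 0"
  "r \<in> R \<Longrightarrow> s \<in> R \<Longrightarrow> add M (coset I r) (coset I s) = coset I (r + s)"
  "r \<in> R \<Longrightarrow> s \<in> R \<Longrightarrow> r \<odot>\<^bsub>M\<^esub> coset I s = coset I (r * s)"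
proof -
  show "zero M = coset I 0"
    by (simp add: quot_module_def FactRing_def coset_def')
  show "add M (coset I r) (coset I s) = coset I (r + s)" if "r \<in> R" "s \<in> R"
    using I.a_rcos_sum[of r s] that by (simp add: quot_module_def FactRing_def)
  show "r \<odot>\<^bsub>M\<^esub> coset I s = coset I (r * s)" if "r \<in> R" "s \<in> R"
    using I.rcoset_mult_add[of r s] that by (simp add: quot_module_def FactRing_def)
qed

lemma group_add_M: "Group.group (add_monoid M)"
proof -
  have "Group.group (add_monoid (ring_on Quot I))"
    by (rule abelian_group.a_group[OF ring.is_abelian_group[OF I.quotient_is_ring]])
  then show ?thesis
    unfolding Group.group_def Group.monoid_def Group.group_axioms_def Units_def quot_module_def by simp
qed

text \<open>In \<open>R\<close> modulo \<open>I\<close> the submodules are the images of the ideals that contain \<open>I\<close>. This turns the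
  module conditions in the definition of depth into conditions on elements of \<open>R\<close>.\<close>

lemma submodule_of_ideal:
  assumes K: "is_ideal K"
  shows "submodule (coset I ` K) ring_on M"
proof (intro submodule.intro submodule_axioms.intro)
  have KR: "k \<in> K \<Longrightarrow> k \<in> R" for k by (rule is_idealD(1)[OF K])
  show "subgroup (coset I ` K) (add_monoid M)"
  proof (rule group.subgroupI[OF group_add_M])
    show "coset I ` K \<subseteq> carrier (add_monoid M)" using KR by (auto simp: carrier_M)
    show "coset I ` K \<noteq> {}" using is_idealD(2)[OF K] by auto
    show "inv\<^bsub>add_monoid M\<^esub> a \<in> coset I ` K" if a: "a \<in> coset I ` K" for a
    proof -
      obtain k where k: "k \<in> K" "a = coset I k" using a by auto
      have "inv\<^bsub>add_monoid M\<^esub> a = coset I (- k)"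
        using k KR R_uminus
        by (intro group.inv_equality[OF group_add_M]) (auto simp: M_ops carrier_M)
      then show ?thesis using is_idealD(5)[OF K k(1)] by auto
    qed
    show "a \<otimes>\<^bsub>add_monoid M\<^esub> b \<in> coset I ` K" if "a \<in> coset I ` K" "b \<in> coset I ` K" for a b
      using that KR is_idealD(3)[OF K] by (auto simp: M_ops)
  qed
  show "a \<odot>\<^bsub>M\<^esub> x \<in> coset I ` K" if "a \<in> carrier ring_on" "x \<in> coset I ` K" for a x
    using that KR is_idealD(4)[OF K] by (auto simp: M_ops)
qed

lemma ideal_of_submodule:
  assumes N: "submodule N ring_on M"
  shows "is_ideal {r \<in> R. coset I r \<in> N}" "I \<subseteq> {r \<in> R. coset I r \<in> N}"
proof -
  have sub: "subgroup N (add_monoid M)" using N by (rule submodule.axioms(1))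
  have zero: "coset I 0 \<in> N" using subgroup.one_closed[OF sub] by (simp add: M_ops)
  have add: "coset I (r + s) \<in> N" if "coset I r \<in> N" "coset I s \<in> N" "r \<in> R" "s \<in> R" for r s
    using subgroup.m_closed[OF sub that(1,2)] that by (simp add: M_ops)
  have smult: "coset I (r * s) \<in> N" if "coset I s \<in> N" "r \<in> R" "s \<in> R" for r s
    using submodule.smult_closed[OF N, of r] that by (simp add: M_ops(3)[symmetric])
  show "is_ideal {r \<in> R. coset I r \<in> N}"
    unfolding is_ideal_def using zero add smult R0 R_add R_mult by auto
  show "I \<subseteq> {r \<in> R. coset I r \<in> N}"
  proof
    fix i assume i: "i \<in> I"
    then have "coset I i = coset I 0"
      using coset_eq_iff[of i 0] is_idealD(1)[OF I i] R0 by simp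
    then show "i \<in> {r \<in> R. coset I r \<in> N}" using zero is_idealD(1)[OF I i] by simp
  qed
qed

lemma coset_mem_image_iff:
  assumes K: "is_ideal K" "I \<subseteq> K" and r: "r \<in> R"
  shows "coset I r \<in> coset I ` K \<longleftrightarrow> r \<in> K"
proof
  assume "coset I r \<in> coset I ` K"
  then obtain k where k: "k \<in> K" "coset I r = coset I k" by auto
  then have "r - k \<in> K" using coset_eq_iff[OF r is_idealD(1)[OF K(1) k(1)]] K(2) by auto
  from is_idealD(3)[OF K(1) this k(1)] show "r \<in> K" by simp
qed simp

lemma seq_mult_module_eq:
  assumes xs: "set xs \<subseteq> R"
  shows "seq_mult_module ring_on M xs = coset I ` adjoin_list I xs"
proof -
  let ?K = "adjoin_list I xs"
  have K: "is_ideal ?K" by (rule is_ideal_adjoin_list[OF I xs])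
  have "x \<odot>\<^bsub>M\<^esub> u \<in> coset I ` ?K" if x: "x \<in> set xs" and u: "u \<in> carrier M" for x u
  proof -
    obtain r where r: "r \<in> R" "u = coset I r" using u by (auto simp: carrier_M)
    have "x \<in> R" using x xs by blast
    moreover have "r * x \<in> ?K"
      by (rule is_idealD(4)[OF K r(1) adjoin_list_mem[OF I xs x]])
    ultimately show ?thesis using r by (auto simp: M_ops mult.commute)
  qed
  then have "seq_mult_module ring_on M xs \<subseteq> coset I ` ?K"
    unfolding seq_mult_module_def using submodule_of_ideal[OF K] by (intro Inter_lower) blast
  moreover have "coset I ` ?K \<subseteq> N"
    if N: "submodule N ring_on M" "\<forall>x\<in>set xs. \<forall>u\<in>carrier M. x \<odot>\<^bsub>M\<^esub> u \<in> N" for N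
  proof -
    have "x \<in> {r \<in> R. coset I r \<in> N}" if "x \<in> set xs" for x
    proof -
      have "x \<in> R" using that xs by blast
      moreover have "x \<odot>\<^bsub>M\<^esub> coset I 1 \<in> N" using N(2) that R1 by (auto simp: carrier_M)
      ultimately show ?thesis using R1 by (simp add: M_ops)
    qed
    then have "?K \<subseteq> {r \<in> R. coset I r \<in> N}"
      by (intro adjoin_list_minimal ideal_of_submodule N) auto
    then show ?thesis by blast
  qed
  ultimately show ?thesis unfolding seq_mult_module_def by blast
qed

lemma regular_seq_iff:
  assumes xs: "set xs \<subseteq> R"
  shows "regular_seq ring_on M xs \<longleftrightarrow> weakly_regular I xs \<and> adjoin_list I xs \<noteq> R"
proof -
  have "(\<forall>u\<in>carrier M. (xs ! i) \<odot>\<^bsub>M\<^esub> u \<in> seq_mult_module ring_on M (take i xs)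
         \<longrightarrow> u \<in> seq_mult_module ring_on M (take i xs)) \<longleftrightarrow>
      (\<forall>u\<in>R. xs ! i * u \<in> adjoin_list I (take i xs) \<longrightarrow> u \<in> adjoin_list I (take i xs))"
    if "i < length xs" for i
  proof -
    have t: "set (take i xs) \<subseteq> R" using xs set_take_subset[of i xs] by blast
    have x: "xs ! i \<in> R" using xs nth_mem[OF that] by blast
    show ?thesis
      unfolding carrier_M seq_mult_module_eq[OF t] ball_simps
      using x R_mult
      by (intro ball_cong refl)
        (simp add: M_ops coset_mem_image_iff[OF is_ideal_adjoin_list[OF I t] adjoin_list_superset])
  qed
  moreover have "seq_mult_module ring_on M xs = carrier M \<longleftrightarrow> adjoin_list I xs = R"
  proof -
    have K: "is_ideal (adjoin_list I xs)" by (rule is_ideal_adjoin_list[OF I xs])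
    have "coset I ` adjoin_list I xs = coset I ` R \<longleftrightarrow> adjoin_list I xs = R"
    proof
      assume "coset I ` adjoin_list I xs = coset I ` R"
      then have "r \<in> adjoin_list I xs" if "r \<in> R" for r
        using coset_mem_image_iff[OF K adjoin_list_superset that] that by auto
      then show "adjoin_list I xs = R" using is_idealD(1)[OF K] by blast
    qed simp
    then show ?thesis by (simp add: seq_mult_module_eq[OF xs] carrier_M)
  qed
  ultimately show ?thesis
    unfolding regular_seq_def weakly_regular_iff_nth using xs by auto
qed

lemma carrier_M_trivial_iff: "carrier M = {\<zero>\<^bsub>M\<^esub>} \<longleftrightarrow> I = R"
proof
  assume triv: "carrier M = {\<zero>\<^bsub>M\<^esub>}"
  have "r \<in> I" if r: "r \<in> R" for r
  proof -
    have "coset I r \<in> carrier M" using r unfolding carrier_M by (rule imageI)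
    then have "coset I r = coset I 0" unfolding triv M_ops(1) by (rule singletonD)
    then show ?thesis using coset_eq_iff[OF r R0] by simp
  qed
  then have "R \<subseteq> I" by (rule subsetI)
  moreover have "I \<subseteq> R" using I by (simp add: is_ideal_def)
  ultimately show "I = R" by (rule subset_antisym[rotated])
next
  assume eq: "I = R"
  have "coset I r = coset I 0" if r: "r \<in> R" for r
    using coset_eq_iff[OF r R0] r unfolding eq by simp
  then have "coset I ` R = (\<lambda>r. coset I 0) ` R" by (intro image_cong) auto
  also have "\<dots> = {coset I 0}" using R0 by (intro image_constant)
  finally show "carrier M = {\<zero>\<^bsub>M\<^esub>}" unfolding carrier_M M_ops(1) .
qed

lemma depth_trivial:
  assumes "I = R"
  shows "depth ring_on A M = \<infinity>"
proof -
  have "carrier M = {\<zero>\<^bsub>M\<^esub>}" using carrier_M_trivial_iff assms by blast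
  then show ?thesis by (simp only: depth_def if_True simp_thms)
qed

lemma depth_eq_if_socle:
  assumes "I \<noteq> R" "A \<subseteq> R"
    and xs: "set xs \<subseteq> A" "weakly_regular I xs"
    and f: "f \<in> R" "f \<notin> adjoin_list I xs" "\<And>y. y \<in> A \<Longrightarrow> y * f \<in> adjoin_list I xs"
  shows "depth ring_on A M = enat (length xs)"
proof -
  have xsR: "set xs \<subseteq> R" using assms(2) xs(1) by blast
  have reg: "regular_seq ring_on M xs"
    using regular_seq_iff[OF xsR] xs(2) f by auto
  have le: "length ys \<le> length xs" if "set ys \<subseteq> A" "regular_seq ring_on M ys" for ys
  proof (rule regular_length_le_if_socle[OF I xsR xs(2)])
    show "set ys \<subseteq> R" using that(1) assms(2) by blast
    then show "weakly_regular I ys" using that(2) regular_seq_iff[of ys] by simp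
    show "y * f \<in> adjoin_list I xs" if "y \<in> set ys" for y
      using f(3) that \<open>set ys \<subseteq> A\<close> by blast
  qed (use f in auto)
  have "Sup {enat (length xs) | xs. set xs \<subseteq> A \<and> regular_seq ring_on M xs} = enat (length xs)"
    (is "Sup ?S = _")
  proof (intro antisym)
    have "e \<le> enat (length xs)" if e: "e \<in> ?S" for e
    proof -
      obtain ys where "e = enat (length ys)" "set ys \<subseteq> A" "regular_seq ring_on M ys" using e by blast
      then show ?thesis using le by simp
    qed
    then show "Sup ?S \<le> enat (length xs)" by (rule Sup_least)
    have "enat (length xs) \<in> ?S" using reg xs(1) by blast
    then show "enat (length xs) \<le> Sup ?S" by (rule Sup_upper)
  qed
  moreover have "carrier M \<noteq> {\<zero>\<^bsub>M\<^esub>}" using carrier_M_trivial_iff assms(1) by blast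
  ultimately show ?thesis by (simp only: depth_def if_False)
qed

end

end

section \<open>Dickson's lemma\<close>

text \<open>A monotone subsequence of natural numbers that does not increase attains its minimum and is constant
  from there on.\<close>

lemma nat_seq_mono_subseq:
  fixes s :: "nat \<Rightarrow> nat"
  obtains \<phi> :: "nat \<Rightarrow> nat" where "strict_mono \<phi>" "mono (\<lambda>i. s (\<phi> i))"
proof -
  obtain f :: "nat \<Rightarrow> nat" where f: "strict_mono f" "monoseq (\<lambda>n. s (f n))"
    using seq_monosub[of s] by blast
  show ?thesis
  proof (cases "incseq (\<lambda>n. s (f n))")
    case True
    with f(1) show ?thesis by (rule that)
  next
    case False
    then have dec: "decseq (\<lambda>n. s (f n))" using f(2) by (simp add: monoseq_iff)
    define k where "k = (LEAST k. \<exists>n. s (f n) = k)"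
    have "\<exists>n. s (f n) = k" unfolding k_def by (rule LeastI_ex) blast
    then obtain N where N: "s (f N) = k" by blast
    have "s (f (N + i)) = k" for i
    proof (rule antisym)
      show "s (f (N + i)) \<le> k" using decseqD[OF dec, of N "N + i"] N by simp
      show "k \<le> s (f (N + i))" unfolding k_def by (rule Least_le) blast
    qed
    then show ?thesis
      using f(1) by (intro that[of "\<lambda>i. f (N + i)"]) (auto simp: strict_mono_def mono_def)
  qed
qed

lemma mono_seq_mono_subseq:
  fixes s :: "nat \<Rightarrow> 'x mono"
  assumes "finite A"
  shows "\<exists>\<phi> :: nat \<Rightarrow> nat. strict_mono \<phi> \<and> (\<forall>v\<in>A. mono (\<lambda>i. lookup (s (\<phi> i)) v))"
  using assms
proof (induction A rule: finite_induct)
  case empty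
  then show ?case by (intro exI[of _ id]) (auto simp: strict_mono_def)
next
  case (insert v A)
  then obtain \<phi> :: "nat \<Rightarrow> nat" where \<phi>: "strict_mono \<phi>" "\<forall>v\<in>A. mono (\<lambda>i. lookup (s (\<phi> i)) v)" by blast
  obtain \<psi> :: "nat \<Rightarrow> nat" where \<psi>: "strict_mono \<psi>" "mono (\<lambda>i. lookup (s (\<phi> (\<psi> i))) v)"
    using nat_seq_mono_subseq[of "\<lambda>i. lookup (s (\<phi> i)) v"] by blast
  have "mono (\<lambda>i. lookup (s (\<phi> (\<psi> i))) w)" if "w \<in> A" for w
    using \<phi>(2) that strict_mono_mono[OF \<psi>(1)] unfolding mono_def by blast
  then show ?case
    using \<phi>(1) \<psi> by (intro exI[of _ "\<lambda>i. \<phi> (\<psi> i)"]) (auto simp: strict_mono_def)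
qed

lemma keys_nonempty: "f \<noteq> 0 \<Longrightarrow> keys f \<noteq> {}"
  by (metis empty_iff in_keys_iff lookup_zero poly_mapping_eqI)

lemma var_after_total: "v = w \<or> var_after v w \<or> var_after w v"
  by (cases v; cases w) (auto simp: var_after_def)

text \<open>The basis consists of the minimal elements. A sequence of distinct minimal elements would have
  a subsequence along which no exponent decreases, and two terms of that subsequence would be
  comparable.\<close>

lemma dickson:
  fixes T :: "var mono set"
  assumes "finite A" "\<And>t. t \<in> T \<Longrightarrow> keys t \<subseteq> A"
  obtains B where "finite B" "B \<subseteq> T" "\<And>t. t \<in> T \<Longrightarrow> \<exists>b\<in>B. \<exists>c. t = c + b"
proof -
  define B where "B = {t \<in> T. \<forall>s\<in>T. (\<exists>c. t = c + s) \<longrightarrow> s = t}"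
  have "finite B"
  proof (rule ccontr)
    assume "infinite B"
    then obtain s :: "nat \<Rightarrow> var mono" where s: "inj s" "range s \<subseteq> B"
      using infinite_countable_subset by blast
    obtain \<phi> :: "nat \<Rightarrow> nat" where \<phi>: "strict_mono \<phi>" "\<forall>v\<in>A. mono (\<lambda>i. lookup (s (\<phi> i)) v)"
      using mono_seq_mono_subseq[OF assms(1)] by blast
    let ?a = "s (\<phi> 0)" and ?b = "s (\<phi> 1)"
    have ab: "?a \<in> B" "?b \<in> B" using s(2) by auto
    then have kA: "keys ?a \<subseteq> A" "keys ?b \<subseteq> A" using assms(2) by (auto simp: B_def)
    have le: "lookup ?a v \<le> lookup ?b v" for v
    proof (cases "v \<in> A")
      case True
      then show ?thesis using \<phi>(2) unfolding mono_def by (meson zero_le_one)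
    next
      case False
      then have "lookup ?a v = 0" using kA(1) by (meson in_keys_iff subset_iff)
      then show ?thesis by simp
    qed
    have "?b = (?b - ?a) + ?a"
      by (rule poly_mapping_eqI) (use le in \<open>simp add: lookup_add lookup_minus\<close>)
    then have "?a = ?b" using ab by (auto simp: B_def)
    then have "\<phi> 0 = \<phi> 1" using s(1) by (simp add: inj_eq)
    then show False using \<phi>(1) by (metis strict_mono_eq zero_neq_one)
  qed
  moreover have "\<exists>b\<in>B. \<exists>c. t = c + b" if "t \<in> T" for t
    using that
  proof (induction "wdeg (\<lambda>_. 1) t" arbitrary: t rule: less_induct)
    case less
    show ?case
    proof (cases "t \<in> B")
      case True
      then show ?thesis by (intro bexI[of _ t] exI[of _ 0]) auto
    next
      case False
      then obtain s c where s: "s \<in> T" "t = c + s" "s \<noteq> t" using less.prems by (auto simp: B_def)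
      have "c \<noteq> 0" using s by auto
      then obtain v where v: "v \<in> keys c" using keys_nonempty by blast
      have "0 < wdeg (\<lambda>_. 1) c"
        unfolding wdeg_def using v by (intro sum_pos2[of _ v]) (auto simp: in_keys_iff)
      then have "wdeg (\<lambda>_. 1) s < wdeg (\<lambda>_. 1) t" using s(2) by (simp add: wdeg_add)
      then obtain b c' where "b \<in> B" "s = c' + b" using less.hyps s(1) by blast
      then show ?thesis using s(2) by (intro bexI[of _ b] exI[of _ "c + c'"]) (auto simp: add.assoc)
    qed
  qed
  ultimately show ?thesis using that[of B] by (auto simp: B_def)
qed

section \<open>Ideals with strongly stable leading monomials\<close>

context weighted_ring
begin

text \<open>The last variables of the list, from some position on.\<close>

definition final :: "var set \<Rightarrow> bool" where
  "final Z \<longleftrightarrow> Z \<subseteq> V \<and> (\<forall>z\<in>Z. \<forall>v\<in>V. var_after v z \<longrightarrow> v \<in> Z)"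

definition meeting :: "var set \<Rightarrow> var mono set" where
  "meeting Z = {m \<in> Mon. keys m \<inter> Z \<noteq> {}}"

text \<open>The ideal generated by \<open>I\<close> and the variables in \<open>Z\<close>. Splitting off the terms that involve
  \<open>Z\<close> makes its leading monomials accessible.\<close>

definition adjoin_vars :: "(var, 'k) mpoly set \<Rightarrow> var set \<Rightarrow> (var, 'k) mpoly set" where
  "adjoin_vars I Z = {a + b | a b. a \<in> I \<and> b \<in> monomial_ideal (meeting Z)}"

definition up_closed :: "var mono set \<Rightarrow> bool" where
  "up_closed T \<longleftrightarrow> T \<subseteq> Mon \<and> (\<forall>s\<in>T. \<forall>t\<in>Mon. t + s \<in> T)"

text \<open>The analogue for weighted variables of strongly stable monomial ideals: it expresses invariance
  under the shears that add to a variable a monomial of its degree in earlier variables.\<close>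

definition strongly_stable :: "var mono set \<Rightarrow> bool" where
  "strongly_stable T \<longleftrightarrow> (\<forall>w\<in>T. \<forall>v\<in>keys w. \<forall>m\<in>Mon.
     wdeg q m = q (fst v) \<and> (\<forall>u\<in>keys m. var_after v u) \<longrightarrow> w - single v 1 + m \<in> T)"

lemma up_closed_meeting: "up_closed (meeting Z)"
  by (auto simp: up_closed_def meeting_def keys_add_mono Mon_add)

lemma up_closed_Un: "up_closed S \<Longrightarrow> up_closed T \<Longrightarrow> up_closed (S \<union> T)"
  by (auto simp: up_closed_def)

lemma up_closed_leads: "is_ideal I \<Longrightarrow> up_closed (leads I)"
  using leads_Mon leads_up by (auto simp: up_closed_def)

lemma graded_monomial_ideal: "up_closed T \<Longrightarrow> graded_ideal (monomial_ideal T)"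
  by (intro graded_ideal_monomial_ideal) (auto simp: up_closed_def)

lemma graded_ideal_adjoin_vars:
  assumes I: "graded_ideal I"
  shows "graded_ideal (adjoin_vars I Z)"
proof -
  have J: "graded_ideal (monomial_ideal (meeting Z))"
    by (rule graded_monomial_ideal[OF up_closed_meeting])
  note i = graded_idealD(1)[OF I] and j = graded_idealD(1)[OF J]
  have mem: "a + b \<in> adjoin_vars I Z" if "a \<in> I" "b \<in> monomial_ideal (meeting Z)" for a b
    using that by (auto simp: adjoin_vars_def)
  show ?thesis
    unfolding graded_ideal_def is_ideal_def
  proof (intro conjI ballI allI subsetI)
    show "0 \<in> adjoin_vars I Z" using mem[OF is_idealD(2)[OF i] is_idealD(2)[OF j]] by simp
    fix f assume "f \<in> adjoin_vars I Z"
    then obtain a b where f: "f = a + b" "a \<in> I" "b \<in> monomial_ideal (meeting Z)"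
      by (auto simp: adjoin_vars_def)
    show "f \<in> R" unfolding f(1) using is_idealD(1)[OF i f(2)] is_idealD(1)[OF j f(3)] by (rule R_add)
    show "r * f \<in> adjoin_vars I Z" if "r \<in> R" for r
      using mem[OF is_idealD(4)[OF i that f(2)] is_idealD(4)[OF j that f(3)]]
      by (simp add: f(1) algebra_simps)
    show "hom_component q d f \<in> adjoin_vars I Z" for d
      using mem[OF graded_idealD(2)[OF I f(2)] graded_idealD(2)[OF J f(3)]]
      by (simp add: f(1) hom_component_add)
    fix g assume "g \<in> adjoin_vars I Z"
    then obtain a' b' where g: "g = a' + b'" "a' \<in> I" "b' \<in> monomial_ideal (meeting Z)"
      by (auto simp: adjoin_vars_def)
    show "f + g \<in> adjoin_vars I Z"
      using mem[OF is_idealD(3)[OF i f(2) g(2)] is_idealD(3)[OF j f(3) g(3)]]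
      by (simp add: f(1) g(1) algebra_simps)
  qed
qed

lemma adjoin_vars_superset:
  assumes "is_ideal I"
  shows "I \<subseteq> adjoin_vars I Z" "monomial_ideal (meeting Z) \<subseteq> adjoin_vars I Z"
proof
  show "f \<in> adjoin_vars I Z" if "f \<in> I" for f
    unfolding adjoin_vars_def mem_Collect_eq using that
    by (intro exI[of _ f] exI[of _ 0]) (auto simp: monomial_ideal_def)
  show "monomial_ideal (meeting Z) \<subseteq> adjoin_vars I Z"
  proof
    show "f \<in> adjoin_vars I Z" if "f \<in> monomial_ideal (meeting Z)" for f
      unfolding adjoin_vars_def mem_Collect_eq using that is_idealD(2)[OF assms]
      by (intro exI[of _ 0] exI[of _ f]) auto
  qed
qed

lemma adjoin_vars_empty: "adjoin_vars I {} = I"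
  by (auto simp: adjoin_vars_def meeting_def monomial_ideal_def)

lemma single_mem_adjoin_vars:
  "is_ideal I \<Longrightarrow> m \<in> meeting Z \<Longrightarrow> single m c \<in> adjoin_vars I Z"
proof -
  assume "is_ideal I" "m \<in> meeting Z"
  then have "single m c \<in> monomial_ideal (meeting Z)" by (simp add: monomial_ideal_def)
  with adjoin_vars_superset(2)[OF \<open>is_ideal I\<close>] show ?thesis by blast
qed

lemma indet_mult_single: "indet x * single m c = single (single x 1 + m) c"
  by (simp add: indet_def monomial_def mult_single)

lemma single_split: "x \<in> keys m \<Longrightarrow> single m c = indet x * single (m - single x 1) c"
  using mono_diff_single[of x m] by (simp add: indet_mult_single add.commute)

lemma diff_in_Mon: "m \<in> Mon \<Longrightarrow> m - s \<in> Mon"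
  by (auto simp: Mon_def in_keys_iff lookup_minus)

lemma adjoin_adjoin_vars:
  assumes I: "graded_ideal I" and x: "x \<in> V"
  shows "adjoin (adjoin_vars I Z) (indet x) = adjoin_vars I (insert x Z)"
proof
  note i = graded_idealD(1)[OF I]
  note K = graded_idealD(1)[OF graded_ideal_adjoin_vars[OF I]]
  show "adjoin (adjoin_vars I Z) (indet x) \<subseteq> adjoin_vars I (insert x Z)"
  proof (rule adjoin_minimal[OF K])
    have "monomial_ideal (meeting Z) \<subseteq> monomial_ideal (meeting (insert x Z))"
      by (auto simp: monomial_ideal_def meeting_def)
    then show "adjoin_vars I Z \<subseteq> adjoin_vars I (insert x Z)" unfolding adjoin_vars_def by blast
    show "indet x \<in> adjoin_vars I (insert x Z)"
      unfolding indet_def monomial_def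
      by (rule single_mem_adjoin_vars[OF i]) (simp add: meeting_def Mon_single x)
  qed
  show "adjoin_vars I (insert x Z) \<subseteq> adjoin (adjoin_vars I Z) (indet x)" (is "_ \<subseteq> ?A")
  proof
    have A: "is_ideal ?A" by (rule is_ideal_adjoin[OF K indet_in_R[OF x]])
    fix f assume "f \<in> adjoin_vars I (insert x Z)"
    then obtain a b where f: "f = a + b" "a \<in> I" "keys b \<subseteq> meeting (insert x Z)"
      by (auto simp: adjoin_vars_def monomial_ideal_def)
    have "single m (lookup b m) \<in> ?A" if m: "m \<in> keys b" for m
    proof (cases "m \<in> meeting Z")
      case True
      then show ?thesis using single_mem_adjoin_vars[OF i] adjoin_superset by blast
    next
      case False
      then have x': "x \<in> keys m" "m \<in> Mon" using f(3) m by (auto simp: meeting_def)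
      show ?thesis
        unfolding single_split[OF x'(1)]
        by (intro adjoin_mem[OF K] single_in_R diff_in_Mon x')
    qed
    then have "b \<in> ?A" by (subst poly_mapping_sum_single) (intro ideal_sum[OF A])
    moreover have "a \<in> ?A" using adjoin_vars_superset(1)[OF i] f(2) adjoin_superset by blast
    ultimately show "f \<in> ?A" unfolding f(1) using is_idealD(3)[OF A] by blast
  qed
qed

text \<open>This is the property of the degree reverse lexicographic order on which the depth argument rests.
  The last variable in which the exponents of \<open>s\<close> and \<open>t\<close> differ lies in \<open>Z\<close>, and there \<open>t\<close> has the
  larger exponent.\<close>

lemma drl_avoiding_greater_meeting:
  assumes Z: "final Z" and st: "s \<in> Mon" "wdeg q s = wdeg q t"
    and meet: "keys s \<inter> Z = {}" "keys t \<inter> Z \<noteq> {}"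
  shows "s \<succ> t"
proof (rule ccontr)
  assume "\<not> s \<succ> t"
  moreover have "s \<noteq> t" using meet by auto
  ultimately have "t \<succ> s" using drl_greater_total by blast
  then obtain v where v: "lookup t v < lookup s v" "\<And>w. var_after w v \<Longrightarrow> lookup t w = lookup s w"
    using st(2) by (auto simp: drl_greater_def)
  have "v \<in> keys s" using v(1) by (auto simp: in_keys_iff)
  then have vV: "v \<in> V" "v \<notin> Z" using st(1) meet(1) by (auto simp: Mon_def)
  obtain z where z: "z \<in> keys t" "z \<in> Z" using meet(2) by auto
  have "lookup s z = 0" "lookup t z \<noteq> 0" using z meet(1) by (auto simp: in_keys_iff)
  then have "\<not> var_after z v" using v(2)[of z] by auto
  moreover have "z \<noteq> v" using z vV by auto
  ultimately have "var_after v z" by (auto simp: var_after_def prod_eq_iff)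
  then show False using Z z(2) vV by (auto simp: final_def)
qed

lemma leads_mono: "I \<subseteq> J \<Longrightarrow> leads I \<subseteq> leads J"
  by (auto simp: leads_def)

text \<open>An element of the sum whose leading monomial avoids \<open>Z\<close> has the same leading monomial as its
  component in \<open>I\<close>, since the terms that involve \<open>Z\<close> are smaller.\<close>

lemma leads_adjoin_vars:
  assumes I: "graded_ideal I" and Z: "final Z"
  shows "leads (adjoin_vars I Z) = leads I \<union> meeting Z"
proof
  note i = graded_idealD(1)[OF I]
  show "leads I \<union> meeting Z \<subseteq> leads (adjoin_vars I Z)"
    using leads_mono[OF adjoin_vars_superset(1)[OF i]] leads_mono[OF adjoin_vars_superset(2)[OF i]]
    by (simp add: leads_monomial_ideal)
  show "leads (adjoin_vars I Z) \<subseteq> leads I \<union> meeting Z"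
  proof
    fix m assume m: "m \<in> leads (adjoin_vars I Z)"
    note K = graded_ideal_adjoin_vars[OF I, of Z]
    have mM: "m \<in> Mon" using leads_Mon[OF graded_idealD(1)[OF K]] m by blast
    obtain f where f: "f \<in> adjoin_vars I Z" "homogeneous q (wdeg q m) f" "lookup f m = 1"
      "\<And>t. t \<in> keys f \<Longrightarrow> t \<noteq> m \<Longrightarrow> m \<succ> t"
      using leads_representative[OF K m] by blast
    obtain a b where ab: "f = a + b" "a \<in> I" "keys b \<subseteq> meeting Z"
      using f(1) by (auto simp: adjoin_vars_def monomial_ideal_def)
    show "m \<in> leads I \<union> meeting Z"
    proof (rule ccontr)
      assume n: "m \<notin> leads I \<union> meeting Z"
      define h where "h = hom_component q (wdeg q m) a"
      have hI: "h \<in> I" unfolding h_def by (rule graded_idealD(2)[OF I ab(2)])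
      have mb: "lookup b m = 0" using n ab(3) by (auto simp: in_keys_iff)
      then have hm: "lookup h m = 1" using f(3) ab(1) by (simp add: h_def lookup_hom_component lookup_add)
      have "lead h = m"
      proof (rule lead_mono_eqI)
        show "m \<in> keys h" using hm by (simp add: in_keys_iff)
        fix t assume t: "t \<in> keys h" "t \<noteq> m"
        have dt: "wdeg q t = wdeg q m" using t(1) by (auto simp: h_def keys_hom_component)
        show "m \<succ> t"
        proof (cases "t \<in> keys f")
          case False
          have "t \<in> keys a" using t(1) by (auto simp: h_def keys_hom_component)
          then have "t \<in> keys b" using False by (auto simp: in_keys_iff ab(1) lookup_add)
          then have "keys t \<inter> Z \<noteq> {}" using ab(3) by (auto simp: meeting_def)
          moreover have "keys m \<inter> Z = {}" using n mM by (auto simp: meeting_def)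
          ultimately show ?thesis using drl_avoiding_greater_meeting[OF Z mM] dt by metis
        qed (use f(4) t(2) in blast)
      qed
      moreover have "h \<noteq> 0" using hm by auto
      ultimately show False using lead_in_leads[OF hI] n by auto
    qed
  qed
qed

lemma leads_indet_mult:
  assumes "indet x * f \<in> K" "f \<noteq> 0"
  shows "single x 1 + lead f \<in> leads K"
proof -
  have "indet x * f \<noteq> 0" using assms(2) by (simp add: indet_def monomial_mult_eq_0_iff)
  then have "lead (indet x * f) \<in> leads K" using assms(1) by (rule lead_in_leads[rotated])
  then show ?thesis using lead_mono_monomial_mult[OF assms(2)] by (simp add: indet_def)
qed

text \<open>A zero divisor would annihilate a nonzero element that is reduced modulo \<open>K\<close>, and then the
  leading monomial of that element would contradict the assumption.\<close>

lemma nonzerodivisor_if_leads: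
  assumes K: "graded_ideal K" and x: "x \<in> V"
    and nzd: "\<And>u. u \<in> Mon \<Longrightarrow> single x 1 + u \<in> leads K \<Longrightarrow> u \<in> leads K"
    and f: "f \<in> R" "indet x * f \<in> K"
  shows "f \<in> K"
proof -
  note k = graded_idealD(1)[OF K]
  obtain g where g: "g \<in> R" "f - g \<in> K" "keys g \<inter> leads K = {}" using reduce[OF K f(1)] by blast
  have "indet x * g = indet x * f - indet x * (f - g)" by (simp add: algebra_simps)
  then have xg: "indet x * g \<in> K"
    using is_idealD(6)[OF k f(2) is_idealD(4)[OF k indet_in_R[OF x] g(2)]] by simp
  have "g = 0"
  proof (rule ccontr)
    assume "g \<noteq> 0"
    then have lg: "lead g \<in> keys g" by (rule lead_mono(1))
    then have "lead g \<in> Mon" using g(1) by (auto simp: in_R_Mon)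
    then have "lead g \<in> leads K" using nzd leads_indet_mult[OF xg \<open>g \<noteq> 0\<close>] by blast
    then show False using g(3) lg by blast
  qed
  then show ?thesis using g(2) by simp
qed

lemma hom_component_monomial_mult:
  "hom_component q (wdeg q s + d) (monomial s * f) = monomial s * hom_component q d f"
proof (rule poly_mapping_eqI)
  fix c
  show "lookup (hom_component q (wdeg q s + d) (monomial s * f)) c =
      lookup (monomial s * hom_component q d f) c"
  proof (cases "c \<in> range ((+) s)")
    case True
    then show ?thesis by (auto simp: lookup_hom_component lookup_monomial_mult wdeg_add)
  next
    case False
    then have "c \<notin> keys (monomial s * f)" "c \<notin> keys (monomial s * hom_component q d f)"
      by (auto simp: keys_monomial_mult)
    then show ?thesis by (simp add: lookup_hom_component in_keys_iff)
  qed
qed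

text \<open>The monomials \<open>m\<close> with \<open>x m\<close> in the set have a finite basis. Let \<open>m = c b\<close> with \<open>b\<close> in the
  basis. If \<open>c\<close> were divisible by the power $y^a$ of an earlier variable that has the degree of \<open>x\<close>,
  then stability, applied to \<open>x b\<close>, would put $y^a b$ and hence \<open>m\<close> into the set. So all exponents
  of \<open>c\<close> are bounded. Such a power $y^a$ exists for every earlier \<open>y\<close> because its weight divides
  that of \<open>x\<close>.\<close>

lemma colon_degree_bounded:
  assumes dvd: "\<And>v. v \<in> V \<Longrightarrow> fst v \<le> fst x \<Longrightarrow> q (fst v) dvd q (fst x)"
    and T: "up_closed T" "strongly_stable T"
    and Z: "Z \<subseteq> V" and x: "x \<in> V" "x \<notin> Z" "\<And>v. v \<in> V \<Longrightarrow> var_after v x \<Longrightarrow> v \<in> Z"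
  obtains D where "\<And>m. m \<in> Mon \<Longrightarrow> single x 1 + m \<in> T \<union> meeting Z \<Longrightarrow> m \<notin> T \<union> meeting Z \<Longrightarrow> wdeg q m \<le> D"
proof -
  let ?T = "T \<union> meeting Z"
  have up: "up_closed ?T" by (intro up_closed_Un T up_closed_meeting)
  define S where "S = {m \<in> Mon. single x 1 + m \<in> ?T}"
  have "keys t \<subseteq> V" if "t \<in> S" for t using that by (simp add: S_def Mon_def)
  from dickson[OF finite_V this, of S]
  obtain B where B: "finite B" "B \<subseteq> S" "\<And>t. t \<in> S \<Longrightarrow> \<exists>b\<in>B. \<exists>c. t = c + b"
    by blast
  define D where "D = Max (insert 0 (wdeg q ` B)) + (\<Sum>v\<in>V. q (fst v) * q (fst x))"
  have "wdeg q m \<le> D" if m: "m \<in> S" "m \<notin> ?T" for m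
  proof -
    obtain b c where bc: "b \<in> B" "m = c + b" using B(3) m(1) by blast
    have bS: "b \<in> Mon" "single x 1 + b \<in> ?T" using bc(1) B(2) by (auto simp: S_def)
    have cM: "c \<in> Mon" using m(1) bc(2) by (auto simp: S_def Mon_add)
    have avoid: "keys m \<inter> Z = {}" using m by (auto simp: S_def meeting_def)
    have upT: "t + s \<in> ?T" if "s \<in> ?T" "t \<in> Mon" for s t
      using up that by (auto simp: up_closed_def)
    have sub: "c - single v k + single v k = c" if "k \<le> lookup c v" for v k
      by (rule poly_mapping_eqI) (use that in \<open>auto simp: lookup_add lookup_minus lookup_single when_def\<close>)
    have "lookup c v \<le> q (fst x)" if v: "v \<in> V" for v
    proof -
      consider "v \<in> Z" | "v = x" | "v \<notin> Z" "var_after x v"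
        using x(3)[OF v] var_after_total[of v x] by blast
      then show ?thesis
      proof cases
        case 1
        then have "v \<notin> keys c" using avoid bc(2) by (auto simp: keys_add_mono)
        then show ?thesis by (simp add: in_keys_iff)
      next
        case 2
        have "lookup c x = 0"
        proof (rule ccontr)
          assume "lookup c x \<noteq> 0"
          then have "c - single x 1 + single x 1 = c" by (intro sub) simp
          then have "m = (c - single x 1) + (single x 1 + b)" by (simp add: bc(2) flip: add.assoc)
          then show False using upT[OF bS(2) diff_in_Mon[OF cM]] m(2) by simp
        qed
        then show ?thesis using 2 by simp
      next
        case 3
        define a where "a = q (fst x) div q (fst v)"
        have qa: "q (fst v) * a = q (fst x)"
          unfolding a_def using dvd[OF v] 3(2) by (auto simp: var_after_def)
        have ax: "a \<le> q (fst x)" unfolding a_def by simp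
        have "lookup c v < a"
        proof (rule ccontr)
          assume "\<not> lookup c v < a"
          then have c: "c - single v a + single v a = c" by (intro sub) simp
          have "single x 1 + b \<notin> meeting Z"
            using x(2) avoid bc(2) by (auto simp: meeting_def keys_add_mono)
          then have "single x 1 + b \<in> T" using bS(2) by blast
          moreover have "x \<in> keys (single x 1 + b)" by (simp add: keys_add_mono)
          moreover have "single v a \<in> Mon" "wdeg q (single v a) = q (fst x)" "\<forall>u\<in>keys (single v a). var_after x u"
            using v qa 3(2) by (auto simp: Mon_single split: if_splits)
          ultimately have "(single x 1 + b) - single x 1 + single v a \<in> T"
            using T(2) unfolding strongly_stable_def by blast
          then have "b + single v a \<in> T" by simp
          moreover have "m = (c - single v a) + (b + single v a)"
            unfolding bc(2) using c by (metis add.assoc add.commute)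
          ultimately show False using upT[OF _ diff_in_Mon[OF cM]] m(2) by simp
        qed
        then show ?thesis using ax by simp
      qed
    qed
    then have "wdeg q c \<le> (\<Sum>v\<in>V. q (fst v) * q (fst x))"
      using cM wdeg_superset[OF finite_V, of c q] by (auto simp: Mon_def intro!: sum_mono)
    moreover have "wdeg q b \<le> Max (insert 0 (wdeg q ` B))" using bc(1) B(1) by (intro Max_ge) auto
    ultimately show ?thesis by (simp add: bc(2) wdeg_add D_def)
  qed
  then show ?thesis using that[of D] by (simp add: S_def)
qed


definition colon :: "(var, 'k) mpoly set \<Rightarrow> var \<Rightarrow> (var, 'k) mpoly set" where
  "colon K x = {f \<in> R. indet x * f \<in> K}"

lemma graded_ideal_colon:
  assumes K: "graded_ideal K" and x: "x \<in> V"
  shows "graded_ideal (colon K x)"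
proof -
  note k = graded_idealD(1)[OF K]
  show ?thesis
    unfolding graded_ideal_def is_ideal_def
  proof (intro conjI ballI allI)
    show "colon K x \<subseteq> R" by (auto simp: colon_def)
    show "0 \<in> colon K x" using R0 is_idealD(2)[OF k] by (simp add: colon_def)
    fix f assume f: "f \<in> colon K x"
    then have fR: "f \<in> R" and xf: "indet x * f \<in> K" by (simp_all add: colon_def)
    show "r * f \<in> colon K x" if "r \<in> R" for r
      using R_mult[OF that fR] is_idealD(4)[OF k that xf] by (simp add: colon_def mult.left_commute)
    show "hom_component q d f \<in> colon K x" for d
      using hom_component_in_R[OF fR] graded_idealD(2)[OF K xf]
        hom_component_monomial_mult[of "single x 1" d f]
      by (simp add: colon_def indet_def) metis
    fix g assume g: "g \<in> colon K x"
    then show "f + g \<in> colon K x"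
      using R_add[OF fR] is_idealD(3)[OF k xf] by (simp add: colon_def distrib_left)
  qed
qed

lemma colon_superset:
  assumes "is_ideal K" "x \<in> V"
  shows "K \<subseteq> colon K x"
  using is_idealD(1)[OF assms(1)] is_idealD(4)[OF assms(1) indet_in_R[OF assms(2)]]
  by (auto simp: colon_def)

lemma homogeneous_indet_mult: "homogeneous q d f \<Longrightarrow> homogeneous q (q (fst v) + d) (indet v * f)"
  by (rule homogeneous_mult) (auto simp: indet_def monomial_def intro!: homogeneous_single)

text \<open>Here the order is used once more: if the leading monomial of a homogeneous element without the
  last variables is divisible by \<open>x\<close>, so are all its terms, being smaller. Dividing by \<open>x\<close> lifts the
  monomial \<open>u\<close> to an element of the colon ideal.\<close>

lemma colon_proper:
  assumes I: "graded_ideal I" and Z: "final Z"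
    and x: "x \<in> V" "x \<notin> Z" "final (insert x Z)"
    and u: "u \<in> Mon" "u \<notin> leads I \<union> meeting Z" "single x 1 + u \<in> leads I \<union> meeting Z"
  shows "\<exists>f\<in>colon (adjoin_vars I Z) x. f \<notin> adjoin_vars I Z"
proof -
  define K where "K = adjoin_vars I Z"
  have K: "graded_ideal K" unfolding K_def by (rule graded_ideal_adjoin_vars[OF I])
  note k = graded_idealD(1)[OF K]
  have lK: "leads K = leads I \<union> meeting Z" unfolding K_def by (rule leads_adjoin_vars[OF I Z])
  define w where "w = single x 1 + u"
  have w: "w \<in> leads K" "w \<in> Mon" using u x(1) by (auto simp: w_def lK Mon_add Mon_single)
  have wZ: "keys w \<inter> Z = {}" using u(1,2) x(2) by (auto simp: w_def meeting_def keys_add_mono)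
  obtain h where h: "h \<in> K" "homogeneous q (wdeg q w) h" "lookup h w = 1"
    "\<And>t. t \<in> keys h \<Longrightarrow> t \<noteq> w \<Longrightarrow> w \<succ> t"
    using leads_representative[OF K w(1)] by blast
  have hR: "h \<in> R" by (rule is_idealD(1)[OF k h(1)])
  \<comment> \<open>The terms of \<open>h\<close> that avoid the last variables are all divisible by \<open>x\<close>.\<close>
  define A where "A = {t \<in> keys h. keys t \<inter> Z = {}}"
  have finA: "finite A" by (simp add: A_def)
  have AM: "t \<in> Mon" "x \<in> keys t" if t: "t \<in> A" for t
  proof -
    show tM: "t \<in> Mon" using t hR by (auto simp: A_def in_R_Mon)
    show "x \<in> keys t"
    proof (cases "t = w")
      case True
      then show ?thesis by (simp add: w_def keys_add_mono)
    next
      case False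
      have wt: "w \<succ> t" "wdeg q t = wdeg q w" using t h(2,4) False by (auto simp: A_def homogeneous_def)
      show ?thesis
      proof (rule ccontr)
        assume "x \<notin> keys t"
        then have "keys t \<inter> insert x Z = {}" using t by (auto simp: A_def)
        moreover have "keys w \<inter> insert x Z \<noteq> {}" by (simp add: w_def keys_add_mono)
        ultimately have "t \<succ> w" using drl_avoiding_greater_meeting[OF x(3) tM wt(2)] by blast
        then show False using wt(1) drl_greater_asym by blast
      qed
    qed
  qed
  define f where "f = (\<Sum>t\<in>A. single (t - single x 1) (lookup h t))"
  define h' where "h' = indet x * f"
  have h'_sum: "h' = (\<Sum>t\<in>A. single t (lookup h t))"
    unfolding h'_def f_def sum_distrib_left
    by (intro sum.cong refl single_split[OF AM(2), symmetric])
  have lh': "lookup h' t = (if t \<in> A then lookup h t else 0)" for t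
  proof -
    have "lookup h' t = (\<Sum>s\<in>A. if s = t then lookup h s else 0)"
      unfolding h'_sum lookup_sum by (rule sum.cong) (auto simp: lookup_single when_def)
    then show ?thesis using finA by (auto simp: sum.delta)
  qed
  have wA: "w \<in> A" using h(3) wZ by (auto simp: A_def in_keys_iff)
  have lead_h': "lead h' = w"
  proof (rule lead_mono_eqI)
    show "w \<in> keys h'" using wA h(3) by (simp add: in_keys_iff lh')
    fix t assume "t \<in> keys h'" "t \<noteq> w"
    then show "w \<succ> t" using h(4)[of t] by (auto simp: in_keys_iff lh' split: if_splits)
  qed
  have fR: "f \<in> R" unfolding f_def by (intro sum_in_R single_in_R diff_in_Mon AM(1))
  have "h - h' \<in> monomial_ideal (meeting Z)"
  proof -
    have "t \<in> meeting Z" if t: "t \<in> keys (h - h')" for t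
    proof -
      have "t \<notin> A" using t by (auto simp: in_keys_iff lookup_minus lh' split: if_splits)
      then have "t \<in> keys h" using t by (auto simp: in_keys_iff lookup_minus lh')
      then show ?thesis using hR \<open>t \<notin> A\<close> by (auto simp: A_def meeting_def in_R_Mon)
    qed
    then show ?thesis by (auto simp: monomial_ideal_def)
  qed
  then have "h - h' \<in> K" using adjoin_vars_superset(2)[OF graded_idealD(1)[OF I]] by (auto simp: K_def)
  then have "h - (h - h') \<in> K" using is_idealD(6)[OF k h(1)] by blast
  then have fQ: "f \<in> colon K x" using fR by (simp add: colon_def h'_def)
  have f0: "f \<noteq> 0"
  proof
    assume "f = 0"
    then have "lookup h' w = 0" by (simp add: h'_def)
    then show False using wA h(3) by (simp add: lh')
  qed
  have "single x 1 + lead f = single x 1 + u"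
    using lead_mono_monomial_mult[OF f0, of q "single x 1"] lead_h' by (simp add: h'_def w_def indet_def)
  then have "lead f = u" by simp
  then have "f \<notin> K" using lead_in_leads[of f K] f0 u(2) lK by auto
  then show ?thesis using fQ unfolding K_def by blast
qed

text \<open>The colon ideal and \<open>adjoin_vars I Z\<close> agree in all degrees above a bound, since their leading
  monomials do. A homogeneous element of highest degree in the difference is annihilated by every
  variable, because multiplication raises the degree.\<close>

lemma socle_if_zero_divisor:
  assumes dvd: "\<And>v. v \<in> V \<Longrightarrow> fst v \<le> fst x \<Longrightarrow> q (fst v) dvd q (fst x)"
    and I: "graded_ideal I" and stable: "strongly_stable (leads I)" and Z: "final Z"
    and x: "x \<in> V" "x \<notin> Z" "final (insert x Z)" "\<And>v. v \<in> V \<Longrightarrow> var_after v x \<Longrightarrow> v \<in> Z"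
    and u: "u \<in> Mon" "u \<notin> leads I \<union> meeting Z" "single x 1 + u \<in> leads I \<union> meeting Z"
  shows "\<exists>f\<in>R. f \<notin> adjoin_vars I Z \<and> (\<forall>v\<in>V. indet v * f \<in> adjoin_vars I Z)"
proof -
  define K where "K = adjoin_vars I Z"
  have K: "graded_ideal K" unfolding K_def by (rule graded_ideal_adjoin_vars[OF I])
  note k = graded_idealD(1)[OF K]
  have lK: "leads K = leads I \<union> meeting Z" unfolding K_def by (rule leads_adjoin_vars[OF I Z])
  have Q: "graded_ideal (colon K x)" by (rule graded_ideal_colon[OF K x(1)])
  note qq = graded_idealD(1)[OF Q]
  have ZV: "Z \<subseteq> V" using Z by (simp add: final_def)
  obtain D where D: "\<And>m. m \<in> Mon \<Longrightarrow> single x 1 + m \<in> leads K \<Longrightarrow> m \<notin> leads K \<Longrightarrow> wdeg q m \<le> D"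
    using colon_degree_bounded[OF dvd up_closed_leads[OF graded_idealD(1)[OF I]] stable ZV x(1,2,4)]
    unfolding lK by blast
  have bounded: "d \<le> D" if f: "f \<in> colon K x" "f \<notin> K" "homogeneous q d f" for f d
  proof -
    have fR: "f \<in> R" using f(1) by (simp add: colon_def)
    obtain g where g: "g \<in> R" "homogeneous q d g" "f - g \<in> K" "keys g \<inter> leads K = {}"
      using reduce_homogeneous[OF K fR f(3)] by blast
    have "f - g \<in> colon K x" using g(3) colon_superset[OF k x(1)] by blast
    then have "f - (f - g) \<in> colon K x" by (rule is_idealD(6)[OF qq f(1)])
    then have xg: "indet x * g \<in> K" by (simp add: colon_def)
    have "g \<noteq> 0" using f(2) g(3) by auto
    then have lg: "lead g \<in> keys g" by (rule lead_mono(1))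
    have "wdeg q (lead g) \<le> D"
    proof (rule D)
      show "lead g \<in> Mon" using lg g(1) by (auto simp: in_R_Mon)
      show "single x 1 + lead g \<in> leads K" by (rule leads_indet_mult[OF xg \<open>g \<noteq> 0\<close>])
      show "lead g \<notin> leads K" using lg g(4) by blast
    qed
    then show ?thesis using lg g(2) by (auto simp: homogeneous_def)
  qed
  define S where "S = {d. \<exists>f\<in>colon K x. f \<notin> K \<and> homogeneous q d f}"
  have S_I: "d \<in> S" if "f \<in> colon K x" "f \<notin> K" "homogeneous q d f" for f d
    using that by (auto simp: S_def)
  have "S \<subseteq> {..D}" using bounded by (auto simp: S_def)
  then have finS: "finite S" by (rule finite_subset) simp
  have "S \<noteq> {}"
  proof
    assume "S = {}"
    obtain f where f: "f \<in> colon K x" "f \<notin> K"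
      using colon_proper[OF I Z x(1,2,3) u] unfolding K_def by blast
    have "hom_component q d f \<in> K" for d
      using \<open>S = {}\<close> graded_idealD(2)[OF Q f(1), of d] homogeneous_hom_component
      unfolding S_def by blast
    then have "(\<Sum>d\<in>wdeg q ` keys f. hom_component q d f) \<in> K" by (intro ideal_sum[OF k])
    then show False using f(2) sum_hom_components[of f q] by simp
  qed
  then have "Max S \<in> S" using finS by (intro Max_in)
  then obtain f where f: "f \<in> colon K x" "f \<notin> K" "homogeneous q (Max S) f" unfolding S_def by blast
  have "indet v * f \<in> K" if v: "v \<in> V" for v
  proof (rule ccontr)
    assume n: "indet v * f \<notin> K"
    have "indet v * f \<in> colon K x" by (rule is_idealD(4)[OF qq indet_in_R[OF v] f(1)])
    then have "q (fst v) + Max S \<in> S"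
      using n homogeneous_indet_mult[OF f(3)] by (rule S_I)
    then have "q (fst v) + Max S \<le> Max S" using finS by (intro Max_ge)
    then show False using q_pos_V[OF v] by simp
  qed
  moreover have "f \<in> R" using f(1) by (simp add: colon_def)
  ultimately show ?thesis using f(2) unfolding K_def by blast
qed

text \<open>The variables are adjoined from the last one backwards until one of them is a zero divisor or none
  is left. Which case occurs at each stage depends on \<open>T\<close> only; this is why \<open>xs\<close> is chosen before \<open>I\<close>.\<close>

lemma stable_regular_socle_vars:
  assumes dvd: "\<And>v w. v \<in> V \<Longrightarrow> w \<in> V \<Longrightarrow> fst v \<le> fst w \<Longrightarrow> q (fst v) dvd q (fst w)"
    and T: "strongly_stable T" "0 \<notin> T" and Z: "final Z"
  shows "\<exists>xs. set xs \<subseteq> V \<and> (\<forall>I. graded_ideal I \<and> leads I = T \<longrightarrow>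
      weakly_regular (adjoin_vars I Z) (map indet xs) \<and>
      (\<exists>f\<in>R. f \<notin> adjoin_list (adjoin_vars I Z) (map indet xs) \<and>
        (\<forall>v\<in>V. indet v * f \<in> adjoin_list (adjoin_vars I Z) (map indet xs))))"
  using Z
proof (induction "card (V - Z)" arbitrary: Z)
  case 0
  then have "Z = V" using finite_V by (auto simp: final_def)
  have "1 \<notin> adjoin_vars I Z \<and> (\<forall>v\<in>V. indet v * 1 \<in> adjoin_vars I Z)"
    if I: "graded_ideal I" "leads I = T" for I
  proof
    have "lead (1 :: (var, 'k) mpoly) = 0" by (rule lead_mono_eqI) auto
    then have "0 \<in> leads (adjoin_vars I Z)" if "1 \<in> adjoin_vars I Z"
      using lead_in_leads[OF that] by simp
    then show "1 \<notin> adjoin_vars I Z"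
      using leads_adjoin_vars[OF I(1) 0(2)] I(2) T(2) by (auto simp: meeting_def)
    have "single (single v 1) 1 \<in> adjoin_vars I Z" if "v \<in> V" for v
      using that by (intro single_mem_adjoin_vars graded_idealD(1)[OF I(1)])
        (simp add: meeting_def Mon_single \<open>Z = V\<close>)
    then show "\<forall>v\<in>V. indet v * 1 \<in> adjoin_vars I Z" by (simp add: indet_def monomial_def)
  qed
  then have "\<exists>f\<in>R. f \<notin> adjoin_vars I Z \<and> (\<forall>v\<in>V. indet v * f \<in> adjoin_vars I Z)"
    if "graded_ideal I" "leads I = T" for I
    using that R1 by blast
  then show ?case by (intro exI[of _ "[]"]) auto
next
  case (Suc k)
  then have "V - Z \<noteq> {}" by (metis card.empty nat.distinct(1))
  then have "\<exists>x\<in>V - Z. \<forall>v\<in>V - Z. v \<noteq> x \<longrightarrow> var_after x v"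
    using finite_V var_after_total by (intro finite_has_greatest) (auto simp: var_after_def)
  then obtain x where x: "x \<in> V" "x \<notin> Z" "\<forall>v\<in>V - Z. v \<noteq> x \<longrightarrow> var_after x v" by blast
  have irr: "\<not> (var_after v w \<and> (var_after w v \<or> v = w))" for v w
    by (auto simp: var_after_def)
  have last: "v \<in> Z" if "v \<in> V" "var_after v x" for v
    using that x(3) irr by blast
  have fin: "final (insert x Z)"
    using Suc.prems x(1) last by (auto simp: final_def)
  show ?case
  proof (cases "\<exists>u\<in>Mon. u \<notin> T \<union> meeting Z \<and> single x 1 + u \<in> T \<union> meeting Z")
    case True
    then obtain u where u: "u \<in> Mon" "u \<notin> T \<union> meeting Z" "single x 1 + u \<in> T \<union> meeting Z" by blast
    have "\<exists>f\<in>R. f \<notin> adjoin_vars I Z \<and> (\<forall>v\<in>V. indet v * f \<in> adjoin_vars I Z)"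
      if I: "graded_ideal I" "leads I = T" for I
      using dvd x(1) T(1) u that
      by (intro socle_if_zero_divisor[OF _ I(1) _ Suc.prems x(1,2) fin last, of u]) auto
    then show ?thesis by (intro exI[of _ "[]"]) auto
  next
    case False
    have "k = card (V - insert x Z)"
    proof -
      have "V - insert x Z = (V - Z) - {x}" by blast
      then show ?thesis using Suc.hyps(2) x(1,2) finite_V by (simp add: card_Diff_singleton)
    qed
    from Suc.hyps(1)[OF this fin] obtain xs where xs: "set xs \<subseteq> V" "\<And>I. graded_ideal I \<Longrightarrow> leads I = T \<Longrightarrow>
      weakly_regular (adjoin_vars I (insert x Z)) (map indet xs) \<and>
      (\<exists>f\<in>R. f \<notin> adjoin_list (adjoin_vars I (insert x Z)) (map indet xs) \<and>
        (\<forall>v\<in>V. indet v * f \<in> adjoin_list (adjoin_vars I (insert x Z)) (map indet xs)))"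
      by blast
    have nzd: "u' \<in> adjoin_vars I Z"
      if I: "graded_ideal I" "leads I = T" and u': "u' \<in> R" "indet x * u' \<in> adjoin_vars I Z" for I u'
      using False nonzerodivisor_if_leads[OF graded_ideal_adjoin_vars[OF I(1)] x(1) _ u']
      unfolding leads_adjoin_vars[OF I(1) Suc.prems] I(2) by blast
    show ?thesis
    proof (intro exI[of _ "x # xs"] conjI allI impI)
      show "set (x # xs) \<subseteq> V" using x(1) xs(1) by simp
      fix I assume I: "graded_ideal I \<and> leads I = T"
      then have eq: "adjoin (adjoin_vars I Z) (indet x) = adjoin_vars I (insert x Z)"
        using adjoin_adjoin_vars x(1) by blast
      show "weakly_regular (adjoin_vars I Z) (map indet (x # xs))"
        using nzd I xs(2)[of I] by (simp add: eq)
      show "\<exists>f\<in>R. f \<notin> adjoin_list (adjoin_vars I Z) (map indet (x # xs)) \<and>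
        (\<forall>v\<in>V. indet v * f \<in> adjoin_list (adjoin_vars I Z) (map indet (x # xs)))"
        using I xs(2)[of I] by (simp add: eq)
    qed
  qed
qed

theorem stable_regular_socle:
  assumes "\<And>v w. v \<in> V \<Longrightarrow> w \<in> V \<Longrightarrow> fst v \<le> fst w \<Longrightarrow> q (fst v) dvd q (fst w)"
    and "strongly_stable T" "0 \<notin> T"
  obtains xs where "set xs \<subseteq> V"
    "\<And>I. graded_ideal I \<Longrightarrow> leads I = T \<Longrightarrow> weakly_regular I (map indet xs)"
    "\<And>I. graded_ideal I \<Longrightarrow> leads I = T \<Longrightarrow>
      \<exists>f\<in>R. f \<notin> adjoin_list I (map indet xs) \<and> (\<forall>v\<in>V. indet v * f \<in> adjoin_list I (map indet xs))"
proof -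
  have "final {}" by (simp add: final_def)
  from stable_regular_socle_vars[OF assms(1) assms(2,3) this]
  show ?thesis unfolding adjoin_vars_empty using that by blast
qed

end

section \<open>Graded automorphisms\<close>

lemma independent_rows_solve:
  assumes "independent_rows S C A" "finite S" "finite C" "card S = card C"
  shows "\<exists>x. \<forall>c\<in>C. (\<Sum>s\<in>S. x s * A s c) = b c"
proof -
  \<comment> \<open>Adding the row \<open>b\<close> gives more rows than columns.\<close>
  define S' where "S' = insert None (Some ` S)"
  define A' where "A' s c = (case s of None \<Rightarrow> b c | Some s \<Rightarrow> A s c)" for s c
  have sum_S': "(\<Sum>s\<in>S'. a s * A' s c) = a None * b c + (\<Sum>s\<in>S. a (Some s) * A s c)" for a c
    using assms(2) by (simp add: S'_def A'_def sum.reindex)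
  have "card S' = Suc (card S)" using assms(2) by (simp add: S'_def card_image)
  then have "\<not> card S' \<le> card C" using assms(4) by simp
  then have "\<not> independent_rows S' C A'"
    using independent_rows_card_le[of S' C A'] assms(2,3) by (auto simp: S'_def)
  then obtain a s0 where a: "\<And>c. c \<in> C \<Longrightarrow> (\<Sum>s\<in>S'. a s * A' s c) = 0" and s0: "s0 \<in> S'" "a s0 \<noteq> 0"
    unfolding independent_rows_def by blast
  have "a None \<noteq> 0"
  proof
    assume "a None = 0"
    then have "a (Some s) = 0" if "s \<in> S" for s
      using independent_rowsD[OF assms(1) _ that, of "\<lambda>s. a (Some s)"] a by (simp add: sum_S')
    then show False using s0 \<open>a None = 0\<close> by (auto simp: S'_def)
  qed
  have "(\<Sum>s\<in>S. (- a (Some s) / a None) * A s c) = b c" if "c \<in> C" for c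
  proof -
    have "(\<Sum>s\<in>S. (- a (Some s) / a None) * A s c) = - (\<Sum>s\<in>S. a (Some s) * A s c) / a None"
      by (simp add: sum_divide_distrib sum_negf)
    also have "(\<Sum>s\<in>S. a (Some s) * A s c) = - (a None * b c)"
      using a[OF that] by (simp add: sum_S' add_eq_0_iff)
    finally show ?thesis using \<open>a None \<noteq> 0\<close> by simp
  qed
  then show ?thesis by (intro exI[of _ "\<lambda>s. - a (Some s) / a None"] ballI)
qed

lemma subst_comp: "subst \<sigma> (subst \<tau> f) = subst (\<lambda>v. subst \<sigma> (\<tau> v)) f"
proof -
  have pow: "subst \<sigma> (g ^ k) = subst \<sigma> g ^ k" for g k
    by (induction k) (auto simp: substitution.mpoly_hom_mult)
  have "subst \<sigma> (mono_val \<tau> m) = mono_val (\<lambda>v. subst \<sigma> (\<tau> v)) m" for m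
    by (simp add: mono_val_def substitution.mpoly_hom_prod pow)
  then show ?thesis
    unfolding mpoly_hom_def[of const \<tau> f] mpoly_hom_def[of const "\<lambda>v. subst \<sigma> (\<tau> v)" f]
    by (simp add: substitution.mpoly_hom_sum substitution.mpoly_hom_mult)
qed

context weighted_ring
begin

lemma poly_ring_eq: "poly_ring n l = ring_on"
  unfolding poly_ring_def ring_on_def R_def[symmetric] ..

abbreviation "Aut \<equiv> graded_auts n l q :: ((var, 'k) mpoly \<Rightarrow> (var, 'k) mpoly) set"

lemma Aut_iff:
  "g \<in> Aut \<longleftrightarrow> (\<forall>f\<in>R. g f \<in> R) \<and> (\<forall>f\<in>R. \<forall>h\<in>R. g (f * h) = g f * g h) \<and>
     (\<forall>f\<in>R. \<forall>h\<in>R. g (f + h) = g f + g h) \<and> bij_betw g R R \<and> (\<forall>c. g (const c) = const c) \<and>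
     (\<forall>d. \<forall>f\<in>R. homogeneous q d f \<longrightarrow> homogeneous q d (g f))"
proof -
  have "g 1 = 1" if "\<forall>c. g (const c) = const c"
    using that[rule_format, of 1] by (simp add: const_hom)
  then show ?thesis
    unfolding graded_auts_def ring_iso_def poly_ring_eq by (auto simp: ring_hom_def)
qed

lemma AutD:
  assumes "g \<in> Aut"
  shows "f \<in> R \<Longrightarrow> g f \<in> R" "f \<in> R \<Longrightarrow> h \<in> R \<Longrightarrow> g (f * h) = g f * g h"
    "f \<in> R \<Longrightarrow> h \<in> R \<Longrightarrow> g (f + h) = g f + g h" "bij_betw g R R" "g (const c) = const c"
    "f \<in> R \<Longrightarrow> homogeneous q d f \<Longrightarrow> homogeneous q d (g f)"
proof -
  from assms have *: "\<forall>f\<in>R. g f \<in> R" "\<forall>f\<in>R. \<forall>h\<in>R. g (f * h) = g f * g h"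
    "\<forall>f\<in>R. \<forall>h\<in>R. g (f + h) = g f + g h" "bij_betw g R R" "\<forall>c. g (const c) = const c"
    "\<forall>d. \<forall>f\<in>R. homogeneous q d f \<longrightarrow> homogeneous q d (g f)"
    using assms[unfolded Aut_iff] by - (elim conjE; assumption)+
  then show "f \<in> R \<Longrightarrow> g f \<in> R" "f \<in> R \<Longrightarrow> h \<in> R \<Longrightarrow> g (f * h) = g f * g h"
    "f \<in> R \<Longrightarrow> h \<in> R \<Longrightarrow> g (f + h) = g f + g h" "bij_betw g R R" "g (const c) = const c"
    "f \<in> R \<Longrightarrow> homogeneous q d f \<Longrightarrow> homogeneous q d (g f)"
    by simp_all
qed

lemma Aut_comp:
  assumes b: "b \<in> Aut" and g: "g \<in> Aut"
  shows "(\<lambda>f. b (g f)) \<in> Aut"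
proof -
  have "bij_betw (\<lambda>f. b (g f)) R R"
    using bij_betw_trans[OF AutD(4)[OF g] AutD(4)[OF b]] by (simp add: o_def)
  moreover have "b (g (f * h)) = b (g f) * b (g h)" "b (g (f + h)) = b (g f) + b (g h)"
    if "f \<in> R" "h \<in> R" for f h
    using that by (simp_all add: AutD(1-3)[OF g] AutD(2,3)[OF b])
  moreover have "b (g f) \<in> R" if "f \<in> R" for f
    using AutD(1)[OF b AutD(1)[OF g that]] .
  moreover have "homogeneous q d (b (g f))" if "f \<in> R" "homogeneous q d f" for d f
    using AutD(6)[OF b AutD(1)[OF g that(1)] AutD(6)[OF g that]] .
  ultimately show ?thesis
    unfolding Aut_iff by (simp add: AutD(5)[OF b] AutD(5)[OF g])
qed

lemma Aut_zero: "g \<in> Aut \<Longrightarrow> g 0 = 0"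
  using AutD(5)[of g 0] by (simp add: const_hom)

lemma Aut_one: "g \<in> Aut \<Longrightarrow> g 1 = 1"
  using AutD(5)[of g 1] by (simp add: const_hom)

lemma Aut_inj: "g \<in> Aut \<Longrightarrow> f \<in> R \<Longrightarrow> h \<in> R \<Longrightarrow> g f = g h \<Longrightarrow> f = h"
  using AutD(4)[of g] by (auto simp: bij_betw_def dest: inj_onD)

lemma Aut_sum:
  assumes g: "g \<in> Aut" and F: "\<And>i. i \<in> X \<Longrightarrow> F i \<in> R"
  shows "g (\<Sum>i\<in>X. F i) = (\<Sum>i\<in>X. g (F i))"
  using F
proof (induction X rule: infinite_finite_induct)
  case (insert i X)
  then show ?case using AutD(3)[OF g, of "F i" "\<Sum>i\<in>X. F i"] sum_in_R[of X F] by simp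
qed (auto simp: Aut_zero[OF g])

lemma Aut_const_mult: "g \<in> Aut \<Longrightarrow> f \<in> R \<Longrightarrow> g (const a * f) = const a * g f"
  using AutD(2)[of g "const a" f] AutD(5)[of g a] by (simp add: const_in_R)

lemma prod_in_R: "(\<And>i. i \<in> X \<Longrightarrow> F i \<in> R) \<Longrightarrow> (\<Prod>i\<in>X. F i) \<in> R"
  by (induction X rule: infinite_finite_induct) (auto intro: R1 R_mult)

lemma power_in_R: "f \<in> R \<Longrightarrow> f ^ k \<in> R"
  by (induction k) (auto intro: R1 R_mult)

lemma Aut_prod:
  assumes g: "g \<in> Aut" and F: "\<And>i. i \<in> X \<Longrightarrow> F i \<in> R"
  shows "g (\<Prod>i\<in>X. F i) = (\<Prod>i\<in>X. g (F i))"
  using F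
proof (induction X rule: infinite_finite_induct)
  case (insert i X)
  then show ?case using AutD(2)[OF g, of "F i" "\<Prod>i\<in>X. F i"] prod_in_R[of X F] by simp
qed (auto simp: Aut_one[OF g])

lemma Aut_power:
  assumes g: "g \<in> Aut" and f: "f \<in> R"
  shows "g (f ^ k) = g f ^ k"
  using AutD(2)[OF g f power_in_R[OF f]] by (induction k) (auto simp: Aut_one[OF g])

text \<open>The coordinates of an automorphism are the coefficients of the images of the variables. By the
  following formula they determine its values on all polynomials.\<close>

lemma Aut_eq_subst:
  assumes g: "g \<in> Aut" and f: "f \<in> R"
  shows "g f = subst (\<lambda>v. g (indet v)) f"
proof -
  have "g (monomial m) = mono_val (\<lambda>v. g (indet v)) m" if m: "m \<in> Mon" for m
  proof -
    have v: "indet v \<in> R" if "v \<in> keys m" for v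
      using m that by (intro indet_in_R) (auto simp: Mon_def)
    have "g (monomial m) = g (\<Prod>v\<in>keys m. indet v ^ lookup m v)"
      unfolding mono_val_indet[symmetric] mono_val_def ..
    also have "\<dots> = (\<Prod>v\<in>keys m. g (indet v ^ lookup m v))"
      by (intro Aut_prod[OF g] power_in_R v)
    also have "\<dots> = mono_val (\<lambda>v. g (indet v)) m"
      unfolding mono_val_def by (intro prod.cong refl Aut_power[OF g] v)
    finally show ?thesis .
  qed
  note mono = this
  have fM: "keys f \<subseteq> Mon" using f by (simp add: in_R_Mon)
  have "g f = g (\<Sum>m\<in>keys f. const (lookup f m) * monomial m)"
    by (simp flip: single_eq_const_monomial poly_mapping_sum_single)
  also have "\<dots> = (\<Sum>m\<in>keys f. g (const (lookup f m) * monomial m))"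
    using fM by (intro Aut_sum[OF g] R_mult const_in_R monomial_in_R) auto
  also have "\<dots> = (\<Sum>m\<in>keys f. const (lookup f m) * mono_val (\<lambda>v. g (indet v)) m)"
    using fM mono by (intro sum.cong refl) (auto simp: Aut_const_mult[OF g] monomial_in_R)
  finally show ?thesis by (simp add: mpoly_hom_def)
qed

subsection \<open>Graded endomorphisms\<close>

definition graded_images :: "(var \<Rightarrow> (var, 'k) mpoly) \<Rightarrow> bool" where
  "graded_images \<sigma> \<longleftrightarrow> (\<forall>v\<in>V. \<sigma> v \<in> R \<and> homogeneous q (q (fst v)) (\<sigma> v))"

lemma homogeneous_indet: "homogeneous q (q (fst v)) (indet v)" for v :: var
  by (auto simp: indet_def monomial_def intro!: homogeneous_single)

lemma homogeneous_one: "homogeneous q 0 1"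
  by (simp add: homogeneous_def)

lemma homogeneous_power: "homogeneous q d f \<Longrightarrow> homogeneous q (d * k) (f ^ k)"
  for f :: "(var, 'c::comm_ring_1) mpoly"
  by (induction k) (auto intro: homogeneous_one homogeneous_mult)

lemma homogeneous_prod:
  "(\<And>i. i \<in> X \<Longrightarrow> homogeneous q (D i) (F i)) \<Longrightarrow> homogeneous q (\<Sum>i\<in>X. D i) (\<Prod>i\<in>X. F i)"
  for F :: "'i \<Rightarrow> (var, 'c::comm_ring_1) mpoly"
  by (induction X rule: infinite_finite_induct) (auto intro: homogeneous_one homogeneous_mult)

lemma graded_images_mono_val:
  assumes "graded_images \<sigma>" "m \<in> Mon"
  shows "mono_val \<sigma> m \<in> R" "homogeneous q (wdeg q m) (mono_val \<sigma> m)"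
proof -
  have v: "\<sigma> v \<in> R" "homogeneous q (q (fst v)) (\<sigma> v)" if "v \<in> keys m" for v
    using assms that by (auto simp: graded_images_def Mon_def)
  show "mono_val \<sigma> m \<in> R"
    unfolding mono_val_def by (intro prod_in_R power_in_R v)
  show "homogeneous q (wdeg q m) (mono_val \<sigma> m)"
    unfolding mono_val_def wdeg_def by (intro homogeneous_prod homogeneous_power v)
qed

lemma subst_in_R:
  assumes "graded_images \<sigma>" "f \<in> R"
  shows "subst \<sigma> f \<in> R"
  unfolding mpoly_hom_def using assms
  by (intro sum_in_R R_mult const_in_R graded_images_mono_val) (auto simp: in_R_Mon)

lemma subst_homogeneous:
  assumes "graded_images \<sigma>" "f \<in> R" "homogeneous q d f"
  shows "homogeneous q d (subst \<sigma> f)"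
  unfolding mpoly_hom_def
proof (intro homogeneous_sum homogeneous_const_mult)
  fix m assume "m \<in> keys f"
  then have "m \<in> Mon" "wdeg q m = d" using assms(2,3) by (auto simp: in_R_Mon homogeneous_def)
  then show "homogeneous q d (mono_val \<sigma> m)" using graded_images_mono_val(2)[OF assms(1)] by blast
qed

lemma subst_Aut:
  assumes "graded_images \<sigma>" "bij_betw (subst \<sigma>) R R"
  shows "subst \<sigma> \<in> Aut"
  unfolding Aut_iff
  using assms subst_in_R[OF assms(1)] subst_homogeneous[OF assms(1)]
  by (auto simp: substitution.mpoly_hom_add substitution.mpoly_hom_mult)

lemma graded_images_Aut: "g \<in> Aut \<Longrightarrow> graded_images (\<lambda>v. g (indet v))"
  unfolding graded_images_def
  using AutD(1)[of g] AutD(6)[of g] indet_in_R homogeneous_indet by blast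

lemma subst_eq_on_R:
  assumes "\<And>v. v \<in> V \<Longrightarrow> \<sigma> v = \<tau> v" "f \<in> R"
  shows "subst \<sigma> f = subst \<tau> f"
  using assms by (intro mpoly_hom_cong[of f V]) (auto simp: R_def)

lemma subst_inverse_on_R:
  assumes "\<And>v. v \<in> V \<Longrightarrow> subst \<sigma> (\<tau> v) = indet v" "f \<in> R"
  shows "subst \<sigma> (subst \<tau> f) = f"
  using subst_eq_on_R[of "\<lambda>v. subst \<sigma> (\<tau> v)" indet f] assms by (simp add: subst_comp)

text \<open>The condition in the degrees of the variables suffices for bijectivity and involves only
  finitely many matrices, so it is open.\<close>

definition nondegenerate :: "(var \<Rightarrow> (var, 'k) mpoly) \<Rightarrow> bool" where
  "nondegenerate \<sigma> \<longleftrightarrow> (\<forall>v\<in>V. independent_rows (Mon_deg (q (fst v))) (Mon_deg (q (fst v)))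
      (\<lambda>m c. lookup (subst \<sigma> (monomial m)) c))"

lemma Mon_deg_Mon: "m \<in> Mon_deg d \<Longrightarrow> m \<in> Mon"
  by (simp add: Mon_deg_def)

lemma homogeneous_eqI:
  assumes "f \<in> R" "homogeneous q d f" "g \<in> R" "homogeneous q d g"
    and "\<And>c. c \<in> Mon_deg d \<Longrightarrow> lookup f c = lookup g c"
  shows "f = g"
proof (rule poly_mapping_eqI)
  fix c
  show "lookup f c = lookup g c"
  proof (cases "c \<in> Mon_deg d")
    case False
    then have "c \<notin> keys f" "c \<notin> keys g"
      using assms(1-4) by (auto simp: Mon_deg_def homogeneous_def in_R_Mon)
    then show ?thesis by (simp add: in_keys_iff)
  qed (fact assms(5))
qed

lemma subst_combination:
  "subst \<sigma> (\<Sum>m\<in>S. single m (a m)) = (\<Sum>m\<in>S. const (a m) * subst \<sigma> (monomial m))"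
  by (simp add: substitution.mpoly_hom_sum monomial_def const_hom)

lemma lookup_combination:
  "lookup (\<Sum>s\<in>S. const (a s) * F s) c = (\<Sum>s\<in>S. a s * lookup (F s) c)"
  for F :: "'s \<Rightarrow> ('x, 'c::comm_ring_1) mpoly"
  by (simp add: lookup_sum)

lemma lookup_sum_single:
  "finite S \<Longrightarrow> lookup (\<Sum>m\<in>S. single m (a m)) c = (if c \<in> S then a c else 0)"
proof -
  assume "finite S"
  have "lookup (\<Sum>m\<in>S. single m (a m)) c = (\<Sum>m\<in>S. if m = c then a m else 0)"
    unfolding lookup_sum by (rule sum.cong) (auto simp: lookup_single when_def)
  then show ?thesis using \<open>finite S\<close> by (auto simp: sum.delta)
qed

lemma combination_Mon_deg:
  "(\<Sum>m\<in>Mon_deg d. single m (a m)) \<in> R" "homogeneous q d (\<Sum>m\<in>Mon_deg d. single m (a m))"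
proof -
  show "(\<Sum>m\<in>Mon_deg d. single m (a m)) \<in> R"
    by (intro sum_in_R single_in_R Mon_deg_Mon)
  show "homogeneous q d (\<Sum>m\<in>Mon_deg d. single m (a m))"
    by (intro homogeneous_sum homogeneous_single) (simp add: Mon_deg_def)
qed

lemma nondegenerate_if_inj:
  assumes \<sigma>: "graded_images \<sigma>" and inj: "\<And>f. f \<in> R \<Longrightarrow> subst \<sigma> f = 0 \<Longrightarrow> f = 0"
  shows "nondegenerate \<sigma>"
  unfolding nondegenerate_def independent_rows_def
proof (intro ballI allI impI)
  fix v :: var and a s
  let ?D = "Mon_deg (q (fst v))"
  assume v: "v \<in> V" and s: "s \<in> ?D"
    and a: "\<forall>c\<in>?D. (\<Sum>m\<in>?D. a m * lookup (subst \<sigma> (monomial m)) c) = 0"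
  let ?f = "\<Sum>m\<in>?D. single m (a m)"
  have "subst \<sigma> ?f = 0"
  proof (rule homogeneous_eqI)
    show "lookup (subst \<sigma> ?f) c = lookup 0 c" if "c \<in> ?D" for c
      using a that by (simp add: subst_combination lookup_combination)
  qed (use combination_Mon_deg subst_in_R[OF \<sigma>] subst_homogeneous[OF \<sigma>] R0 in auto)
  then have "?f = 0" using inj combination_Mon_deg by blast
  then have "lookup ?f s = 0" by simp
  then show "a s = 0" using s by (simp add: lookup_sum_single finite_Mon_deg)
qed

text \<open>In the degree of a variable the substitution is an injective linear map between spaces of the same
  finite dimension, so the variable has a preimage.\<close>

lemma nondegenerate_section:
  assumes \<sigma>: "graded_images \<sigma>" "nondegenerate \<sigma>"
  obtains \<tau> where "graded_images \<tau>" "\<And>f. f \<in> R \<Longrightarrow> subst \<sigma> (subst \<tau> f) = f"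
proof -
  have "\<exists>w. w \<in> R \<and> homogeneous q (q (fst v)) w \<and> subst \<sigma> w = indet v" if v: "v \<in> V" for v :: var
  proof -
    let ?D = "Mon_deg (q (fst v))"
    obtain x where x: "\<forall>c\<in>?D. (\<Sum>m\<in>?D. x m * lookup (subst \<sigma> (monomial m)) c) = lookup (indet v) c"
      using independent_rows_solve[of ?D ?D "\<lambda>m c. lookup (subst \<sigma> (monomial m)) c" "lookup (indet v)"]
        \<sigma>(2) v finite_Mon_deg unfolding nondegenerate_def by blast
    let ?w = "\<Sum>m\<in>?D. single m (x m)"
    have "subst \<sigma> ?w = indet v"
    proof (rule homogeneous_eqI)
      show "lookup (subst \<sigma> ?w) c = lookup (indet v) c" if "c \<in> ?D" for c
        using x that by (simp add: subst_combination lookup_combination)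
    qed (use combination_Mon_deg subst_in_R[OF \<sigma>(1)] subst_homogeneous[OF \<sigma>(1)]
          indet_in_R[OF v] homogeneous_indet[of v] in auto)
    then show ?thesis using combination_Mon_deg by blast
  qed
  then obtain \<tau> where \<tau>: "\<And>v. v \<in> V \<Longrightarrow> \<tau> v \<in> R \<and> homogeneous q (q (fst v)) (\<tau> v) \<and> subst \<sigma> (\<tau> v) = indet v"
    by metis
  show ?thesis
  proof (rule that)
    show "graded_images \<tau>" using \<tau> by (simp add: graded_images_def)
    show "subst \<sigma> (subst \<tau> f) = f" if "f \<in> R" for f
      using \<tau> that by (intro subst_inverse_on_R) auto
  qed
qed

text \<open>A right inverse is injective, hence has a right inverse itself, and is therefore bijective.\<close>

lemma nondegenerate_Aut:
  assumes \<sigma>: "graded_images \<sigma>" "nondegenerate \<sigma>"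
  shows "subst \<sigma> \<in> Aut"
proof (rule subst_Aut[OF \<sigma>(1)])
  obtain \<tau> where \<tau>: "graded_images \<tau>" "\<And>f. f \<in> R \<Longrightarrow> subst \<sigma> (subst \<tau> f) = f"
    using nondegenerate_section[OF \<sigma>] by blast
  have "nondegenerate \<tau>"
  proof (rule nondegenerate_if_inj[OF \<tau>(1)])
    show "f = 0" if "f \<in> R" "subst \<tau> f = 0" for f
      using \<tau>(2)[OF that(1)] that(2) by simp
  qed
  then obtain \<rho> where \<rho>: "graded_images \<rho>" "\<And>f. f \<in> R \<Longrightarrow> subst \<tau> (subst \<rho> f) = f"
    using nondegenerate_section[OF \<tau>(1)] by blast
  have "subst \<tau> (subst \<sigma> f) = f" if "f \<in> R" for f
    using \<rho>(2)[OF that] \<tau>(2)[OF subst_in_R[OF \<rho>(1) that]] by simp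
  then show "bij_betw (subst \<sigma>) R R"
    by (intro bij_betw_byWitness[of R "subst \<tau>"])
      (use \<tau>(2) subst_in_R[OF \<sigma>(1)] subst_in_R[OF \<tau>(1)] in auto)
qed

end

section \<open>The automorphism group is irreducible\<close>

lemma coordinate_functions_cong:
  "u \<in> coordinate_functions G x X \<Longrightarrow> (\<And>g. g \<in> G \<Longrightarrow> w g = u g) \<Longrightarrow> w \<in> coordinate_functions G x X"
  unfolding coordinate_functions_def by auto

context weighted_ring
begin

definition Fn :: "(((var, 'k) mpoly \<Rightarrow> (var, 'k) mpoly) \<Rightarrow> 'k) set" where
  "Fn = coordinate_functions Aut aut_coord (aut_coords n l q)"

lemma function_ring_Fn: "function_ring Fn"
  unfolding Fn_def by (rule function_ring_coordinate_functions)

text \<open>The entries of \<open>g (indet v)\<close> are coordinates of \<open>g\<close> or, at monomials of the wrong degree,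
  zero; the entries of \<open>g f\<close> are polynomials in them.\<close>

lemma lookup_in_Fn:
  assumes f: "f \<in> R"
  shows "(\<lambda>g. lookup (g f) c) \<in> Fn"
proof -
  interpret F: function_ring Fn by (rule function_ring_Fn)
  have "F.coeffs_in (\<lambda>g. g (indet v))" if v: "v \<in> V" for v
    unfolding F.coeffs_in_def
  proof
    fix c
    show "(\<lambda>g. lookup (g (indet v)) c) \<in> Fn"
    proof (cases "(v, c) \<in> aut_coords n l q")
      case True
      from coordinate_functions_coordinate[OF this, of aut_coord Aut] show ?thesis
        by (simp add: Fn_def aut_coord_def)
    next
      case False
      have "lookup (g (indet v)) c = 0" if g: "g \<in> Aut" for g
      proof -
        have "g (indet v) \<in> R" "homogeneous q (q (fst v)) (g (indet v))"
          using AutD(1)[OF g indet_in_R[OF v]] AutD(6)[OF g indet_in_R[OF v] homogeneous_indet] .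
        then have "c \<notin> keys (g (indet v))"
          using False v by (auto simp: aut_coords_def in_R_iff homogeneous_def)
        then show ?thesis by (simp add: in_keys_iff)
      qed
      then show ?thesis
        unfolding Fn_def by (rule coordinate_functions_cong[OF F.fr_const[of 0, unfolded Fn_def]])
    qed
  qed
  moreover have "indets f \<subseteq> V" using f unfolding R_def by simp
  ultimately have "F.coeffs_in (\<lambda>g. subst (\<lambda>v. g (indet v)) f)"
    by (rule F.coeffs_in_subst[rotated])
  then have "(\<lambda>g. lookup (subst (\<lambda>v. g (indet v)) f) c) \<in> Fn" by (simp add: F.coeffs_in_def)
  then show ?thesis
    unfolding Fn_def
  proof (rule coordinate_functions_cong)
    show "lookup (g f) c = lookup (subst (\<lambda>v. g (indet v)) f) c" if "g \<in> Aut" for g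
      using Aut_eq_subst[OF that f] by simp
  qed
qed

lemma id_Aut: "(\<lambda>f. f) \<in> Aut"
  by (simp add: Aut_iff bij_betw_def)

text \<open>Two automorphisms are joined by the line through their coordinates. All but finitely many
  points of the line are automorphisms, and a polynomial that does not vanish at some point of the line
  vanishes at only finitely many.\<close>

lemma Aut_irreducible:
  assumes inf: "infinite (UNIV :: 'k set)"
    and u: "u1 \<in> Fn" "u2 \<in> Fn" and g: "g1 \<in> Aut" "g2 \<in> Aut" "u1 g1 \<noteq> 0" "u2 g2 \<noteq> 0"
  shows "\<exists>g\<in>Aut. u1 g \<noteq> 0 \<and> u2 g \<noteq> 0"
proof -
  interpret P: function_ring "poly_functions :: ('k \<Rightarrow> 'k) set" by (rule function_ring_poly_functions)
  define \<sigma> where "\<sigma> t v = const (1 - t) * g1 (indet v) + const t * g2 (indet v)" for t v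
  have \<sigma>: "graded_images (\<sigma> t)" for t
    using graded_images_Aut[OF g(1)] graded_images_Aut[OF g(2)]
    by (auto simp: graded_images_def \<sigma>_def intro!: R_add R_mult const_in_R homogeneous_add homogeneous_const_mult)
  have coord: "(\<lambda>t. lookup (\<sigma> t v) c) \<in> poly_functions" for v c
    unfolding \<sigma>_def lookup_add lookup_const_mult
    by (intro P.fr_add P.fr_mult P.fr_diff P.fr_const poly_functions_id)
  have coeffs: "P.coeffs_in (\<lambda>t. subst (\<sigma> t) f)" if "f \<in> R" for f
    using that coord by (intro P.coeffs_in_subst[where A = V]) (auto simp: R_def P.coeffs_in_def)
  have \<sigma>01: "\<sigma> 0 = (\<lambda>v. g1 (indet v))" "\<sigma> 1 = (\<lambda>v. g2 (indet v))"
    by (simp_all add: \<sigma>_def[abs_def] const_hom)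
  have at0: "subst (\<sigma> 0) f = g1 f" if "f \<in> R" for f
    using Aut_eq_subst[OF g(1) that] by (simp add: \<sigma>01)
  have nd0: "nondegenerate (\<sigma> 0)"
  proof (rule nondegenerate_if_inj[OF \<sigma>])
    show "f = 0" if "f \<in> R" "subst (\<sigma> 0) f = 0" for f
      using Aut_inj[OF g(1) that(1) R0] that at0[OF that(1)] Aut_zero[OF g(1)] by simp
  qed
  have "\<exists>r\<in>poly_functions. r 0 \<noteq> 0 \<and> (\<forall>t. r t \<noteq> 0 \<longrightarrow>
      independent_rows (Mon_deg (q (fst v))) (Mon_deg (q (fst v))) (\<lambda>m c. lookup (subst (\<sigma> t) (monomial m)) c))"
    if v: "v \<in> V" for v
  proof -
    let ?D = "Mon_deg (q (fst v))"
    have 1: "(\<lambda>t. lookup (subst (\<sigma> t) (monomial m)) c) \<in> poly_functions" if "m \<in> ?D" "c \<in> ?D" for m c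
      using coeffs[OF monomial_in_R[OF Mon_deg_Mon[OF that(1)]]] by (simp add: P.coeffs_in_def)
    have 2: "independent_rows ?D ?D (\<lambda>m c. lookup (subst (\<sigma> 0) (monomial m)) c)"
      using nd0 v by (simp add: nondegenerate_def)
    from independent_rows_open[OF function_ring_poly_functions finite_Mon_deg 1 2] show ?thesis by blast
  qed
  then obtain r where r: "\<And>v. v \<in> V \<Longrightarrow> r v \<in> poly_functions" "\<And>v. v \<in> V \<Longrightarrow> r v 0 \<noteq> 0"
    "\<And>v t. v \<in> V \<Longrightarrow> r v t \<noteq> 0 \<Longrightarrow> independent_rows (Mon_deg (q (fst v))) (Mon_deg (q (fst v)))
        (\<lambda>m c. lookup (subst (\<sigma> t) (monomial m)) c)"
    by metis
  define r' where "r' t = (\<Prod>v\<in>V. r v t)" for t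
  have r': "r' \<in> poly_functions" "r' 0 \<noteq> 0"
    unfolding r'_def[abs_def] using r(1,2) finite_V by (auto intro: P.fr_prod)
  have aut: "subst (\<sigma> t) \<in> Aut" if "r' t \<noteq> 0" for t
  proof (rule nondegenerate_Aut[OF \<sigma>])
    show "nondegenerate (\<sigma> t)"
      using that r(3) finite_V by (auto simp: nondegenerate_def r'_def)
  qed
  have line: "\<exists>w\<in>poly_functions. (\<forall>t. r' t \<noteq> 0 \<longrightarrow> w t = u (subst (\<sigma> t))) \<and> w 0 = u g1 \<and> w 1 = u g2"
    if uF: "u \<in> Fn" for u
  proof -
    obtain p where p: "indets p \<subseteq> aut_coords n l q" "\<And>g. g \<in> Aut \<Longrightarrow> u g = eval_mpoly (aut_coord g) p"
      using uF unfolding Fn_def coordinate_functions_def by blast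
    have co: "aut_coord (subst (\<sigma> t)) x = lookup (\<sigma> t (fst x)) (snd x)" for t x
      by (simp add: aut_coord_def case_prod_unfold)
    have "(\<lambda>t. eval_mpoly (aut_coord (subst (\<sigma> t))) p) \<in> poly_functions"
      using p(1) by (rule P.fr_eval_mpoly) (simp add: co coord)
    moreover have "eval_mpoly (aut_coord (subst (\<sigma> 0))) p = u g1"
      unfolding p(2)[OF g(1)] eval_mpoly_eq_mpoly_hom
      using p(1) by (rule mpoly_hom_cong) (auto simp: co \<sigma>01 aut_coord_def)
    moreover have "eval_mpoly (aut_coord (subst (\<sigma> 1))) p = u g2"
      unfolding p(2)[OF g(2)] eval_mpoly_eq_mpoly_hom
      using p(1) by (rule mpoly_hom_cong) (auto simp: co \<sigma>01 aut_coord_def)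
    ultimately show ?thesis using p(2)[OF aut]
      by (intro bexI[of _ "\<lambda>t. eval_mpoly (aut_coord (subst (\<sigma> t))) p"]) auto
  qed
  obtain w1 where w1: "w1 \<in> poly_functions" "\<And>t. r' t \<noteq> 0 \<Longrightarrow> w1 t = u1 (subst (\<sigma> t))" "w1 0 = u1 g1"
    using line[OF u(1)] by blast
  obtain w2 where w2: "w2 \<in> poly_functions" "\<And>t. r' t \<noteq> 0 \<Longrightarrow> w2 t = u2 (subst (\<sigma> t))" "w2 1 = u2 g2"
    using line[OF u(2)] by blast
  have "finite ({t. r' t = 0} \<union> {t. w1 t = 0} \<union> {t. w2 t = 0})"
    using finite_zeros_poly_function[OF r'] finite_zeros_poly_function[OF w1(1), of 0]
      finite_zeros_poly_function[OF w2(1), of 1] w1(3) w2(3) g by simp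
  from ex_new_if_finite[OF inf this]
  obtain t where t: "r' t \<noteq> 0" "w1 t \<noteq> 0" "w2 t \<noteq> 0" by blast
  show ?thesis
    by (rule bexI[of _ "subst (\<sigma> t)"]) (use t w1(2) w2(2) aut in auto)
qed

lemma Aut_irreducible_finite:
  assumes inf: "infinite (UNIV :: 'k set)" and "finite X"
    and "\<And>i. i \<in> X \<Longrightarrow> u i \<in> Fn" "\<And>i. i \<in> X \<Longrightarrow> \<exists>g\<in>Aut. u i g \<noteq> 0"
  shows "\<exists>g\<in>Aut. (\<Prod>i\<in>X. u i g) \<noteq> 0"
  using assms(2-)
proof (induction X rule: finite_induct)
  case empty
  then show ?case using id_Aut by auto
next
  case (insert i X)
  interpret F: function_ring Fn by (rule function_ring_Fn)
  have prod: "(\<lambda>g. \<Prod>i\<in>X. u i g) \<in> Fn" using insert.prems by (intro F.fr_prod) auto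
  obtain g1 where g1: "g1 \<in> Aut" "(\<Prod>i\<in>X. u i g1) \<noteq> 0" using insert by auto
  obtain g2 where g2: "g2 \<in> Aut" "u i g2 \<noteq> 0" using insert.prems by blast
  have ui: "u i \<in> Fn" using insert.prems by blast
  have "\<exists>g\<in>Aut. (\<Prod>i\<in>X. u i g) \<noteq> 0 \<and> u i g \<noteq> 0"
    by (rule Aut_irreducible[of "\<lambda>g. \<Prod>i\<in>X. u i g" "u i" g1 g2]) (fact inf prod ui g1 g2)+
  then obtain g where "g \<in> Aut" "(\<Prod>i\<in>X. u i g) \<noteq> 0" "u i g \<noteq> 0" by blast
  then show ?case using insert.hyps by (intro bexI[of _ g]) auto
qed

section \<open>Generic leading monomials\<close>

definition Up :: "var mono \<Rightarrow> var mono set" where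
  "Up m = {c \<in> Mon_deg (wdeg q m). c = m \<or> c \<succ> m}"

lemma finite_Up: "finite (Up m)"
  by (simp add: Up_def finite_Mon_deg)

lemma combination_in_ideal:
  "is_ideal J \<Longrightarrow> (\<And>s. s \<in> S \<Longrightarrow> F s \<in> J) \<Longrightarrow> (\<Sum>s\<in>S. const (a s) * F s) \<in> J"
  by (intro ideal_sum ideal_const_mult)

text \<open>Elements of \<open>J\<close> that are independent in the coordinates above \<open>m\<close> force as many leading
  monomials above \<open>m\<close>: a combination is determined by its coordinates at those leading monomials.\<close>

lemma card_leads_ge:
  assumes J: "graded_ideal J" and S: "finite S"
    and F: "\<And>s. s \<in> S \<Longrightarrow> F s \<in> J" "\<And>s. s \<in> S \<Longrightarrow> homogeneous q (wdeg q m) (F s)"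
    and ind: "independent_rows S (Up m) (\<lambda>s c. lookup (F s) c)"
  shows "card S \<le> card (leads J \<inter> Up m)"
proof (rule independent_rows_card_le[of S _ "\<lambda>s c. lookup (F s) c"])
  show "independent_rows S (leads J \<inter> Up m) (\<lambda>s c. lookup (F s) c)"
    unfolding independent_rows_def
  proof (intro allI impI)
    fix a assume a: "\<forall>c\<in>leads J \<inter> Up m. (\<Sum>s\<in>S. a s * lookup (F s) c) = 0"
    define h where "h = (\<Sum>s\<in>S. const (a s) * F s)"
    have lh: "lookup h c = (\<Sum>s\<in>S. a s * lookup (F s) c)" for c
      unfolding h_def by (rule lookup_combination)
    have hJ: "h \<in> J" unfolding h_def by (rule combination_in_ideal[OF graded_idealD(1)[OF J] F(1)])
    have hR: "h \<in> R" by (rule is_idealD(1)[OF graded_idealD(1)[OF J] hJ])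
    have hh: "homogeneous q (wdeg q m) h"
      unfolding h_def by (intro homogeneous_sum homogeneous_const_mult F(2))
    have "lookup h c = 0" if c: "c \<in> Up m" for c
    proof (rule ccontr)
      assume "lookup h c \<noteq> 0"
      then have ck: "c \<in> keys h" by (simp add: in_keys_iff)
      then have h0: "h \<noteq> 0" by auto
      have lead_k: "lead h \<in> keys h" by (rule lead_mono(1)[OF h0])
      have "lead h = c \<or> lead h \<succ> c" using lead_mono(2)[OF h0 ck, of q] by blast
      then have "lead h = m \<or> lead h \<succ> m" using c drl_greater_trans[of q "lead h" c m] by (auto simp: Up_def)
      moreover have "lead h \<in> Mon_deg (wdeg q m)"
        using lead_k hR hh by (auto simp: Mon_deg_def in_R_Mon homogeneous_def)
      ultimately have "lead h \<in> leads J \<inter> Up m" using lead_in_leads[OF hJ h0] by (simp add: Up_def)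
      then have "lookup h (lead h) = 0" using a by (simp add: lh)
      then show False using lead_k by (simp add: in_keys_iff)
    qed
    then show "\<forall>s\<in>S. a s = 0" using ind unfolding independent_rows_def lh by blast
  qed
qed (use S finite_Up in auto)

text \<open>The matrix is triangular: consider the greatest row with a nonzero coefficient.\<close>

lemma distinct_leads_independent:
  assumes S: "S \<subseteq> C" "finite S"
    and F: "\<And>s. s \<in> S \<Longrightarrow> lookup (F s) s = (1 :: 'k)" "\<And>s t. s \<in> S \<Longrightarrow> t \<in> keys (F s) \<Longrightarrow> t \<noteq> s \<Longrightarrow> s \<succ> t"
  shows "independent_rows S C (\<lambda>s c. lookup (F s) c)"
  unfolding independent_rows_def
proof (intro allI impI, rule ccontr)
  fix a assume a: "\<forall>c\<in>C. (\<Sum>s\<in>S. a s * lookup (F s) c) = 0" and "\<not> (\<forall>s\<in>S. a s = 0)"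
  then have "{s \<in> S. a s \<noteq> 0} \<noteq> {}" by blast
  then obtain s0 where s0: "s0 \<in> S" "a s0 \<noteq> 0" "\<And>s. s \<in> S \<Longrightarrow> a s \<noteq> 0 \<Longrightarrow> s \<noteq> s0 \<Longrightarrow> s0 \<succ> s"
    using drl_has_greatest[of "{s \<in> S. a s \<noteq> 0}" q] S(2) by auto
  have "a s * lookup (F s) s0 = (if s = s0 then a s0 else 0)" if s: "s \<in> S" for s
  proof (cases "s = s0 \<or> a s = 0")
    case False
    then have "s0 \<succ> s" using s0(3)[OF s] by blast
    then have "\<not> s \<succ> s0" by (rule drl_greater_asym)
    then have "s0 \<notin> keys (F s)" using F(2)[OF s, of s0] False by blast
    then show ?thesis using False by (simp add: in_keys_iff)
  qed (use F(1)[OF s0(1)] in auto)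
  then have "(\<Sum>s\<in>S. a s * lookup (F s) s0) = (\<Sum>s\<in>S. if s = s0 then a s0 else 0)"
    by (intro sum.cong) auto
  then have "(\<Sum>s\<in>S. a s * lookup (F s) s0) = a s0" using s0(1) S(2) by simp
  then show False using a s0(1,2) S(1) by auto
qed

lemma Aut_hom_component:
  assumes g: "g \<in> Aut" and f: "f \<in> R"
  shows "hom_component q d (g f) = g (hom_component q d f)"
proof -
  let ?D = "wdeg q ` keys f"
  have "hom_component q d (\<Sum>e\<in>X. F e) = (\<Sum>e\<in>X. hom_component q d (F e))" for X :: "nat set" and F
    by (rule poly_mapping_eqI) (simp add: lookup_hom_component lookup_sum)
  note comp_sum = this
  have "g f = g (\<Sum>e\<in>?D. hom_component q e f)" using sum_hom_components[of f q] by simp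
  also have "\<dots> = (\<Sum>e\<in>?D. g (hom_component q e f))"
    by (intro Aut_sum[OF g] hom_component_in_R f)
  finally have "hom_component q d (g f) = (\<Sum>e\<in>?D. hom_component q d (g (hom_component q e f)))"
    by (simp add: comp_sum)
  also have "\<dots> = (\<Sum>e\<in>?D. if e = d then g (hom_component q d f) else 0)"
  proof (intro sum.cong refl)
    fix e
    have "homogeneous q e (g (hom_component q e f))"
      by (rule AutD(6)[OF g hom_component_in_R[OF f] homogeneous_hom_component])
    then show "hom_component q d (g (hom_component q e f)) = (if e = d then g (hom_component q d f) else 0)"
      using hom_component_homogeneous[of q e "g (hom_component q e f)" d] by auto
  qed
  also have "\<dots> = g (hom_component q d f)"
  proof (cases "d \<in> ?D")
    case False
    then have "hom_component q d f = 0"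
      by (intro poly_mapping_eqI) (auto simp: lookup_hom_component in_keys_iff)
    then show ?thesis using False Aut_zero[OF g] by simp
  qed simp
  finally show ?thesis .
qed

lemma Aut_image_R: "g \<in> Aut \<Longrightarrow> g ` R = R"
  using AutD(4)[of g] by (simp add: bij_betw_def)

lemma is_ideal_image:
  assumes g: "g \<in> Aut" and i: "is_ideal I"
  shows "is_ideal (g ` I)"
proof -
  have IR: "f \<in> R" if "f \<in> I" for f by (rule is_idealD(1)[OF i that])
  show ?thesis
    unfolding is_ideal_def
  proof (intro conjI ballI)
    show "g ` I \<subseteq> R" using IR AutD(1)[OF g] by blast
    show "0 \<in> g ` I" using is_idealD(2)[OF i] Aut_zero[OF g] by force
    fix x assume "x \<in> g ` I"
    then obtain f where f: "x = g f" "f \<in> I" by blast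
    show "r * x \<in> g ` I" if r: "r \<in> R" for r
    proof -
      obtain r' where r': "r' \<in> R" "r = g r'" using r Aut_image_R[OF g] by blast
      have "r * x = g (r' * f)" using AutD(2)[OF g r'(1) IR[OF f(2)]] by (simp add: f(1) r'(2))
      then show ?thesis using is_idealD(4)[OF i r'(1) f(2)] by blast
    qed
    fix y assume "y \<in> g ` I"
    then obtain h where h: "y = g h" "h \<in> I" by blast
    have "x + y = g (f + h)" using AutD(3)[OF g IR[OF f(2)] IR[OF h(2)]] by (simp add: f(1) h(1))
    then show "x + y \<in> g ` I" using is_idealD(3)[OF i f(2) h(2)] by blast
  qed
qed

lemma graded_ideal_image:
  assumes g: "g \<in> Aut" and I: "graded_ideal I"
  shows "graded_ideal (g ` I)"
  unfolding graded_ideal_def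
proof (intro conjI ballI allI)
  note i = graded_idealD(1)[OF I]
  show "is_ideal (g ` I)" by (rule is_ideal_image[OF g i])
  fix x d assume "x \<in> g ` I"
  then obtain f where f: "x = g f" "f \<in> I" by blast
  show "hom_component q d x \<in> g ` I"
    unfolding f(1) Aut_hom_component[OF g is_idealD(1)[OF i f(2)]]
    by (intro imageI graded_idealD(2)[OF I f(2)])
qed

definition count_above :: "(var, 'k) mpoly set \<Rightarrow> var mono \<Rightarrow> nat" where
  "count_above J m = card (leads J \<inter> Up m)"

lemma count_above_le: "count_above J m \<le> card (Up m)"
  unfolding count_above_def by (intro card_mono finite_Up) auto

text \<open>Elements of \<open>g0 ` I\<close> with distinct leading monomials are independent in the coordinates above
  \<open>m\<close>. Their preimages in \<open>I\<close> keep this property under all \<open>g\<close> in an open set.\<close>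

lemma count_above_open:
  assumes I: "graded_ideal I" and g0: "g0 \<in> Aut"
  shows "\<exists>p\<in>Fn. p g0 \<noteq> 0 \<and>
    (\<forall>g\<in>Aut. p g \<noteq> 0 \<longrightarrow> count_above (g0 ` I) m \<le> count_above (g ` I) m)"
proof -
  note i = graded_idealD(1)[OF I]
  have IR: "f \<in> R" if "f \<in> I" for f by (rule is_idealD(1)[OF i that])
  let ?S = "leads (g0 ` I) \<inter> Up m"
  have "\<exists>F. F \<in> I \<and> homogeneous q (wdeg q m) F \<and> lookup (g0 F) s = 1 \<and>
      (\<forall>t\<in>keys (g0 F). t \<noteq> s \<longrightarrow> s \<succ> t)" if s: "s \<in> ?S" for s
  proof -
    have ds: "wdeg q s = wdeg q m" using s by (auto simp: Up_def Mon_deg_def)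
    obtain f where f: "f \<in> g0 ` I" "homogeneous q (wdeg q m) f" "lookup f s = 1"
      "\<And>t. t \<in> keys f \<Longrightarrow> t \<noteq> s \<Longrightarrow> s \<succ> t"
      using leads_representative[OF graded_ideal_image[OF g0 I], of s] s unfolding ds by blast
    obtain h where h: "h \<in> I" "f = g0 h" using f(1) by blast
    have "g0 (hom_component q (wdeg q m) h) = f"
      using Aut_hom_component[OF g0 IR[OF h(1)], of "wdeg q m"] hom_component_homogeneous[OF f(2), of "wdeg q m"] h(2)
      by simp
    then show ?thesis
      using graded_idealD(2)[OF I h(1), of "wdeg q m"] homogeneous_hom_component[of q "wdeg q m" h] f(3,4)
      by (intro exI[of _ "hom_component q (wdeg q m) h"]) simp
  qed
  then obtain F where F: "\<And>s. s \<in> ?S \<Longrightarrow> F s \<in> I" "\<And>s. s \<in> ?S \<Longrightarrow> homogeneous q (wdeg q m) (F s)"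
    "\<And>s. s \<in> ?S \<Longrightarrow> lookup (g0 (F s)) s = 1"
    "\<And>s t. s \<in> ?S \<Longrightarrow> t \<in> keys (g0 (F s)) \<Longrightarrow> t \<noteq> s \<Longrightarrow> s \<succ> t"
    by metis
  have fin: "finite ?S" using finite_Up by blast
  have ind: "independent_rows ?S (Up m) (\<lambda>s c. lookup (g0 (F s)) c)"
    using F(3,4) fin by (intro distinct_leads_independent) auto
  have poly: "(\<lambda>g. lookup (g (F s)) c) \<in> Fn" if "s \<in> ?S" "c \<in> Up m" for s c
    by (rule lookup_in_Fn[OF IR[OF F(1)[OF that(1)]]])
  obtain p where p: "p \<in> Fn" "p g0 \<noteq> 0"
    "\<And>g. p g \<noteq> 0 \<Longrightarrow> independent_rows ?S (Up m) (\<lambda>s c. lookup (g (F s)) c)"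
    using independent_rows_open[where A = "\<lambda>g s c. lookup (g (F s)) c", OF function_ring_Fn fin poly ind]
    by blast
  show ?thesis
  proof (intro bexI[OF _ p(1)] conjI ballI impI)
    show "p g0 \<noteq> 0" by (rule p(2))
    fix g assume g: "g \<in> Aut" "p g \<noteq> 0"
    show "count_above (g0 ` I) m \<le> count_above (g ` I) m"
      unfolding count_above_def
    proof (rule card_leads_ge[OF graded_ideal_image[OF g(1) I] fin])
      show "g (F s) \<in> g ` I" if "s \<in> ?S" for s using F(1)[OF that] by blast
      show "homogeneous q (wdeg q m) (g (F s))" if "s \<in> ?S" for s
        by (rule AutD(6)[OF g(1) IR[OF F(1)[OF that]] F(2)[OF that]])
      show "independent_rows ?S (Up m) (\<lambda>s c. lookup (g (F s)) c)" by (rule p(3)[OF g(2)])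
    qed
  qed
qed


text \<open>The maximality of all counts determines the leading monomials of degree \<open>d\<close>.\<close>

definition generic :: "(var, 'k) mpoly set \<Rightarrow> nat \<Rightarrow> ((var, 'k) mpoly \<Rightarrow> (var, 'k) mpoly) \<Rightarrow> bool" where
  "generic I d g \<longleftrightarrow> g \<in> Aut \<and>
     (\<forall>m\<in>Mon_deg d. \<forall>h\<in>Aut. count_above (h ` I) m \<le> count_above (g ` I) m)"

lemma count_above_max_open:
  assumes I: "graded_ideal I"
  shows "\<exists>p\<in>Fn. (\<exists>g\<in>Aut. p g \<noteq> 0) \<and>
    (\<forall>g\<in>Aut. p g \<noteq> 0 \<longrightarrow> (\<forall>h\<in>Aut. count_above (h ` I) m \<le> count_above (g ` I) m))"
proof -
  have "\<exists>g0. g0 \<in> Aut \<and> (\<forall>h. h \<in> Aut \<longrightarrow> count_above (h ` I) m \<le> count_above (g0 ` I) m)"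
    by (rule ex_has_greatest_nat[of "\<lambda>g. g \<in> Aut", OF id_Aut, of _ "Suc (card (Up m))"])
      (simp add: count_above_le less_Suc_eq_le)
  then obtain g0 where g0: "g0 \<in> Aut" "\<And>h. h \<in> Aut \<Longrightarrow> count_above (h ` I) m \<le> count_above (g0 ` I) m"
    by blast
  obtain p where p: "p \<in> Fn" "p g0 \<noteq> 0"
    "\<And>g. g \<in> Aut \<Longrightarrow> p g \<noteq> 0 \<Longrightarrow> count_above (g0 ` I) m \<le> count_above (g ` I) m"
    using count_above_open[OF I g0(1)] by blast
  show ?thesis
  proof (intro bexI[OF _ p(1)] conjI ballI impI)
    show "\<exists>g\<in>Aut. p g \<noteq> 0" using p(2) g0(1) by (rule bexI)
    fix g h assume "g \<in> Aut" "p g \<noteq> 0" "h \<in> Aut"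
    then show "count_above (h ` I) m \<le> count_above (g ` I) m"
      using p(3)[of g] g0(2)[of h] by simp
  qed
qed

lemma generic_open:
  assumes inf: "infinite (UNIV :: 'k set)" and I: "graded_ideal I"
  shows "\<exists>p\<in>Fn. (\<exists>g\<in>Aut. p g \<noteq> 0) \<and> (\<forall>g\<in>Aut. p g \<noteq> 0 \<longrightarrow> generic I d g)"
proof -
  interpret F: function_ring Fn by (rule function_ring_Fn)
  have "\<forall>m. \<exists>p. p \<in> Fn \<and> (\<exists>g\<in>Aut. p g \<noteq> 0) \<and>
    (\<forall>g\<in>Aut. p g \<noteq> 0 \<longrightarrow> (\<forall>h\<in>Aut. count_above (h ` I) m \<le> count_above (g ` I) m))"
    using count_above_max_open[OF I] by blast
  from choice[OF this] obtain P where P: "\<And>m. P m \<in> Fn" "\<And>m. \<exists>g\<in>Aut. P m g \<noteq> 0"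
    "\<And>m g h. g \<in> Aut \<Longrightarrow> P m g \<noteq> 0 \<Longrightarrow> h \<in> Aut \<Longrightarrow> count_above (h ` I) m \<le> count_above (g ` I) m"
    by blast
  show ?thesis
  proof (intro bexI[of _ "\<lambda>g. \<Prod>m\<in>Mon_deg d. P m g"] conjI ballI impI)
    show "\<exists>g\<in>Aut. (\<Prod>m\<in>Mon_deg d. P m g) \<noteq> 0"
      by (rule Aut_irreducible_finite[OF inf finite_Mon_deg P(1) P(2)])
    show "(\<lambda>g. \<Prod>m\<in>Mon_deg d. P m g) \<in> Fn" by (rule F.fr_prod[OF P(1)])
    show "generic I d g" if g: "g \<in> Aut" "(\<Prod>m\<in>Mon_deg d. P m g) \<noteq> 0" for g
    proof -
      have "P m g \<noteq> 0" if "m \<in> Mon_deg d" for m using g(2) that finite_Mon_deg by simp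
      then show ?thesis using P(3)[OF g(1)] g(1) by (simp add: generic_def)
    qed
  qed
qed

text \<open>At the greatest monomial in which two sets differ, the counts differ by one.\<close>

lemma same_counts_imp_eq:
  assumes L: "L \<subseteq> Mon_deg d" "L' \<subseteq> Mon_deg d"
    and count: "\<And>m. m \<in> Mon_deg d \<Longrightarrow> card (L \<inter> Up m) = card (L' \<inter> Up m)"
  shows "L = L'"
proof (rule ccontr)
  assume "L \<noteq> L'"
  let ?D = "(L - L') \<union> (L' - L)"
  have fin: "finite L" "finite L'" using L finite_Mon_deg finite_subset by blast+
  have "?D \<noteq> {}" using \<open>L \<noteq> L'\<close> by blast
  then obtain m where m: "m \<in> ?D" "\<forall>t\<in>?D. t \<noteq> m \<longrightarrow> m \<succ> t"
    using drl_has_greatest[of ?D q] fin by auto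
  have mD: "m \<in> Mon_deg d" using m(1) L by blast
  have self: "m \<in> Up m" using mD by (simp add: Up_def Mon_deg_def)
  have "t \<in> L \<longleftrightarrow> t \<in> L'" if t: "t \<in> Up m" "t \<noteq> m" for t
  proof -
    have "t \<succ> m" using t by (simp add: Up_def)
    then have "\<not> m \<succ> t" by (rule drl_greater_asym)
    then show ?thesis using m(2) t(2) by blast
  qed
  then have eq: "L \<inter> Up m - {m} = L' \<inter> Up m - {m}" by blast
  have c: "card (A \<inter> Up m) = card (A \<inter> Up m - {m}) + (if m \<in> A then 1 else 0)" if "finite A" for A
  proof (cases "m \<in> A")
    case True
    then show ?thesis using card.remove[of "A \<inter> Up m" m] that self by simp
  qed simp
  have "card (L \<inter> Up m) \<noteq> card (L' \<inter> Up m)"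
    unfolding c[OF fin(1)] c[OF fin(2)] eq using m(1) by auto
  then show False using count[OF mD] by simp
qed

lemma Up_subset: "m \<in> Mon_deg d \<Longrightarrow> Up m \<subseteq> Mon_deg d"
  by (auto simp: Up_def Mon_deg_def)

lemma leads_Int_Up: "m \<in> Mon_deg d \<Longrightarrow> leads J \<inter> Mon_deg d \<inter> Up m = leads J \<inter> Up m"
  using Up_subset by blast

lemma generic_leads_unique:
  assumes "generic I d g" "generic I d h"
  shows "leads (g ` I) \<inter> Mon_deg d = leads (h ` I) \<inter> Mon_deg d"
proof (rule same_counts_imp_eq)
  fix m assume m: "m \<in> Mon_deg d"
  have "count_above (g ` I) m = count_above (h ` I) m"
    using assms m by (intro antisym) (auto simp: generic_def)
  then show "card (leads (g ` I) \<inter> Mon_deg d \<inter> Up m) = card (leads (h ` I) \<inter> Mon_deg d \<inter> Up m)"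
    unfolding leads_Int_Up[OF m] count_above_def .
qed auto

text \<open>The lowest monomial of a degree counts all leading monomials of that degree.\<close>

lemma card_leads_le_generic:
  assumes "generic I d g" "h \<in> Aut"
  shows "card (leads (h ` I) \<inter> Mon_deg d) \<le> card (leads (g ` I) \<inter> Mon_deg d)"
proof (cases "Mon_deg d = {}")
  case False
  have "\<exists>m\<in>Mon_deg d. \<forall>t\<in>Mon_deg d. t \<noteq> m \<longrightarrow> t \<succ> m"
    using finite_Mon_deg False
    by (rule finite_has_greatest[where gt = "\<lambda>x y. y \<succ> x"])
      (blast intro: drl_greater_trans dest: drl_greater_total)+
  then obtain m where m: "m \<in> Mon_deg d" "\<forall>t\<in>Mon_deg d. t \<noteq> m \<longrightarrow> t \<succ> m" by blast
  then have "Up m = Mon_deg d" by (auto simp: Up_def Mon_deg_def)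
  then show ?thesis using assms m(1) unfolding generic_def count_above_def by auto
qed simp

text \<open>The generic leading monomials of the various degrees fit together to one set \<open>T\<close> that is closed
  under multiplication, because two degrees can be treated with one \<open>g\<close>. If \<open>g\<close> is generic in the
  degrees of a finite basis of \<open>T\<close>, then \<open>leads (g ` I)\<close> contains \<open>T\<close>, and it cannot be larger
  because the generic count is maximal in every degree.\<close>

theorem generic_leads_exist:
  assumes inf: "infinite (UNIV :: 'k set)" and I: "graded_ideal I"
  shows "\<exists>T p. p \<in> Fn \<and> (\<exists>g\<in>Aut. p g \<noteq> 0) \<and> (\<forall>g\<in>Aut. p g \<noteq> 0 \<longrightarrow> leads (g ` I) = T) \<and>
    (\<forall>h\<in>Aut. \<forall>m\<in>Mon. count_above (h ` I) m \<le> card (T \<inter> Up m))"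
proof -
  interpret F: function_ring Fn by (rule function_ring_Fn)
  have "\<forall>d. \<exists>p. p \<in> Fn \<and> (\<exists>g\<in>Aut. p g \<noteq> 0) \<and> (\<forall>g\<in>Aut. p g \<noteq> 0 \<longrightarrow> generic I d g)"
    using generic_open[OF inf I] by blast
  from choice[OF this] obtain P where P: "\<And>d. P d \<in> Fn" "\<And>d. \<exists>g\<in>Aut. P d g \<noteq> 0"
    "\<And>d g. g \<in> Aut \<Longrightarrow> P d g \<noteq> 0 \<Longrightarrow> generic I d g"
    by blast
  have common: "\<exists>g\<in>Aut. (\<forall>d\<in>X. generic I d g)" if X: "finite X" for X
  proof -
    have "\<exists>g\<in>Aut. (\<Prod>d\<in>X. P d g) \<noteq> 0"
      by (rule Aut_irreducible_finite[OF inf X P(1) P(2)])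
    then obtain g where g: "g \<in> Aut" "(\<Prod>d\<in>X. P d g) \<noteq> 0" by blast
    then have "generic I d g" if "d \<in> X" for d using P(3)[OF g(1)] X that by simp
    then show ?thesis using g(1) by blast
  qed
  define T where "T = {m \<in> Mon. \<exists>g. generic I (wdeg q m) g \<and> m \<in> leads (g ` I)}"
  have T_deg: "T \<inter> Mon_deg d = leads (g ` I) \<inter> Mon_deg d" if g: "generic I d g" for d g
  proof -
    have "m \<in> leads (g ` I)" if m: "m \<in> Mon_deg d" "m \<in> T" for m
    proof -
      obtain h where h: "generic I d h" "m \<in> leads (h ` I)"
        using m by (auto simp: T_def Mon_deg_def)
      then show ?thesis using generic_leads_unique[OF h(1) g] m(1) by blast
    qed
    moreover have "m \<in> T" if m: "m \<in> Mon_deg d" "m \<in> leads (g ` I)" for m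
      using m g unfolding T_def Mon_deg_def by auto
    ultimately show ?thesis by blast
  qed
  have TMon: "T \<subseteq> Mon" by (auto simp: T_def)
  have up: "t + s \<in> T" if s: "s \<in> T" and t: "t \<in> Mon" for s t
  proof -
    obtain g where g: "g \<in> Aut" "generic I (wdeg q s) g" "generic I (wdeg q (t + s)) g"
      using common[of "{wdeg q s, wdeg q (t + s)}"] by auto
    have "s \<in> Mon_deg (wdeg q s)" "t + s \<in> Mon_deg (wdeg q (t + s))"
      using s t TMon by (auto simp: Mon_deg_def Mon_add)
    moreover from this have "s \<in> leads (g ` I)" using T_deg[OF g(2)] s by blast
    then have "t + s \<in> leads (g ` I)"
      by (rule leads_up[OF graded_idealD(1)[OF graded_ideal_image[OF g(1) I]] _ t])
    ultimately show ?thesis using T_deg[OF g(3)] by blast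
  qed
  have "keys t \<subseteq> V" if "t \<in> T" for t using that TMon by (auto simp: Mon_def)
  from dickson[OF finite_V this]
  obtain B where B: "finite B" "B \<subseteq> T" "\<And>t. t \<in> T \<Longrightarrow> \<exists>b\<in>B. \<exists>c. t = c + b" by blast
  let ?X = "wdeg q ` B"
  have "leads (g ` I) = T" if g: "g \<in> Aut" "(\<Prod>d\<in>?X. P d g) \<noteq> 0" for g
  proof -
    note J = graded_idealD(1)[OF graded_ideal_image[OF g(1) I]]
    have gen: "generic I (wdeg q b) g" if "b \<in> B" for b
      using P(3)[OF g(1), of "wdeg q b"] g(2) B(1) that by simp
    have sub: "T \<subseteq> leads (g ` I)"
    proof
      fix t assume t: "t \<in> T"
      obtain b c where b: "b \<in> B" "t = c + b" using B(3)[OF t] by blast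
      have "b \<in> Mon_deg (wdeg q b)" using b(1) B(2) TMon by (auto simp: Mon_deg_def)
      then have "b \<in> leads (g ` I)" using T_deg[OF gen[OF b(1)]] b(1) B(2) by blast
      moreover have "c \<in> Mon" using t TMon unfolding b(2) by (auto simp: Mon_add)
      ultimately show "t \<in> leads (g ` I)" unfolding b(2) by (rule leads_up[OF J])
    qed
    have "leads (g ` I) \<subseteq> T"
    proof
      fix m assume m: "m \<in> leads (g ` I)"
      define d where "d = wdeg q m"
      have md: "m \<in> Mon_deg d" using m leads_Mon[OF J] by (auto simp: Mon_deg_def d_def)
      obtain h where h: "generic I d h" using common[of "{d}"] by auto
      have "card (leads (g ` I) \<inter> Mon_deg d) \<le> card (T \<inter> Mon_deg d)"
        unfolding T_deg[OF h] by (rule card_leads_le_generic[OF h g(1)])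
      then have "T \<inter> Mon_deg d = leads (g ` I) \<inter> Mon_deg d"
        using sub finite_Mon_deg by (intro card_seteq) auto
      then show "m \<in> T" using m md by blast
    qed
    with sub show ?thesis by (intro antisym)
  qed
  moreover have "count_above (h ` I) m \<le> card (T \<inter> Up m)" if h: "h \<in> Aut" and m: "m \<in> Mon" for h m
  proof -
    obtain g where g: "generic I (wdeg q m) g" using common[of "{wdeg q m}"] by auto
    have md: "m \<in> Mon_deg (wdeg q m)" using m by (simp add: Mon_deg_def)
    have "count_above (h ` I) m \<le> count_above (g ` I) m" using g h md by (auto simp: generic_def)
    also have "\<dots> = card (T \<inter> Up m)"
      using T_deg[OF g] Up_subset[OF md] unfolding count_above_def by (intro arg_cong[of _ _ card]) blast
    finally show ?thesis .
  qed
  moreover have "(\<lambda>g. \<Prod>d\<in>?X. P d g) \<in> Fn" by (rule F.fr_prod[OF P(1)])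
  moreover have "\<exists>g\<in>Aut. (\<Prod>d\<in>?X. P d g) \<noteq> 0"
    using B(1) by (intro Aut_irreducible_finite[OF inf _ P(1) P(2)]) simp
  ultimately show ?thesis
    by (intro exI[of _ T] exI[of _ "\<lambda>g. \<Prod>d\<in>?X. P d g"]) blast
qed

end

section \<open>Stability of generic leading monomials\<close>

context weighted_ring
begin

context
  fixes v :: var and m' :: "var mono"
  assumes v: "v \<in> V" and m': "m' \<in> Mon" "wdeg q m' = q (fst v)" "\<And>u. u \<in> keys m' \<Longrightarrow> var_after v u"
begin

definition shift :: "var mono \<Rightarrow> var mono" where
  "shift c = c - single v 1 + m'"

definition shear :: "'k \<Rightarrow> var \<Rightarrow> (var, 'k) mpoly" where
  "shear t u = (if u = v then indet v + const t * monomial m' else indet u)"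

lemma v_notin_m': "v \<notin> keys m'"
  using m'(3)[of v] by (auto simp: var_after_def)

lemma shift_mono: "v \<in> keys c \<Longrightarrow> v \<in> keys e \<Longrightarrow> c \<succ> e \<Longrightarrow> shift c \<succ> shift e"
proof -
  assume c: "v \<in> keys c" and e: "v \<in> keys e" and ce: "c \<succ> e"
  have "c = single v 1 + (c - single v 1)" "e = single v 1 + (e - single v 1)"
    using mono_diff_single[OF c] mono_diff_single[OF e] by (simp_all add: add.commute)
  then have "c - single v 1 \<succ> e - single v 1" using ce drl_greater_add by metis
  then show ?thesis unfolding shift_def by (simp add: drl_greater_add add.commute[of _ m'])
qed

lemma wdeg_shift: "v \<in> keys c \<Longrightarrow> wdeg q (shift c) = wdeg q c"
proof -
  assume c: "v \<in> keys c"
  have "wdeg q c = wdeg q (c - single v 1) + q (fst v)"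
    using mono_diff_single[OF c] wdeg_add[of q "c - single v 1" "single v 1"] by simp
  then show ?thesis by (simp add: shift_def wdeg_add m'(2))
qed

lemma shift_greater: "v \<in> keys c \<Longrightarrow> shift c \<succ> c"
proof -
  assume c: "v \<in> keys c"
  have "lookup (shift c) w = lookup c w" if w: "var_after w v" for w
  proof -
    have "w \<notin> keys m'" using m'(3)[of w] w by (auto simp: var_after_def)
    moreover have "w \<noteq> v" using w by (auto simp: var_after_def)
    ultimately show ?thesis by (simp add: shift_def lookup_add lookup_minus lookup_single in_keys_iff)
  qed
  moreover have "lookup (shift c) v < lookup c v"
    using c v_notin_m' by (simp add: shift_def lookup_add lookup_minus in_keys_iff)
  ultimately have "\<exists>u. lookup (shift c) u < lookup c u \<and>
      (\<forall>w. var_after w u \<longrightarrow> lookup (shift c) w = lookup c w)"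
    by (intro exI[of _ v]) blast
  then show ?thesis using wdeg_shift[OF c] unfolding drl_greater_def by simp
qed

lemma shear_graded: "graded_images (shear t)"
  unfolding graded_images_def
proof (intro ballI conjI)
  fix u assume u: "u \<in> V"
  show "shear t u \<in> R"
    unfolding shear_def using indet_in_R[OF u] indet_in_R[OF v] monomial_in_R[OF m'(1)]
    by (auto intro: R_add R_mult const_in_R)
  have "homogeneous q (q (fst v)) (monomial m')"
    unfolding monomial_def by (rule homogeneous_single[OF m'(2)])
  then show "homogeneous q (q (fst u)) (shear t u)"
    unfolding shear_def using homogeneous_indet[of u] homogeneous_indet[of v]
    by (auto intro: homogeneous_add homogeneous_const_mult)
qed

lemma subst_shear_monomial_avoiding:
  assumes "v \<notin> keys c"
  shows "subst (shear t) (monomial c) = monomial c"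
proof -
  have "subst (shear t) (monomial c) = subst indet (monomial c)"
    by (rule mpoly_hom_cong[where A = "keys c"])
      (use assms in \<open>auto simp: shear_def monomial_def indets_def split: if_splits\<close>)
  then show ?thesis by simp
qed

lemma shear_Aut: "subst (shear t) \<in> Aut"
proof (rule subst_Aut[OF shear_graded])
  have inv: "subst (shear s) (subst (shear (- s)) f) = f" if "f \<in> R" for s f
  proof (rule subst_inverse_on_R[OF _ that])
    fix u
    show "subst (shear s) (shear (- s) u) = indet u"
    proof (cases "u = v")
      case True
      have "const s * monomial m' + const (- s) * monomial m' = (0 :: (var, 'k) mpoly)"
        by (rule poly_mapping_eqI) (simp add: lookup_add)
      then show ?thesis
        using True subst_shear_monomial_avoiding[OF v_notin_m', of s]
        by (simp add: shear_def substitution.mpoly_hom_add substitution.mpoly_hom_mult add.assoc)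
    qed (simp add: shear_def)
  qed
  show "bij_betw (subst (shear t)) R R"
    by (rule bij_betw_byWitness[of R "subst (shear (- t))"])
      (use inv[of _ t] inv[of _ "- t"] subst_in_R[OF shear_graded] in auto)
qed

text \<open>The value of the derivation that sends the variable \<open>v\<close> to \<open>monomial m'\<close> and the other
  variables to zero.\<close>

definition derivative :: "(var, 'k) mpoly \<Rightarrow> (var, 'k) mpoly" where
  "derivative f = (\<Sum>c\<in>{c \<in> keys f. v \<in> keys c}. single (shift c) (lookup f c * of_nat (lookup c v)))"

text \<open>The first order expansion of the shear in its parameter: the remainder is polynomial in \<open>t\<close>.\<close>

definition expands :: "(var, 'k) mpoly \<Rightarrow> (var, 'k) mpoly \<Rightarrow> bool" where
  "expands f D \<longleftrightarrow> (\<exists>r. (\<forall>c. (\<lambda>t. lookup (r t) c) \<in> poly_functions) \<and>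
     (\<forall>t. subst (shear t) f = f + const t * D + const (t * t) * r t))"

lemma expands_add: "expands f D \<Longrightarrow> expands g E \<Longrightarrow> expands (f + g) (D + E)"
proof -
  interpret P: function_ring "poly_functions :: ('k \<Rightarrow> 'k) set" by (rule function_ring_poly_functions)
  assume "expands f D" "expands g E"
  then obtain r s where r: "\<And>c. (\<lambda>t. lookup (r t) c) \<in> poly_functions"
      "\<And>t. subst (shear t) f = f + const t * D + const (t * t) * r t"
    and s: "\<And>c. (\<lambda>t. lookup (s t) c) \<in> poly_functions"
      "\<And>t. subst (shear t) g = g + const t * E + const (t * t) * s t"
    unfolding expands_def by blast
  show ?thesis
    unfolding expands_def
    by (rule exI[of _ "\<lambda>t. r t + s t"])
      (auto simp: lookup_add substitution.mpoly_hom_add r s algebra_simps intro: P.fr_add r s)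
qed

text \<open>The Leibniz rule for the linear terms.\<close>

lemma expands_mult: "expands f D \<Longrightarrow> expands g E \<Longrightarrow> expands (f * g) (D * g + f * E)"
proof -
  interpret P: function_ring "poly_functions :: ('k \<Rightarrow> 'k) set" by (rule function_ring_poly_functions)
  assume "expands f D" "expands g E"
  then obtain r s where r: "P.coeffs_in r" "\<And>t. subst (shear t) f = f + const t * D + const (t * t) * r t"
    and s: "P.coeffs_in s" "\<And>t. subst (shear t) g = g + const t * E + const (t * t) * s t"
    unfolding expands_def P.coeffs_in_def by blast
  define w where "w t = D * E + r t * g + f * s t + const t * (D * s t + r t * E) + const (t * t) * (r t * s t)" for t
  have add: "P.coeffs_in (\<lambda>t. a t + b t)" if "P.coeffs_in a" "P.coeffs_in b" for a b :: "'k \<Rightarrow> (var, 'k) mpoly"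
    using that unfolding P.coeffs_in_def by (auto simp: lookup_add intro: P.fr_add)
  have scal: "P.coeffs_in (\<lambda>t. const (u t) * b t)" if "u \<in> poly_functions" "P.coeffs_in b"
    for u and b :: "'k \<Rightarrow> (var, 'k) mpoly"
    using that unfolding P.coeffs_in_def by (auto intro: P.fr_mult)
  have "P.coeffs_in w"
    unfolding w_def[abs_def]
    by (intro add scal P.coeffs_in_mult P.coeffs_in_const r(1) s(1) poly_functions_id P.fr_mult)
  moreover have "subst (shear t) (f * g) = f * g + const t * (D * g + f * E) + const (t * t) * w t" for t
    unfolding substitution.mpoly_hom_mult r(2) s(2) w_def const_hom(4) by (simp add: algebra_simps)
  ultimately show ?thesis unfolding expands_def P.coeffs_in_def by blast
qed

lemma expands_const_mult: "expands f D \<Longrightarrow> expands (const a * f) (const a * D)"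
proof -
  interpret P: function_ring "poly_functions :: ('k \<Rightarrow> 'k) set" by (rule function_ring_poly_functions)
  have "expands (const a) 0"
    unfolding expands_def by (rule exI[of _ "\<lambda>t. 0"]) (auto intro: P.fr_const)
  moreover assume "expands f D"
  ultimately show ?thesis using expands_mult by fastforce
qed

lemma expands_fixed:
  assumes "\<And>t. subst (shear t) f = f"
  shows "expands f 0"
proof -
  interpret P: function_ring "poly_functions :: ('k \<Rightarrow> 'k) set" by (rule function_ring_poly_functions)
  show ?thesis
    unfolding expands_def by (rule exI[of _ "\<lambda>t. 0"]) (auto simp: assms intro: P.fr_const)
qed

lemma expands_power_v:
  "expands (monomial (single v k)) (single (shift (single v k)) (of_nat k))"
proof (induction k)
  case 0
  show ?case using expands_fixed[of "monomial 0"] subst_shear_monomial_avoiding[of 0] by simp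
next
  case (Suc k)
  interpret P: function_ring "poly_functions :: ('k \<Rightarrow> 'k) set" by (rule function_ring_poly_functions)
  have "expands (indet v) (monomial m')"
    unfolding expands_def by (rule exI[of _ "\<lambda>t. 0"]) (auto simp: shear_def intro: P.fr_const)
  from expands_mult[OF this Suc]
  have "expands (indet v * monomial (single v k))
      (monomial m' * monomial (single v k) + indet v * single (shift (single v k)) (of_nat k))" .
  moreover have "indet v * monomial (single v k) = (monomial (single v (Suc k)) :: (var, 'k) mpoly)"
    unfolding indet_def by (simp flip: monomial_add single_add)
  moreover have "monomial m' * monomial (single v k) + indet v * single (shift (single v k)) (of_nat k) =
      (single (shift (single v (Suc k))) (of_nat (Suc k)) :: (var, 'k) mpoly)"
  proof -
    have s: "shift (single v (Suc k)) = m' + single v k"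
      by (rule poly_mapping_eqI)
        (auto simp: shift_def lookup_add lookup_minus lookup_single when_def)
    have "indet v * single (shift (single v k)) (of_nat k) = (single (m' + single v k) (of_nat k) :: (var, 'k) mpoly)"
    proof (cases k)
      case (Suc j)
      have "single v 1 + shift (single v k) = m' + single v k"
        by (rule poly_mapping_eqI)
          (auto simp: shift_def lookup_add lookup_minus lookup_single when_def Suc)
      then show ?thesis by (simp add: indet_mult_single)
    qed simp
    then show ?thesis
      unfolding s by (simp add: monomial_def mult_single flip: single_add)
  qed
  ultimately show ?case by simp
qed

lemma expands_monomial:
  "expands (monomial c) (if v \<in> keys c then single (shift c) (of_nat (lookup c v)) else 0)"
proof -
  define k where "k = lookup c v"
  define c0 where "c0 = c - single v k"
  have c: "c = single v k + c0"
    by (rule poly_mapping_eqI) (simp add: c0_def k_def lookup_add lookup_minus lookup_single when_def)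
  have "v \<notin> keys c0" by (simp add: c0_def k_def in_keys_iff lookup_minus)
  then have "expands (monomial c0) 0" using subst_shear_monomial_avoiding by (intro expands_fixed)
  from expands_mult[OF expands_power_v this]
  have e: "expands (monomial c) (single (shift (single v k)) (of_nat k) * monomial c0)"
    unfolding c monomial_add by simp
  show ?thesis
  proof (cases "v \<in> keys c")
    case True
    then have "k \<noteq> 0" by (simp add: k_def in_keys_iff)
    then have "shift (single v k) + c0 = shift c"
      by (intro poly_mapping_eqI)
        (auto simp: shift_def lookup_add lookup_minus lookup_single when_def c0_def k_def)
    then show ?thesis using e True by (simp add: monomial_def mult_single k_def)
  next
    case False
    then have "k = 0" by (simp add: k_def in_keys_iff)
    then show ?thesis using e False by simp
  qed
qed

lemma expands_derivative: "expands f (derivative f)"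
proof -
  have "expands (\<Sum>c\<in>X. single c (lookup f c))
      (\<Sum>c\<in>X. if v \<in> keys c then single (shift c) (lookup f c * of_nat (lookup c v)) else 0)"
    if "finite X" for X
    using that
  proof (induction X rule: finite_induct)
    case empty
    then show ?case using expands_fixed[of 0] by simp
  next
    case (insert c X)
    have "expands (single c (lookup f c)) (if v \<in> keys c then single (shift c) (lookup f c * of_nat (lookup c v)) else 0)"
      using expands_const_mult[OF expands_monomial[of c], of "lookup f c"]
      by (simp add: single_eq_const_monomial[of c] const_mult_single split: if_splits)
    then show ?case using insert expands_add by simp
  qed
  from this[of "keys f"] show ?thesis
    unfolding derivative_def by (simp add: sum.inter_filter flip: poly_mapping_sum_single)
qed

lemma lookup_derivative_greater:
  assumes f: "\<And>t. t \<in> keys f \<Longrightarrow> t \<noteq> w \<Longrightarrow> w \<succ> t" and w: "v \<in> keys w" and c: "c \<succ> shift w"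
  shows "lookup (derivative f) c = 0"
  unfolding derivative_def lookup_sum
proof (rule sum.neutral, rule ballI)
  fix t assume t: "t \<in> {t \<in> keys f. v \<in> keys t}"
  have "shift t = shift w \<or> shift w \<succ> shift t"
    using f[of t] t shift_mono[OF w, of t] by blast
  then have "c \<succ> shift t" using c drl_greater_trans[of q c "shift w" "shift t"] by auto
  then have "shift t \<noteq> c" using drl_greater_irrefl by metis
  then show "lookup (single (shift t) (lookup f t * of_nat (lookup t v))) c = 0"
    by (simp add: lookup_single)
qed

lemma lookup_derivative_lead:
  assumes f: "\<And>t. t \<in> keys f \<Longrightarrow> t \<noteq> w \<Longrightarrow> w \<succ> t" and w: "v \<in> keys w" "w \<in> keys f"
  shows "lookup (derivative f) (shift w) = lookup f w * of_nat (lookup w v)"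
proof -
  let ?X = "{t \<in> keys f. v \<in> keys t}"
  have "lookup (single (shift t) (lookup f t * of_nat (lookup t v))) (shift w) =
      (if t = w then lookup f w * of_nat (lookup w v) else 0)" if t: "t \<in> ?X" for t
  proof (cases "t = w")
    case False
    then have "shift w \<succ> shift t" using f[of t] t shift_mono[OF w(1), of t] by blast
    then have "shift t \<noteq> shift w" using drl_greater_irrefl by metis
    then show ?thesis using False by (simp add: lookup_single)
  qed simp
  then have "lookup (derivative f) (shift w) = (\<Sum>t\<in>?X. if t = w then lookup f w * of_nat (lookup w v) else 0)"
    unfolding derivative_def lookup_sum by (intro sum.cong refl)
  then show ?thesis using w by simp
qed

text \<open>Suppose that \<open>ws = shift w\<close> is not a leading monomial. Consider the sheared images of the reduced
  elements with leading monomial above \<open>ws\<close>, together with \<open>1/t\<close> times the sheared image of the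
  reduced element of \<open>w\<close>. In the coordinates from \<open>ws\<close> upwards the last one is polynomial in \<open>t\<close>,
  because the reduced element of \<open>w\<close> itself has no terms there, and its value at \<open>t = 0\<close> is the
  derivative. The derivative has the exponent of \<open>v\<close> in \<open>w\<close> as coefficient at \<open>ws\<close> and nothing
  above. So the family is independent at \<open>t = 0\<close>, hence also for some nonzero \<open>t\<close>, and the sheared
  ideal has more leading monomials from \<open>ws\<close> upwards than \<open>J\<close>.\<close>

lemma shift_in_leads:
  assumes inf: "infinite (UNIV :: 'k set)" and char0: "\<And>k. k > 0 \<Longrightarrow> of_nat k \<noteq> (0 :: 'k)"
    and J: "graded_ideal J"
    and max: "\<And>b m. b \<in> Aut \<Longrightarrow> m \<in> Mon \<Longrightarrow> count_above (b ` J) m \<le> card (leads J \<inter> Up m)"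
    and w: "w \<in> leads J" "v \<in> keys w"
  shows "shift w \<in> leads J"
proof (rule ccontr)
  assume bad: "shift w \<notin> leads J"
  interpret P: function_ring "poly_functions :: ('k \<Rightarrow> 'k) set" by (rule function_ring_poly_functions)
  note j = graded_idealD(1)[OF J]
  define T where "T = leads J"
  define ws where "ws = shift w"
  have wM: "w \<in> Mon" using w(1) leads_Mon[OF j] by blast
  then have wsM: "ws \<in> Mon" unfolding ws_def shift_def by (simp add: Mon_add diff_in_Mon m'(1))
  have dws: "wdeg q ws = wdeg q w" unfolding ws_def by (rule wdeg_shift[OF w(2)])
  have ws_w: "ws \<succ> w" unfolding ws_def by (rule shift_greater[OF w(2)])
  define T' where "T' = T \<inter> Up ws"
  have finT': "finite T'" unfolding T'_def using finite_Up by blast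
  have T'D: "s \<in> T" "s \<succ> ws" "wdeg q s = wdeg q w" "s \<in> Up ws" if "s \<in> T'" for s
    using that bad by (auto simp: T'_def Up_def Mon_deg_def T_def ws_def dws[unfolded ws_def])
  have wT': "w \<notin> T'" using T'D(2)[of w] ws_w drl_greater_asym by blast
  have "\<exists>F. F \<in> J \<and> homogeneous q (wdeg q s) F \<and> lookup F s = 1 \<and> (\<forall>t\<in>keys F. t \<noteq> s \<longrightarrow> s \<succ> t \<and> t \<notin> T)"
    if "s \<in> T" for s
    using leads_reduced_representative[OF J, of s] that unfolding T_def by metis
  then obtain F where F: "\<And>s. s \<in> T \<Longrightarrow> F s \<in> J" "\<And>s. s \<in> T \<Longrightarrow> homogeneous q (wdeg q s) (F s)"
    "\<And>s. s \<in> T \<Longrightarrow> lookup (F s) s = 1" "\<And>s t. s \<in> T \<Longrightarrow> t \<in> keys (F s) \<Longrightarrow> t \<noteq> s \<Longrightarrow> s \<succ> t \<and> t \<notin> T"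
    by metis
  have FR: "F s \<in> R" if "s \<in> T" for s by (rule is_idealD(1)[OF j F(1)[OF that]])
  have wT: "w \<in> T" using w(1) by (simp add: T_def)
  have below: "t \<noteq> w \<Longrightarrow> w \<succ> t" if "t \<in> keys (F w)" for t using F(4)[OF wT that] by blast
  obtain r where r: "\<And>c. (\<lambda>t. lookup (r t) c) \<in> poly_functions"
    "\<And>t. subst (shear t) (F w) = F w + const t * derivative (F w) + const (t * t) * r t"
    using expands_derivative[of "F w"] unfolding expands_def by blast
  define D where "D = derivative (F w)"
  \<comment> \<open>The row of \<open>w\<close> is already divided by \<open>t\<close>, so that it makes sense at \<open>t = 0\<close>.\<close>
  define A where "A t s c = (if s = w then lookup D c + t * lookup (r t) c else lookup (subst (shear t) (F s)) c)"
    for t s c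
  define S where "S = insert w T'"
  have finS: "finite S" using finT' by (simp add: S_def)
  have shear_coeff: "P.coeffs_in (\<lambda>t. shear t u)" for u
  proof -
    have "(\<lambda>t :: 'k. lookup (indet v) c + t * lookup (monomial m') c) \<in> poly_functions" for c
      by (intro P.fr_add P.fr_mult P.fr_const poly_functions_id)
    then show ?thesis
      by (cases "u = v") (auto simp: P.coeffs_in_def shear_def lookup_add intro: P.fr_const)
  qed
  have A_poly: "(\<lambda>t. A t s c) \<in> poly_functions" for s c
  proof (cases "s = w")
    case True
    then show ?thesis unfolding A_def by (simp add: P.fr_add P.fr_mult P.fr_const poly_functions_id r(1))
  next
    case False
    have "P.coeffs_in (\<lambda>t. subst (shear t) (F s))"
      using shear_coeff by (intro P.coeffs_in_subst[where A = UNIV]) auto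
    then show ?thesis using False by (simp add: A_def P.coeffs_in_def)
  qed
  have shear0: "subst (shear 0) f = f" for f
  proof -
    have "shear 0 = indet" by (rule ext) (simp add: shear_def const_hom)
    then show ?thesis by simp
  qed
  have ind0: "independent_rows S (Up ws) (A 0)"
    unfolding independent_rows_def
  proof (intro allI impI)
    fix a assume a: "\<forall>c\<in>Up ws. (\<Sum>s\<in>S. a s * A 0 s c) = 0"
    have sum: "(\<Sum>s\<in>S. a s * A 0 s c) = a w * lookup D c + (\<Sum>s\<in>T'. a s * lookup (F s) c)" for c
    proof -
      have "(\<Sum>s\<in>T'. a s * A 0 s c) = (\<Sum>s\<in>T'. a s * lookup (F s) c)"
        using wT' by (intro sum.cong refl) (auto simp: A_def shear0)
      then show ?thesis using wT' finT' by (simp add: S_def) (simp add: A_def)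
    qed
    have aT': "a c = 0" if c: "c \<in> T'" for c
    proof -
      have "lookup D c = 0"
        unfolding D_def using below w(2) T'D(2)[OF c] unfolding ws_def by (rule lookup_derivative_greater)
      moreover have "(\<Sum>s\<in>T'. a s * lookup (F s) c) = (\<Sum>s\<in>T'. if s = c then a c else 0)"
      proof (intro sum.cong refl)
        fix s assume s: "s \<in> T'"
        show "a s * lookup (F s) c = (if s = c then a c else 0)"
        proof (cases "s = c")
          case False
          then have "c \<notin> keys (F s)" using F(4)[OF T'D(1)[OF s], of c] T'D(1)[OF c] by blast
          then show ?thesis using False by (simp add: in_keys_iff)
        qed (use F(3)[OF T'D(1)[OF s]] in simp)
      qed
      ultimately show ?thesis
        using a T'D(4)[OF c] sum[of c] c finT' by (simp add: sum.delta)
    qed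
    have "ws \<in> Up ws" using wsM by (simp add: Up_def Mon_deg_def)
    then have "a w * lookup D ws = 0"
      using a sum[of ws] aT' by simp
    moreover have "lookup D ws = lookup (F w) w * of_nat (lookup w v)"
      unfolding D_def ws_def
    proof (rule lookup_derivative_lead[OF below w(2)])
      show "w \<in> keys (F w)" using F(3)[OF wT] by (simp add: in_keys_iff)
    qed auto
    moreover have "lookup w v > 0" using w(2) by (simp add: in_keys_iff)
    ultimately have "a w = 0" using F(3)[OF wT] char0 by simp
    then show "\<forall>s\<in>S. a s = 0" using aT' by (simp add: S_def)
  qed
  obtain p where p: "p \<in> poly_functions" "p 0 \<noteq> 0" "\<And>t. p t \<noteq> 0 \<Longrightarrow> independent_rows S (Up ws) (A t)"
    using independent_rows_open[where A = A, OF function_ring_poly_functions finS A_poly ind0] by blast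
  have "finite ({t. p t = 0} \<union> {0})" using finite_zeros_poly_function[OF p(1,2)] by simp
  from ex_new_if_finite[OF inf this] obtain t where t: "p t \<noteq> 0" "t \<noteq> 0" by blast
  let ?b = "subst (shear t)"
  define H where "H s = (if s = w then const (inverse t) * ?b (F w) else ?b (F s))" for s
  have ST: "s \<in> T" "wdeg q s = wdeg q ws" if "s \<in> S" for s
    using that T'D wT by (auto simp: S_def dws)
  have bJ: "graded_ideal (?b ` J)" by (rule graded_ideal_image[OF shear_Aut J])
  have "card S \<le> card (leads (?b ` J) \<inter> Up ws)"
  proof (rule card_leads_ge[OF bJ finS])
    show "H s \<in> ?b ` J" if s: "s \<in> S" for s
    proof -
      have "?b (F s) \<in> ?b ` J" using F(1)[OF ST(1)[OF s]] by blast
      then show ?thesis unfolding H_def using ideal_const_mult[OF graded_idealD(1)[OF bJ]] by auto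
    qed
    show "homogeneous q (wdeg q ws) (H s)" if s: "s \<in> S" for s
    proof -
      have "homogeneous q (wdeg q ws) (?b (F s))"
        using subst_homogeneous[OF shear_graded FR[OF ST(1)[OF s]]] F(2)[OF ST(1)[OF s]] ST(2)[OF s] by simp
      then show ?thesis unfolding H_def using homogeneous_const_mult by auto
    qed
    have eq: "lookup (H s) c = A t s c" if c: "c \<in> Up ws" for s c
    proof (cases "s = w")
      case True
      have "c \<succ> w" using c ws_w drl_greater_trans[of q c ws w] by (auto simp: Up_def)
      then have "c \<notin> keys (F w)" using below[of c] drl_greater_asym drl_greater_irrefl by blast
      then have "lookup (F w) c = 0" by (simp add: in_keys_iff)
      then have "lookup (?b (F w)) c = t * lookup D c + t * t * lookup (r t) c"
        unfolding r(2) D_def by (simp add: lookup_add)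
      then show ?thesis using True t(2) by (simp add: H_def A_def field_simps)
    qed (simp add: H_def A_def)
    show "independent_rows S (Up ws) (\<lambda>s c. lookup (H s) c)"
      using p(3)[OF t(1)] unfolding independent_rows_def by (simp add: eq)
  qed
  also have "\<dots> \<le> card (leads J \<inter> Up ws)"
    using max[OF shear_Aut wsM, of t] by (simp add: count_above_def)
  also have "\<dots> = card T'" by (simp add: T'_def T_def)
  finally show False using wT' finT' by (simp add: S_def)
qed

end

theorem strongly_stable_if_generic:
  assumes "infinite (UNIV :: 'k set)" "\<And>k. k > 0 \<Longrightarrow> of_nat k \<noteq> (0 :: 'k)" "graded_ideal J"
    and "\<And>b m. b \<in> Aut \<Longrightarrow> m \<in> Mon \<Longrightarrow> count_above (b ` J) m \<le> card (leads J \<inter> Up m)"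
  shows "strongly_stable (leads J)"
  unfolding strongly_stable_def
proof (intro ballI impI)
  fix w v m
  assume w: "w \<in> leads J" "v \<in> keys w" and m: "m \<in> Mon" "wdeg q m = q (fst v) \<and> (\<forall>u\<in>keys m. var_after v u)"
  have "v \<in> V" using w leads_Mon[OF graded_idealD(1)[OF assms(3)]] by (auto simp: Mon_def)
  moreover have "wdeg q m = q (fst v)" "\<And>u. u \<in> keys m \<Longrightarrow> var_after v u" using m(2) by blast+
  ultimately have prem: "v \<in> V" "m \<in> Mon" "wdeg q m = q (fst v)" "\<And>u. u \<in> keys m \<Longrightarrow> var_after v u"
    using m(1) by blast+
  have "shift v m w \<in> leads J"
    by (rule shift_in_leads[OF prem]) (assumption | fact assms w)+
  then show "w - single v 1 + m \<in> leads J"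
    by (simp add: shift_def[OF prem])
qed

end

section \<open>Depth of the generic initial ideal\<close>

context weighted_ring
begin

abbreviation irr :: "(var, 'k) mpoly set" where "irr \<equiv> irrelevant_ideal n l"

lemma homogeneous_ideal_iff: "homogeneous_ideal n l q I \<longleftrightarrow> graded_ideal I"
  by (simp add: homogeneous_ideal_def graded_ideal_def poly_ring_eq ideal_ring_on_iff)

lemma initial_ideal_eq:
  assumes J: "graded_ideal J"
  shows "initial_ideal n l q J = monomial_ideal (leads J)"
proof -
  interpret ring ring_on by (rule ring_ring_on)
  note j = graded_idealD(1)[OF J]
  let ?G = "monomial ` leads J :: (var, 'k) mpoly set"
  have "{monomial (lead f) | f. f \<in> J \<and> f \<noteq> 0} = ?G" by (auto simp: leads_def)
  then have eq: "initial_ideal n l q J = Idl\<^bsub>ring_on\<^esub> ?G"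
    by (simp add: initial_ideal_def poly_ring_eq)
  have GR: "?G \<subseteq> carrier ring_on" using leads_Mon[OF j] monomial_in_R by auto
  have M: "graded_ideal (monomial_ideal (leads J))"
    by (rule graded_monomial_ideal[OF up_closed_leads[OF j]])
  have "Idl\<^bsub>ring_on\<^esub> ?G \<subseteq> monomial_ideal (leads J)"
  proof (rule genideal_minimal)
    show "ideal (monomial_ideal (leads J)) ring_on"
      unfolding ideal_ring_on_iff by (rule graded_idealD(1)[OF M])
    show "?G \<subseteq> monomial_ideal (leads J)" by (auto simp: monomial_ideal_def monomial_def)
  qed
  moreover have "monomial_ideal (leads J) \<subseteq> Idl\<^bsub>ring_on\<^esub> ?G"
  proof
    fix f assume f: "f \<in> monomial_ideal (leads J)"
    have I: "is_ideal (Idl\<^bsub>ring_on\<^esub> ?G)"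
      using genideal_ideal[OF GR] by (simp only: ideal_ring_on_iff)
    have "single m (lookup f m) \<in> Idl\<^bsub>ring_on\<^esub> ?G" if "m \<in> keys f" for m
    proof -
      have "monomial m \<in> ?G" using f that by (auto simp: monomial_ideal_def)
      then have "monomial m \<in> Idl\<^bsub>ring_on\<^esub> ?G" using genideal_self[OF GR] by blast
      then show ?thesis unfolding single_eq_const_monomial[of m] by (rule ideal_const_mult[OF I])
    qed
    then show "f \<in> Idl\<^bsub>ring_on\<^esub> ?G"
      by (subst poly_mapping_sum_single) (rule ideal_sum[OF I])
  qed
  ultimately show ?thesis unfolding eq by (rule subset_antisym)
qed

lemma lookup_indet_0: "lookup (indet u) 0 = 0"
proof -
  have "single u (1 :: nat) \<noteq> 0"
  proof
    assume "single u (1 :: nat) = 0"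
    then have "lookup (single u (1 :: nat)) u = 0" by (simp only: lookup_zero)
    then show False by simp
  qed
  then show ?thesis by (simp add: indet_def monomial_def lookup_single when_def)
qed

lemma irr_eq: "irr = {f \<in> R. lookup f 0 = 0}"
proof -
  interpret ring ring_on by (rule ring_ring_on)
  let ?A = "{f \<in> R. lookup f 0 = 0}"
  have eq: "irr = Idl\<^bsub>ring_on\<^esub> (indet ` V)" by (simp add: irrelevant_ideal_def poly_ring_eq)
  have VR: "indet ` V \<subseteq> carrier ring_on" using indet_in_R by auto
  have dec: "{ab :: var mono \<times> var mono. fst ab + snd ab = 0} = {(0, 0)}"
  proof -
    have "a = 0" if "a + b = 0" for a b :: "var mono"
    proof (rule poly_mapping_eqI)
      fix v
      have "lookup (a + b) v = 0" using that by simp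
      then show "lookup a v = lookup 0 v" by (simp add: lookup_add)
    qed
    note left = this
    show ?thesis
    proof (intro equalityI subsetI)
      fix ab :: "var mono \<times> var mono" assume "ab \<in> {ab. fst ab + snd ab = 0}"
      then have "fst ab + snd ab = 0" "snd ab + fst ab = 0" by (simp_all add: add.commute)
      then have "fst ab = 0" "snd ab = 0" using left by blast+
      then show "ab \<in> {(0, 0)}" by (simp add: prod_eq_iff)
    qed simp
  qed
  have mult0: "lookup (f * h) 0 = lookup f 0 * lookup h 0" for f h :: "(var, 'k) mpoly"
    unfolding lookup_mult_sum dec by simp
  have "is_ideal ?A"
    unfolding is_ideal_def using R0 R_add R_mult by (auto simp: lookup_add mult0)
  moreover have "indet ` V \<subseteq> ?A"
    using indet_in_R by (auto simp: lookup_indet_0)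
  ultimately have "irr \<subseteq> ?A"
    unfolding eq by (intro genideal_minimal) (simp_all only: ideal_ring_on_iff)
  moreover have "?A \<subseteq> irr"
  proof
    fix f assume f: "f \<in> ?A"
    have I: "is_ideal irr" unfolding eq using genideal_ideal[OF VR] by (simp only: ideal_ring_on_iff)
    have "single m (lookup f m) \<in> irr" if m: "m \<in> keys f" for m
    proof -
      have mM: "m \<in> Mon" using f m by (auto simp: in_R_Mon)
      have "m \<noteq> 0" using f m by (auto simp: in_keys_iff)
      then obtain v where v: "v \<in> keys m" using keys_nonempty by blast
      then have "v \<in> V" using mM by (auto simp: Mon_def)
      then have "indet v \<in> irr" unfolding eq using genideal_self[OF VR] by blast
      then have "single (m - single v 1) (lookup f m) * indet v \<in> irr"
        by (rule is_idealD(4)[OF I single_in_R[OF diff_in_Mon[OF mM]]])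
      then show ?thesis unfolding single_split[OF v, of "lookup f m"] by (simp add: mult.commute)
    qed
    then show "f \<in> irr" by (subst poly_mapping_sum_single) (rule ideal_sum[OF I])
  qed
  ultimately show ?thesis by (rule subset_antisym)
qed

lemma irr_mult_mem:
  assumes K: "is_ideal K" and f: "f \<in> R" "\<And>v. v \<in> V \<Longrightarrow> indet v * f \<in> K" and y: "y \<in> irr"
  shows "y * f \<in> K"
proof -
  interpret ring ring_on by (rule ring_ring_on)
  have "is_ideal {y \<in> R. y * f \<in> K}"
    unfolding is_ideal_def
    using R0 R_add R_mult is_idealD(2)[OF K] is_idealD(3)[OF K] is_idealD(4)[OF K]
    by (auto simp: distrib_right mult.assoc)
  then have "irr \<subseteq> {y \<in> R. y * f \<in> K}"
    unfolding irrelevant_ideal_def poly_ring_eq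
    by (intro genideal_minimal) (use f indet_in_R in \<open>auto simp: ideal_ring_on_iff\<close>)
  then show ?thesis using y by blast
qed

text \<open>Automorphisms respect components of degree zero and fix the constants.\<close>

lemma Aut_irr_iff:
  assumes g: "g \<in> Aut" and f: "f \<in> R"
  shows "g f \<in> irr \<longleftrightarrow> f \<in> irr"
proof -
  have c0: "hom_component q 0 f = const (lookup f 0)"
  proof (rule poly_mapping_eqI)
    fix m
    have "wdeg q m \<noteq> 0 \<or> m \<notin> keys f" if "m \<noteq> 0"
      using Mon_deg_0[of m] that f by (auto simp: in_R_Mon)
    then show "lookup (hom_component q 0 f) m = lookup (const (lookup f 0)) m"
      by (auto simp: lookup_hom_component lookup_const when_def in_keys_iff)
  qed
  have "lookup (g f) 0 = lookup (hom_component q 0 (g f)) 0" by (simp add: lookup_hom_component)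
  also have "\<dots> = lookup f 0" unfolding Aut_hom_component[OF g f] c0 AutD(5)[OF g] by (simp add: lookup_const)
  finally show ?thesis using f AutD(1)[OF g f] by (simp add: irr_eq)
qed

lemma adjoin_image:
  assumes g: "g \<in> Aut" and I: "I \<subseteq> R" and x: "x \<in> R"
  shows "adjoin (g ` I) (g x) = g ` adjoin I x"
proof
  have eq: "g (a + x * b) = g a + g x * g b" if "a \<in> R" "b \<in> R" for a b
    using that x by (simp add: AutD(2,3)[OF g] R_mult)
  show "adjoin (g ` I) (g x) \<subseteq> g ` adjoin I x"
  proof
    fix y assume "y \<in> adjoin (g ` I) (g x)"
    then obtain a b where ab: "y = g a + g x * b" "a \<in> I" "b \<in> R" by (auto simp: adjoin_def)
    obtain b' where b': "b' \<in> R" "b = g b'" using ab(3) Aut_image_R[OF g] by blast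
    have "y = g (a + x * b')" using ab(1,2) b' eq[of a b'] I by auto
    then show "y \<in> g ` adjoin I x" using adjoinI[OF ab(2) b'(1)] by blast
  qed
  show "g ` adjoin I x \<subseteq> adjoin (g ` I) (g x)"
  proof
    fix y assume "y \<in> g ` adjoin I x"
    then obtain a b where ab: "y = g (a + x * b)" "a \<in> I" "b \<in> R" by (auto simp: adjoin_def)
    then have "y = g a + g x * g b" using eq[of a b] I by auto
    then show "y \<in> adjoin (g ` I) (g x)" using adjoinI[of "g a" "g ` I" "g b" "g x"] ab AutD(1)[OF g] by auto
  qed
qed

lemma adjoin_list_image:
  assumes g: "g \<in> Aut"
  shows "is_ideal I \<Longrightarrow> set xs \<subseteq> R \<Longrightarrow> adjoin_list (g ` I) (map g xs) = g ` adjoin_list I xs"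
proof (induction xs arbitrary: I)
  case (Cons x xs)
  have I: "I \<subseteq> R" using Cons.prems(1) by (auto dest: is_idealD(1))
  have x: "x \<in> R" using Cons.prems by simp
  then show ?case
    using Cons.IH[OF is_ideal_adjoin[OF Cons.prems(1) x]] Cons.prems adjoin_image[OF g I x] by simp
qed simp

lemma weakly_regular_image:
  assumes g: "g \<in> Aut"
  shows "is_ideal I \<Longrightarrow> set xs \<subseteq> R \<Longrightarrow> weakly_regular (g ` I) (map g xs) \<Longrightarrow> weakly_regular I xs"
proof (induction xs arbitrary: I)
  case (Cons x xs)
  have I: "I \<subseteq> R" using Cons.prems(1) by (auto dest: is_idealD(1))
  have x: "x \<in> R" using Cons.prems by simp
  have mem: "f \<in> I" if "f \<in> R" "g f \<in> g ` I" for f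
    using that I Aut_inj[OF g] by blast
  have "u \<in> I" if u: "u \<in> R" "x * u \<in> I" for u
  proof (rule mem[OF u(1)])
    have "g x * g u \<in> g ` I" using u(2) AutD(2)[OF g x u(1)] by (metis imageI)
    then show "g u \<in> g ` I" using Cons.prems(3) AutD(1)[OF g u(1)] by simp
  qed
  moreover have "weakly_regular (adjoin I x) xs"
    using Cons.IH[OF is_ideal_adjoin[OF Cons.prems(1) x]] Cons.prems adjoin_image[OF g I x] by simp
  ultimately show ?case by simp
qed simp

lemma depth_eq_via_Aut:
  assumes g: "g \<in> Aut" and I: "is_ideal I" "I \<noteq> R"
    and xs: "set xs \<subseteq> V" "weakly_regular (g ` I) (map indet xs)"
    and f: "f \<in> R" "f \<notin> adjoin_list (g ` I) (map indet xs)"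
      "\<And>v. v \<in> V \<Longrightarrow> indet v * f \<in> adjoin_list (g ` I) (map indet xs)"
  shows "depth (poly_ring n l) irr (quot_module (poly_ring n l) I) = enat (length xs)"
proof -
  define h where "h = inv_into R g"
  have h: "h y \<in> R" "g (h y) = y" if "y \<in> R" for y
    using that Aut_image_R[OF g] inv_into_into[of y g R] f_inv_into_f[of y g R] by (auto simp: h_def)
  have irrR: "irr \<subseteq> R" by (auto simp: irr_eq)
  have xR: "indet x \<in> R" if "x \<in> set xs" for x using that xs(1) indet_in_R by blast
  define ys where "ys = map (\<lambda>x. h (indet x)) xs"
  have gys: "map g ys = map indet xs" unfolding ys_def using h(2) xR by simp
  have ysR: "set ys \<subseteq> R" unfolding ys_def using h(1) xR by auto
  have gadj: "adjoin_list (g ` I) (map indet xs) = g ` adjoin_list I ys"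
    using adjoin_list_image[OF g I(1) ysR] gys by simp
  have K: "is_ideal (adjoin_list I ys)" by (rule is_ideal_adjoin_list[OF I(1) ysR])
  have "h (indet x) \<in> irr" if x: "x \<in> set xs" for x
  proof -
    have "x \<in> V" using x xs(1) by blast
    then have "indet x \<in> irr"
      using indet_in_R by (auto simp: irr_eq lookup_indet_0)
    then show ?thesis using Aut_irr_iff[OF g h(1)[OF xR[OF x]]] h(2)[OF xR[OF x]] by simp
  qed
  then have ysA: "set ys \<subseteq> irr" by (auto simp: ys_def)
  have gK: "is_ideal (g ` adjoin_list I ys)" by (rule is_ideal_image[OF g K])
  have "depth ring_on irr (quot_module ring_on I) = enat (length ys)"
  proof (rule depth_eq_if_socle[OF I(1) I(2) irrR ysA])
    show "weakly_regular I ys" using weakly_regular_image[OF g I(1) ysR] xs(2) gys by simp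
    show hf: "h f \<in> R" by (rule h(1)[OF f(1)])
    show "h f \<notin> adjoin_list I ys"
      using f(2) h(2)[OF f(1)] unfolding gadj by (metis imageI)
    show "y * h f \<in> adjoin_list I ys" if y: "y \<in> irr" for y
    proof -
      have yR: "y \<in> R" using y irrR by blast
      have "g y * f \<in> g ` adjoin_list I ys"
      proof (rule irr_mult_mem[OF gK f(1)])
        show "g y \<in> irr" using y Aut_irr_iff[OF g yR] by simp
        show "indet v * f \<in> g ` adjoin_list I ys" if "v \<in> V" for v
          using f(3)[OF that] unfolding gadj .
      qed
      moreover have "g (y * h f) = g y * f" using AutD(2)[OF g yR hf] h(2)[OF f(1)] by simp
      ultimately obtain z where z: "z \<in> adjoin_list I ys" "g (y * h f) = g z" by force
      have "y * h f = z" by (rule Aut_inj[OF g R_mult[OF yR hf] is_idealD(1)[OF K z(1)] z(2)])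
      then show ?thesis using z(1) by simp
    qed
  qed
  then show ?thesis by (simp add: poly_ring_eq ys_def)
qed

text \<open>Two nonempty open sets of automorphisms meet, so the constant value on the second one is the
  same.\<close>

theorem Gin_eq_monomial_ideal:
  assumes inf: "infinite (UNIV :: 'k set)" and I: "graded_ideal I"
    and p: "p \<in> Fn" "g0 \<in> Aut" "p g0 \<noteq> 0" "\<And>g. g \<in> Aut \<Longrightarrow> p g \<noteq> 0 \<Longrightarrow> leads (g ` I) = T"
  shows "Gin n l q I = monomial_ideal T"
  unfolding Gin_def
proof (rule the_equality)
  have init: "initial_ideal n l q (g ` I) = monomial_ideal T" if "g \<in> Aut" "p g \<noteq> 0" for g
    using initial_ideal_eq[OF graded_ideal_image[OF that(1) I]] p(4)[OF that] by simp
  obtain P0 where P0: "indets P0 \<subseteq> aut_coords n l q" "\<And>g. g \<in> Aut \<Longrightarrow> p g = eval_mpoly (aut_coord g) P0"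
    using p(1) unfolding Fn_def coordinate_functions_def by blast
  define U where "U = {g \<in> Aut. p g \<noteq> 0}"
  have "zariski_open_auts n l q U"
    unfolding zariski_open_auts_def U_def using P0 by (intro exI[of _ "{P0}"]) auto
  moreover have "U \<noteq> {}" using p(2,3) by (auto simp: U_def)
  moreover have "\<forall>g\<in>U. initial_ideal n l q (g ` I) = monomial_ideal T" using init by (auto simp: U_def)
  ultimately show "\<exists>U. zariski_open_auts n l q U \<and> U \<noteq> {} \<and>
      (\<forall>g\<in>U. initial_ideal n l q (g ` I) = monomial_ideal T)" by blast
  fix J assume "\<exists>U. zariski_open_auts n l q U \<and> U \<noteq> {} \<and> (\<forall>g\<in>U. initial_ideal n l q (g ` I) = J)"
  then obtain U' where U': "zariski_open_auts n l q U'" "U' \<noteq> {}" "\<And>g. g \<in> U' \<Longrightarrow> initial_ideal n l q (g ` I) = J"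
    by blast
  obtain Q where Q: "\<forall>p\<in>Q. indets p \<subseteq> aut_coords n l q"
    "U' = {g \<in> Aut. \<exists>p\<in>Q. eval_mpoly (aut_coord g) p \<noteq> 0}"
    using U'(1) unfolding zariski_open_auts_def by blast
  obtain g1 p1 where g1: "g1 \<in> Aut" "p1 \<in> Q" "eval_mpoly (aut_coord g1) p1 \<noteq> 0"
    using U'(2) unfolding Q(2) by blast
  have u1: "(\<lambda>g. eval_mpoly (aut_coord g) p1) \<in> Fn"
    unfolding Fn_def coordinate_functions_def using Q(1) g1(2) by blast
  have "\<exists>g\<in>Aut. eval_mpoly (aut_coord g) p1 \<noteq> 0 \<and> p g \<noteq> 0"
    by (rule Aut_irreducible[of "\<lambda>g. eval_mpoly (aut_coord g) p1" p g1 g0]) (fact inf u1 p(1) g1(1) p(2) g1(3) p(3))+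
  then obtain g where g: "g \<in> Aut" "eval_mpoly (aut_coord g) p1 \<noteq> 0" "p g \<noteq> 0" by blast
  have "g \<in> U'" unfolding Q(2) using g(1,2) g1(2) by blast
  from U'(3)[OF this] show "J = monomial_ideal T" using init[OF g(1,3)] by simp
qed

text \<open>If \<open>0 \<in> T\<close>, both quotients are zero. Otherwise the same variables \<open>xs\<close> compute both depths,
  via \<open>g\<close> for \<open>I\<close> and via the identity for the monomial ideal.\<close>

theorem depth_Gin:
  assumes inf: "infinite (UNIV :: 'k set)" and char0: "\<And>k. k > 0 \<Longrightarrow> of_nat k \<noteq> (0 :: 'k)"
    and dvd: "\<And>v w. v \<in> V \<Longrightarrow> w \<in> V \<Longrightarrow> fst v \<le> fst w \<Longrightarrow> q (fst v) dvd q (fst w)"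
    and I: "graded_ideal I"
  shows "depth (poly_ring n l) irr (quot_module (poly_ring n l) I) =
    depth (poly_ring n l) irr (quot_module (poly_ring n l) (Gin n l q I))"
proof -
  obtain T p where *: "p \<in> Fn \<and> (\<exists>g\<in>Aut. p g \<noteq> 0) \<and> (\<forall>g\<in>Aut. p g \<noteq> 0 \<longrightarrow> leads (g ` I) = T) \<and>
      (\<forall>h\<in>Aut. \<forall>m\<in>Mon. count_above (h ` I) m \<le> card (T \<inter> Up m))"
    using generic_leads_exist[OF inf I] by (elim exE)
  then have p: "p \<in> Fn" "\<exists>g\<in>Aut. p g \<noteq> 0" "\<And>g. g \<in> Aut \<Longrightarrow> p g \<noteq> 0 \<Longrightarrow> leads (g ` I) = T"
    and max: "\<And>h m. h \<in> Aut \<Longrightarrow> m \<in> Mon \<Longrightarrow> count_above (h ` I) m \<le> card (T \<inter> Up m)"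
    by simp_all
  obtain g where g: "g \<in> Aut" "p g \<noteq> 0" using p(2) by blast
  have Gin: "Gin n l q I = monomial_ideal T"
    by (rule Gin_eq_monomial_ideal[OF inf I p(1) g p(3)])
  have lT: "leads (g ` I) = T" by (rule p(3)[OF g])
  have gI: "graded_ideal (g ` I)" by (rule graded_ideal_image[OF g(1) I])
  note i = graded_idealD(1)[OF I]
  have T: "up_closed T" using up_closed_leads[OF graded_idealD(1)[OF gI]] lT by simp
  have M: "graded_ideal (monomial_ideal T)" by (rule graded_monomial_ideal[OF T])
  show ?thesis
  proof (cases "0 \<in> T")
    case True
    then have "g ` I = R" using one_in_graded_ideal[OF gI] lT by simp
    have "f \<in> I" if f: "f \<in> R" for f
    proof -
      have "g f \<in> g ` I" using \<open>g ` I = R\<close> AutD(1)[OF g(1) f] by simp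
      then obtain h where h: "h \<in> I" "g f = g h" by blast
      then show ?thesis using Aut_inj[OF g(1) f is_idealD(1)[OF i h(1)]] by simp
    qed
    then have "I = R" using is_idealD(1)[OF i] by blast
    moreover have "monomial_ideal T = R"
      using one_in_graded_ideal[OF M] True by (simp add: leads_monomial_ideal)
    ultimately show ?thesis
      unfolding Gin poly_ring_eq
      using depth_trivial[OF i] depth_trivial[OF graded_idealD(1)[OF M]] by simp
  next
    case False
    have "strongly_stable (leads (g ` I))"
    proof (rule strongly_stable_if_generic[OF inf char0 gI])
      fix b m assume b: "b \<in> Aut" and m: "m \<in> Mon"
      have "b ` g ` I = (\<lambda>f. b (g f)) ` I" by (simp add: image_image)
      then show "count_above (b ` g ` I) m \<le> card (leads (g ` I) \<inter> Up m)"
        unfolding lT using max[OF Aut_comp[OF b g(1)] m] by simp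
    qed
    then have stable: "strongly_stable T" by (simp only: lT)
    obtain xs where xs: "set xs \<subseteq> V"
      "\<And>J. graded_ideal J \<Longrightarrow> leads J = T \<Longrightarrow> weakly_regular J (map indet xs)"
      "\<And>J. graded_ideal J \<Longrightarrow> leads J = T \<Longrightarrow>
        \<exists>f\<in>R. f \<notin> adjoin_list J (map indet xs) \<and> (\<forall>v\<in>V. indet v * f \<in> adjoin_list J (map indet xs))"
      using stable_regular_socle[OF dvd stable False] by blast
    have depth: "depth (poly_ring n l) irr (quot_module (poly_ring n l) K) = enat (length xs)"
      if b: "b \<in> Aut" and K: "graded_ideal K" and lK: "leads (b ` K) = T" for b K
    proof -
      have bK: "graded_ideal (b ` K)" by (rule graded_ideal_image[OF b K])
      have "K \<noteq> R"
      proof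
        assume "K = R"
        then have "1 \<in> b ` K" using R1 Aut_image_R[OF b] by simp
        moreover have "lead (1 :: (var, 'k) mpoly) = 0" by (rule lead_mono_eqI) auto
        ultimately have "0 \<in> leads (b ` K)" using lead_in_leads[of 1 "b ` K"] by simp
        then show False using False lK by simp
      qed
      obtain f where f: "f \<in> R" "f \<notin> adjoin_list (b ` K) (map indet xs)"
        "\<And>v. v \<in> V \<Longrightarrow> indet v * f \<in> adjoin_list (b ` K) (map indet xs)"
        using xs(3)[OF bK lK] by blast
      show ?thesis
        by (rule depth_eq_via_Aut[OF b graded_idealD(1)[OF K] \<open>K \<noteq> R\<close> xs(1) xs(2)[OF bK lK] f])
    qed
    have "leads ((\<lambda>f. f) ` monomial_ideal T) = T" by (simp add: leads_monomial_ideal)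
    then show ?thesis
      unfolding Gin using depth[OF g(1) I lT] depth[OF id_Aut M] by simp
  qed
qed

end

lemma dvd_chain:
  fixes q :: "nat \<Rightarrow> nat"
  assumes "\<forall>i\<in>{1..<n}. q i dvd q (i + 1)" "1 \<le> i" "i \<le> j" "j \<le> n"
  shows "q i dvd q j"
  using assms(3,4)
proof (induction j rule: dec_induct)
  case (step j)
  then have "q j dvd q (j + 1)" using assms(1,2) by simp
  then show ?case using step dvd_trans[of "q i" "q j"] by simp
qed simp

theorem theorem2p7:
  fixes n :: nat and l q :: "nat \<Rightarrow> nat"
    and I :: "(var, 'k::field_char_0) mpoly set"
  assumes "\<forall>i\<in>{1..n}. 0 < q i"
    and "strict_mono_on {1..n} q"
    and "\<forall>i\<in>{1..<n}. q i dvd q (i + 1)"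
    and "homogeneous_ideal n l q I"
  shows "depth (poly_ring n l) (irrelevant_ideal n l) (quot_module (poly_ring n l) I) =
         depth (poly_ring n l) (irrelevant_ideal n l) (quot_module (poly_ring n l) (Gin n l q I))"
proof -
  interpret weighted_ring n l q "{f :: (var, 'k) mpoly. indets f \<subseteq> vars n l}"
    using assms(1) by unfold_locales auto
  show ?thesis
  proof (rule depth_Gin)
    show "infinite (UNIV :: 'k set)" by (rule infinite_UNIV_char_0)
    show "of_nat k \<noteq> (0 :: 'k)" if "k > 0" for k using that by simp
    show "q (fst v) dvd q (fst w)" if "v \<in> vars n l" "w \<in> vars n l" "fst v \<le> fst w" for v w
      using that by (intro dvd_chain[OF assms(3)]) (auto simp: vars_def)
    show "graded_ideal I" using assms(4) by (simp add: homogeneous_ideal_iff)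
  qed
qed

end
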